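(* Let $G$ be a finite group and suppose that $G/Z_\infty(G)$ is not an almost simple group. Then the Engel graph $\Gamma(G)$ is strongly connected if and only if $G/Z_\infty(G)$ is not a Frobenius group.
   Context: Commutators: $[a,b]=a^{-1}b^{-1}ab$, $[x,{}_0y]=x$, and $[x,{}_{i+1}y]=[[x,{}_iy],y]$ for $i\ge 0$. $Z_\infty(G)$ denotes the hypercenter of $G$ (the final term of the upper central series). The Engel graph $\Gamma(G)$ is the directed graph whose vertices are the elements of $G\setminus Z_\infty(G)$ and where there is an edge $x\mapsto y$ if and only if $[x,{}_ny]=1$ for some integer $n>0$. A directed graph is strongly connected if for every pair of vertices $(x,y)$ it contains a directed path from $x$ to $y$. (If $G$ is nilpotent, $\Gamma(G)$ is empty; the empty graph is regarded as strongly connected.) *)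

theory Defs
  imports
    "HOL-Algebra.SimpleGroups"
    "HOL-Algebra.Bij"
    "Graph_Theory.Digraph_Component"
begin

subsection \<open>Commutators\<close>

definition commutator :: "('a, 'b) monoid_scheme \<Rightarrow> 'a \<Rightarrow> 'a \<Rightarrow> 'a" where
  "commutator G a b = inv\<^bsub>G\<^esub> a \<otimes>\<^bsub>G\<^esub> inv\<^bsub>G\<^esub> b \<otimes>\<^bsub>G\<^esub> a \<otimes>\<^bsub>G\<^esub> b"

primrec engel_commutator :: "('a, 'b) monoid_scheme \<Rightarrow> 'a \<Rightarrow> nat \<Rightarrow> 'a \<Rightarrow> 'a" where
  "engel_commutator G x 0 y = x"
| "engel_commutator G x (Suc i) y = commutator G (engel_commutator G x i y) y"


subsection \<open>The hypercenter\<close>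

definition center :: "('a, 'b) monoid_scheme \<Rightarrow> 'a set" where
  "center G = {z \<in> carrier G. \<forall>g\<in>carrier G. z \<otimes>\<^bsub>G\<^esub> g = g \<otimes>\<^bsub>G\<^esub> z}"

text \<open>The term with index \<open>i + 1\<close> is the full preimage in \<open>G\<close> of the center of \<open>G / Z\<^sub>i\<close>.\<close>

primrec upper_central :: "('a, 'b) monoid_scheme \<Rightarrow> nat \<Rightarrow> 'a set" where
  "upper_central G 0 = {\<one>\<^bsub>G\<^esub>}"
| "upper_central G (Suc i) =
     {x \<in> carrier G. upper_central G i #>\<^bsub>G\<^esub> x \<in> center (G Mod upper_central G i)}"

text \<open>
  The series is ascending, so whenever it becomes stationary, in particular for finite \<open>G\<close>,
  the union is its final term (see \<open>hypercenter_eq_upper_central\<close> below). For infinite groups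
  this is only the term with index \<open>\<omega>\<close> of the transfinite series.
\<close>

definition hypercenter :: "('a, 'b) monoid_scheme \<Rightarrow> 'a set" where
  "hypercenter G = (\<Union>i. upper_central G i)"

lemma (in group) upper_central_Suc_iff:
  assumes "upper_central G i \<lhd> G"
  shows "x \<in> upper_central G (Suc i) \<longleftrightarrow>
    x \<in> carrier G \<and> (\<forall>g\<in>carrier G. upper_central G i #> (x \<otimes> g) = upper_central G i #> (g \<otimes> x))"
proof -
  interpret N: normal "upper_central G i" G by fact
  show ?thesis
    by (auto simp: center_def FactGroup_def RCOSETS_def N.rcos_sum)
qed

lemma (in group) upper_central_normal: "upper_central G i \<lhd> G"
proof (induction i)
  case 0
  show ?case by (simp add: one_is_normal)
next
  case (Suc i)
  let ?N = "upper_central G i"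
  interpret N: normal ?N G by fact
  note iff = upper_central_Suc_iff[OF Suc]
  have sub: "subgroup (upper_central G (Suc i)) G"
  proof (rule subgroupI)
    show "upper_central G (Suc i) \<subseteq> carrier G" by auto
    have "\<one> \<in> upper_central G (Suc i)" by (simp add: iff del: upper_central.simps)
    then show "upper_central G (Suc i) \<noteq> {}" by blast
  next
    fix a assume "a \<in> upper_central G (Suc i)"
    then have a: "a \<in> carrier G"
      and c: "\<And>g. g \<in> carrier G \<Longrightarrow> ?N #> (a \<otimes> g) = ?N #> (g \<otimes> a)"
      unfolding iff by blast+
    have "?N #> (inv a \<otimes> g) = ?N #> (g \<otimes> inv a)" if g: "g \<in> carrier G" for g
    proof -
      have "?N #> (inv a \<otimes> g) = (?N #> inv a) <#> (?N #> (g \<otimes> a)) <#> (?N #> inv a)"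
        using a g by (simp add: N.rcos_sum m_assoc)
      also have "\<dots> = (?N #> inv a) <#> (?N #> (a \<otimes> g)) <#> (?N #> inv a)"
        by (simp only: c[OF g])
      also have "\<dots> = ?N #> (g \<otimes> inv a)"
        using a g by (simp add: N.rcos_sum m_assoc[symmetric])
      finally show ?thesis .
    qed
    then show "inv a \<in> upper_central G (Suc i)" using a unfolding iff by blast
  next
    fix a b assume "a \<in> upper_central G (Suc i)" "b \<in> upper_central G (Suc i)"
    then have a: "a \<in> carrier G" and b: "b \<in> carrier G"
      and ca: "\<And>g. g \<in> carrier G \<Longrightarrow> ?N #> (a \<otimes> g) = ?N #> (g \<otimes> a)"
      and cb: "\<And>g. g \<in> carrier G \<Longrightarrow> ?N #> (b \<otimes> g) = ?N #> (g \<otimes> b)"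
      unfolding iff by blast+
    have "?N #> (a \<otimes> b \<otimes> g) = ?N #> (g \<otimes> (a \<otimes> b))" if g: "g \<in> carrier G" for g
    proof -
      have "?N #> (a \<otimes> b \<otimes> g) = (?N #> a) <#> (?N #> (b \<otimes> g))"
        using a b g by (simp add: N.rcos_sum m_assoc)
      also have "\<dots> = (?N #> a) <#> (?N #> (g \<otimes> b))"
        by (simp only: cb[OF g])
      also have "\<dots> = (?N #> (a \<otimes> g)) <#> (?N #> b)"
        using a b g by (simp add: N.rcos_sum m_assoc)
      also have "\<dots> = (?N #> (g \<otimes> a)) <#> (?N #> b)"
        by (simp only: ca[OF g])
      also have "\<dots> = ?N #> (g \<otimes> (a \<otimes> b))"
        using a b g by (simp add: N.rcos_sum m_assoc)
      finally show ?thesis .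
    qed
    then show "a \<otimes> b \<in> upper_central G (Suc i)" using a b unfolding iff by blast
  qed
  show ?case
  proof (rule normal_invI[OF sub])
    fix x h assume x: "x \<in> carrier G" and "h \<in> upper_central G (Suc i)"
    then have h: "h \<in> carrier G"
      and c: "\<And>g. g \<in> carrier G \<Longrightarrow> ?N #> (h \<otimes> g) = ?N #> (g \<otimes> h)"
      unfolding iff by blast+
    have eq: "?N #> (x \<otimes> h \<otimes> inv x) = ?N #> h"
    proof -
      have "?N #> (x \<otimes> h \<otimes> inv x) = (?N #> (x \<otimes> h)) <#> (?N #> inv x)"
        using x h by (simp add: N.rcos_sum)
      also have "\<dots> = (?N #> (h \<otimes> x)) <#> (?N #> inv x)"
        by (simp only: c[OF x])
      also have "\<dots> = ?N #> h"
        using x h by (simp add: N.rcos_sum m_assoc)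
      finally show ?thesis .
    qed
    have "?N #> (x \<otimes> h \<otimes> inv x \<otimes> g) = ?N #> (g \<otimes> (x \<otimes> h \<otimes> inv x))"
      if g: "g \<in> carrier G" for g
    proof -
      have "?N #> (x \<otimes> h \<otimes> inv x \<otimes> g) = (?N #> (x \<otimes> h \<otimes> inv x)) <#> (?N #> g)"
        using x h g by (simp add: N.rcos_sum)
      also have "\<dots> = (?N #> g) <#> (?N #> (x \<otimes> h \<otimes> inv x))"
        using h g c[OF g] by (simp only: eq N.rcos_sum)
      finally show ?thesis using x h g by (simp add: N.rcos_sum)
    qed
    then show "x \<otimes> h \<otimes> inv x \<in> upper_central G (Suc i)"
      using x h unfolding iff by blast
  qed
qed

lemma (in group) upper_central_mono:
  assumes "i \<le> j"
  shows "upper_central G i \<subseteq> upper_central G j"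
proof (rule lift_Suc_mono_le[OF _ assms])
  fix n
  let ?N = "upper_central G n"
  interpret N: normal ?N G by (rule upper_central_normal)
  show "?N \<subseteq> upper_central G (Suc n)"
  proof
    fix x assume x: "x \<in> ?N"
    then have xc: "x \<in> carrier G" using N.subset by blast
    have "?N #> (x \<otimes> g) = ?N #> (g \<otimes> x)" if g: "g \<in> carrier G" for g
    proof -
      have "?N #> (x \<otimes> g) = (?N #> x) <#> (?N #> g)" using xc g by (simp add: N.rcos_sum)
      also have "\<dots> = (?N #> g) <#> (?N #> x)"
        using x xc g N.rcos_sum[of \<one> g] N.rcos_sum[of g \<one>]
        by (simp add: coset_join2 N.subgroup_axioms)
      also have "\<dots> = ?N #> (g \<otimes> x)" using xc g by (simp add: N.rcos_sum)
      finally show ?thesis .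
    qed
    then show "x \<in> upper_central G (Suc n)"
      using xc unfolding upper_central_Suc_iff[OF upper_central_normal] by blast
  qed
qed

lemma (in group) hypercenter_eq_upper_central:
  assumes "finite (carrier G)"
  shows "\<exists>n. \<forall>m\<ge>n. upper_central G m = hypercenter G"
proof -
  have sub: "upper_central G i \<subseteq> carrier G" for i
    using normal_imp_subgroup[OF upper_central_normal] subgroup.subset by blast
  then have "finite (hypercenter G)"
    unfolding hypercenter_def by (intro finite_subset[OF _ assms]) blast
  define k where "k x = (LEAST i. x \<in> upper_central G i)" for x
  have k: "x \<in> upper_central G (k x)" if x: "x \<in> hypercenter G" for x
  proof -
    obtain i where "x \<in> upper_central G i" using x unfolding hypercenter_def UN_iff by blast
    then show ?thesis unfolding k_def by (rule LeastI)
  qed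
  have fin: "finite (k ` hypercenter G)"
    using \<open>finite (hypercenter G)\<close> by (rule finite_imageI)
  let ?n = "Max (k ` hypercenter G)"
  have "upper_central G m = hypercenter G" if m: "m \<ge> ?n" for m
  proof
    show "upper_central G m \<subseteq> hypercenter G"
      unfolding hypercenter_def by (rule UN_upper) (rule UNIV_I)
    show "hypercenter G \<subseteq> upper_central G m"
    proof
      fix x assume x: "x \<in> hypercenter G"
      have "k x \<le> ?n" using fin x by simp
      then have "k x \<le> m" using m by (rule order_trans)
      then show "x \<in> upper_central G m" by (rule subsetD[OF upper_central_mono k[OF x]])
    qed
  qed
  then show ?thesis by blast
qed


subsection \<open>The Engel graph\<close>

definition engel_graph :: "('a, 'b) monoid_scheme \<Rightarrow> ('a, 'a \<times> 'a) pre_digraph" where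
  "engel_graph G =
    \<lparr> verts = carrier G - hypercenter G,
      arcs = {(x, y). x \<in> carrier G - hypercenter G \<and> y \<in> carrier G - hypercenter G \<and>
                (\<exists>n>0. engel_commutator G x n y = \<one>\<^bsub>G\<^esub>)},
      tail = fst,
      head = snd \<rparr>"

text \<open>The constant \<open>strongly_connected\<close> requires a nonempty vertex set.\<close>

definition empty_or_strongly_connected :: "('a, 'b) pre_digraph \<Rightarrow> bool" where
  "empty_or_strongly_connected \<Gamma> \<longleftrightarrow> verts \<Gamma> = {} \<or> strongly_connected \<Gamma>"


subsection \<open>Almost simple groups and Frobenius groups\<close>

definition inner_auto :: "('a, 'b) monoid_scheme \<Rightarrow> ('a \<Rightarrow> 'a) set" where
  "inner_auto S = (\<lambda>g. \<lambda>x\<in>carrier S. g \<otimes>\<^bsub>S\<^esub> x \<otimes>\<^bsub>S\<^esub> inv\<^bsub>S\<^esub> g) ` carrier S"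

text \<open>
  \<open>G\<close> is almost simple if \<open>S \<le> G \<le> Aut S\<close> up to isomorphism for a nonabelian simple group \<open>S\<close>,
  where \<open>S\<close> is identified with the group of its inner automorphisms. Taking the elements of \<open>S\<close>
  from the element type of \<open>G\<close> loses no generality, because such an \<open>S\<close> embeds in \<open>G\<close>.
\<close>

definition almost_simple_group :: "('a, 'b) monoid_scheme \<Rightarrow> bool" where
  "almost_simple_group G \<longleftrightarrow>
    (\<exists>(S :: 'a monoid) A. simple_group S \<and> \<not> comm_group S \<and>
       subgroup A (AutoGroup S) \<and> inner_auto S \<subseteq> A \<and> G \<cong> (AutoGroup S)\<lparr>carrier := A\<rparr>)"

text \<open>\<open>H\<close> is a Frobenius complement: it meets its conjugates by elements outside \<open>H\<close> trivially.\<close>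

definition frobenius_group :: "('a, 'b) monoid_scheme \<Rightarrow> bool" where
  "frobenius_group G \<longleftrightarrow> group G \<and>
    (\<exists>H. subgroup H G \<and> H \<noteq> {\<one>\<^bsub>G\<^esub>} \<and> H \<noteq> carrier G \<and>
       (\<forall>g\<in>carrier G - H. H \<inter> (g <#\<^bsub>G\<^esub> H #>\<^bsub>G\<^esub> inv\<^bsub>G\<^esub> g) = {\<one>\<^bsub>G\<^esub>}))"

end

theory Submission
  imports Defs "HOL-Algebra.Group_Action" "HOL-Algebra.Sylow" "HOL-Algebra.Multiplicative_Group"
    "HOL-Number_Theory.Cong"
begin

text \<open>
  Edges of the Engel graph depend only on the images in \<open>K = G / Z\<^sub>\<infinity>(G)\<close>, so one works with the
  nontrivial elements of \<open>K\<close>. If \<open>K\<close> is Frobenius with complement \<open>H\<close>, no edge enters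
  \<open>H - {1}\<close> from outside.

  Conversely, every vertex has an edge into \<open>M - {1}\<close> for each normal subgroup \<open>M \<noteq> 1\<close>: if \<open>x\<close> commutes
  with no such element, it acts without fixed points on \<open>M\<close>, hence normalizes a Sylow subgroup of \<open>M\<close>,
  and \<open>[x, q, q] = 1\<close> for \<open>q\<close> in the center of the latter. If \<open>K\<close> is not almost simple, \<open>M\<close> can be
  chosen such that \<open>M - {1}\<close> is connected by commuting elements. Let \<open>B\<close> be the set of vertices
  that cannot be reached from \<open>M\<close>. It contains the nontrivial elements of the normalizer of \<open>\<langle>b\<rangle>\<close> for
  each \<open>b \<in> B\<close>, and its elements act on \<open>M\<close> without fixed points. If \<open>B\<close> contains an
  involution \<open>t\<close>, then \<open>t\<close> inverts \<open>M\<close> and the centralizer of \<open>t\<close> is a Frobenius complement. Otherwise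
  the normalizers of subgroups of prime order inside \<open>B \<union> {1}\<close> are groups of odd order that act without
  fixed points on an abelian group; such a group has at most one subgroup of each prime
  order, and this makes each of these normalizers a Frobenius complement.
\<close>

subsection \<open>Conjugation, normalizers, centralizers and cyclic subgroups\<close>

context group
begin

text \<open>If \<open>z\<close> normalizes \<open>cyc b\<close>, then \<open>[z, b]\<close> is a
  power of \<open>b\<close>, so \<open>[z, b, b] = 1\<close> and \<open>z\<close> has an edge to
  \<open>b\<close>. Hence the normalizer of \<open>cyc b\<close> for an unreachable \<open>b\<close>
  contains no reachable element; this gives the closure of \<open>B\<close>, and also the absence of
  fixed points on \<open>M\<close>, since commuting elements normalize. The obstacle is to show that
  such a normalizer meets its conjugates trivially. If an element \<open>z\<close> of prime order
  lies in two conjugate normalizers, their generators should lie in the normalizer of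
  \<open>cyc z\<close> and generate the same subgroup there, which is what uniqueness of subgroups
  of prime order provides. In even order it fails: \<open>SL(2,3)\<close> acts without fixed points
  on the plane over the field with five elements and has four subgroups of order 3. This is why
  involutions are treated apart. As \<open>M\<close> may be nonabelian, the abelian group acted upon
  is the center of a Sylow subgroup of \<open>M\<close> that \<open>b\<close> determines uniquely
  for the chosen prime. Almost simple groups are set apart because commuting elements need not
  connect a nonabelian simple normal subgroup with trivial centralizer.\<close>

definition conjug :: "'a \<Rightarrow> 'a \<Rightarrow> 'a" where
  "conjug g x = g \<otimes> x \<otimes> inv g"

lemma cancel_inv_left:
  assumes "x \<in> carrier G" "y \<in> carrier G"
  shows "inv x \<otimes> (x \<otimes> y) = y" "x \<otimes> (inv x \<otimes> y) = y"
  using assms by (simp_all flip: m_assoc)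

lemmas group_word_simps = m_assoc inv_mult_group cancel_inv_left

lemma conjug_closed [simp]: "g \<in> carrier G \<Longrightarrow> x \<in> carrier G \<Longrightarrow> conjug g x \<in> carrier G"
  by (simp add: conjug_def)

lemma conjug_mult:
  "\<lbrakk>g \<in> carrier G; x \<in> carrier G; y \<in> carrier G\<rbrakk> \<Longrightarrow> conjug g (x \<otimes> y) = conjug g x \<otimes> conjug g y"
  by (simp add: conjug_def group_word_simps)

lemma conjug_conjug:
  "\<lbrakk>g \<in> carrier G; h \<in> carrier G; x \<in> carrier G\<rbrakk> \<Longrightarrow> conjug g (conjug h x) = conjug (g \<otimes> h) x"
  by (simp add: conjug_def group_word_simps)

lemma conjug_one [simp]: "g \<in> carrier G \<Longrightarrow> conjug g \<one> = \<one>"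
  by (simp add: conjug_def)

lemma one_conjug [simp]: "x \<in> carrier G \<Longrightarrow> conjug \<one> x = x"
  by (simp add: conjug_def)

lemma conjug_inv:
  "\<lbrakk>g \<in> carrier G; x \<in> carrier G\<rbrakk> \<Longrightarrow> conjug g (inv x) = inv (conjug g x)"
  by (simp add: conjug_def group_word_simps)

lemma conjug_inv_conjug [simp]:
  assumes "g \<in> carrier G" "x \<in> carrier G"
  shows "conjug (inv g) (conjug g x) = x" "conjug g (conjug (inv g) x) = x"
  using assms by (simp_all add: conjug_conjug)

lemma conjug_eq_iff:
  "\<lbrakk>g \<in> carrier G; x \<in> carrier G; y \<in> carrier G\<rbrakk> \<Longrightarrow> conjug g x = conjug g y \<longleftrightarrow> x = y"
  by (metis conjug_inv_conjug(1))

lemma conjug_eq_one_iff: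
  "\<lbrakk>g \<in> carrier G; x \<in> carrier G\<rbrakk> \<Longrightarrow> conjug g x = \<one> \<longleftrightarrow> x = \<one>"
  by (metis conjug_eq_iff conjug_one one_closed)

lemma conjug_fix_iff:
  assumes "g \<in> carrier G" "x \<in> carrier G"
  shows "conjug g x = x \<longleftrightarrow> g \<otimes> x = x \<otimes> g"
  using assms by (simp add: conjug_def inv_solve_right')

lemma conjug_pow:
  "\<lbrakk>g \<in> carrier G; x \<in> carrier G\<rbrakk> \<Longrightarrow> conjug g (x [^] (n::nat)) = conjug g x [^] n"
  by (induction n) (simp_all add: conjug_mult)

lemma ord_conjug:
  assumes "g \<in> carrier G" "x \<in> carrier G"
  shows "ord (conjug g x) = ord x"
  using assms by (simp add: ord_unique flip: conjug_pow) (simp add: conjug_eq_one_iff pow_eq_id)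

lemma inj_on_conjug: "g \<in> carrier G \<Longrightarrow> A \<subseteq> carrier G \<Longrightarrow> inj_on (conjug g) A"
  by (auto simp: inj_on_def conjug_eq_iff subset_iff)

lemma subgroup_conjug:
  assumes "g \<in> carrier G" "subgroup H G"
  shows "subgroup (conjug g ` H) G"
proof -
  interpret H: subgroup H G by fact
  show ?thesis
  proof (rule subgroupI)
    show "conjug g ` H \<noteq> {}" using H.one_closed by blast
    show "inv y \<in> conjug g ` H" if "y \<in> conjug g ` H" for y
      using that assms by (auto simp: H.mem_carrier simp flip: conjug_inv)
    show "y \<otimes> z \<in> conjug g ` H" if "y \<in> conjug g ` H" "z \<in> conjug g ` H" for y z
      using that assms by (auto simp: H.mem_carrier simp flip: conjug_mult)
  qed (use assms in \<open>auto simp: H.mem_carrier\<close>)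
qed

lemma subgroup_pow_closed: "subgroup H G \<Longrightarrow> x \<in> H \<Longrightarrow> x [^] (n::nat) \<in> H"
  by (induction n) (auto simp: subgroup.one_closed subgroup.m_closed)

text \<open>Only an inclusion is asked for. On a finite subset of the carrier conjugation is
  injective, so it becomes an equality (\<open>conjug_image_eq\<close>) and this is the
  normalizer.\<close>

definition setnorm :: "'a set \<Rightarrow> 'a set" where
  "setnorm A = {g \<in> carrier G. conjug g ` A \<subseteq> A}"

definition cent :: "'a set \<Rightarrow> 'a set" where
  "cent A = {g \<in> carrier G. \<forall>x\<in>A. g \<otimes> x = x \<otimes> g}"

lemma cent_subset: "cent A \<subseteq> carrier G"
  by (auto simp: cent_def)

lemma centD: "g \<in> cent A \<Longrightarrow> x \<in> A \<Longrightarrow> g \<otimes> x = x \<otimes> g"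
  unfolding cent_def by blast

lemma centI: "g \<in> carrier G \<Longrightarrow> (\<And>x. x \<in> A \<Longrightarrow> g \<otimes> x = x \<otimes> g) \<Longrightarrow> g \<in> cent A"
  unfolding cent_def by blast

lemma subgroup_cent:
  assumes "A \<subseteq> carrier G"
  shows "subgroup (cent A) G"
proof (rule subgroupI)
  show "cent A \<noteq> {}" using assms by (auto simp: cent_def subset_iff intro!: exI[of _ \<one>])
next
  fix a assume a: "a \<in> cent A"
  have "inv a \<otimes> x = x \<otimes> inv a" if "x \<in> A" for x
  proof -
    have "conjug a x = x" using a that assms by (subst conjug_fix_iff) (auto simp: cent_def)
    then have "conjug (inv a) x = x" using conjug_inv_conjug(1)[of a x] a that assms by (auto simp: cent_def)
    then show ?thesis using a that assms by (subst (asm) conjug_fix_iff) (auto simp: cent_def)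
  qed
  then show "inv a \<in> cent A" using a by (auto simp: cent_def)
next
  fix a b assume ab: "a \<in> cent A" "b \<in> cent A"
  have "a \<otimes> b \<otimes> x = x \<otimes> (a \<otimes> b)" if "x \<in> A" for x
  proof -
    have c: "a \<in> carrier G" "b \<in> carrier G" "x \<in> carrier G" "a \<otimes> x = x \<otimes> a" "b \<otimes> x = x \<otimes> b"
      using ab that assms by (auto simp: cent_def)
    have "a \<otimes> b \<otimes> x = a \<otimes> (x \<otimes> b)" using c by (simp add: m_assoc)
    also have "\<dots> = a \<otimes> x \<otimes> b" using c(1-3) by (simp only: m_assoc)
    also have "\<dots> = x \<otimes> (a \<otimes> b)" using c(1-3) by (simp only: c(4) m_assoc)
    finally show ?thesis .
  qed
  then show "a \<otimes> b \<in> cent A" using ab by (auto simp: cent_def)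
qed (auto simp: cent_def)

lemma conjug_image_eq:
  assumes "finite A" "A \<subseteq> carrier G" "g \<in> setnorm A"
  shows "conjug g ` A = A"
proof (rule card_subset_eq)
  show "conjug g ` A \<subseteq> A" using assms by (auto simp: setnorm_def)
  show "card (conjug g ` A) = card A"
    using assms by (intro card_image inj_on_conjug) (auto simp: setnorm_def)
qed fact

lemma subgroup_setnorm:
  assumes "finite A" "A \<subseteq> carrier G"
  shows "subgroup (setnorm A) G"
proof (rule subgroupI)
  have "\<one> \<in> setnorm A" using assms by (auto simp: setnorm_def subset_iff)
  then show "setnorm A \<noteq> {}" by blast
next
  fix a assume a: "a \<in> setnorm A"
  then have ac: "a \<in> carrier G" by (simp add: setnorm_def)
  have "conjug (inv a) x \<in> A" if x: "x \<in> A" for x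
  proof -
    obtain y where "y \<in> A" "x = conjug a y"
      using conjug_image_eq[OF assms a] x by (metis imageE)
    then show ?thesis using ac assms by auto
  qed
  then show "inv a \<in> setnorm A" using ac by (auto simp: setnorm_def)
next
  fix a b assume ab: "a \<in> setnorm A" "b \<in> setnorm A"
  have "conjug (a \<otimes> b) x \<in> A" if x: "x \<in> A" for x
  proof -
    have "conjug (a \<otimes> b) x = conjug a (conjug b x)"
      using ab x assms by (subst conjug_conjug) (auto simp: setnorm_def)
    then show ?thesis using ab x by (auto simp: setnorm_def)
  qed
  then show "a \<otimes> b \<in> setnorm A" using ab by (auto simp: setnorm_def)
qed (auto simp: setnorm_def)

lemma setnormD: "g \<in> setnorm A \<Longrightarrow> x \<in> A \<Longrightarrow> conjug g x \<in> A"
  by (auto simp: setnorm_def)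

lemma setnormI: "g \<in> carrier G \<Longrightarrow> (\<And>x. x \<in> A \<Longrightarrow> conjug g x \<in> A) \<Longrightarrow> g \<in> setnorm A"
  by (auto simp: setnorm_def)

lemma card_dvd_of_subset:
  assumes "subgroup H G" "subgroup K G" "H \<subseteq> K"
  shows "card H dvd card K"
proof -
  interpret K: group "G\<lparr>carrier := K\<rparr>" by (rule subgroup_imp_group) fact
  have "subgroup H (G\<lparr>carrier := K\<rparr>)" using assms by (simp add: subgroup_incl)
  from K.lagrange[OF this] show ?thesis by (simp add: order_def) (metis dvd_triv_right)
qed

definition cyc :: "'a \<Rightarrow> 'a set" where
  "cyc a = generate G {a}"

lemma subgroup_cyc: "a \<in> carrier G \<Longrightarrow> subgroup (cyc a) G"
  by (simp add: cyc_def generate_is_subgroup)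

lemma in_cyc [simp]: "a \<in> cyc a"
  by (simp add: cyc_def generate.incl)

lemma cyc_subset: "subgroup H G \<Longrightarrow> a \<in> H \<Longrightarrow> cyc a \<subseteq> H"
  by (simp add: cyc_def generate_subgroup_incl)

lemma card_cyc: "a \<in> carrier G \<Longrightarrow> card (cyc a) = ord a"
  by (simp add: cyc_def generate_pow_card)

lemma cyc_eq:
  assumes "finite (carrier G)" "a \<in> carrier G"
  shows "cyc a = range (\<lambda>n::nat. a [^] n)"
  using generate_pow_on_finite_carrier[OF assms] by (auto simp: cyc_def)

lemma cyc_ne_one: "a \<noteq> \<one> \<Longrightarrow> cyc a \<noteq> {\<one>}"
proof
  assume "a \<noteq> \<one>" "cyc a = {\<one>}"
  with in_cyc[of a] show False by blast
qed

lemma prime_ord_ne_one: "prime (ord a) \<Longrightarrow> a \<noteq> \<one>"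
proof
  assume "prime (ord a)" "a = \<one>"
  then show False using ord_id by (metis not_prime_1)
qed

lemma cyc_eq_subgroup:
  assumes fin: "finite (carrier G)" and H: "subgroup H G" "card H = p" "prime p"
    and a: "a \<in> H" "a \<noteq> \<one>"
  shows "cyc a = H"
proof -
  have sub: "cyc a \<subseteq> H" and ac: "a \<in> carrier G"
    using cyc_subset[OF H(1) a(1)] subgroup.mem_carrier[OF H(1) a(1)] by auto
  have fH: "finite H" using fin H subgroup.subset finite_subset by blast
  have "card (cyc a) dvd p" using card_dvd_of_subset[OF subgroup_cyc H(1) sub] ac H by auto
  moreover have "card (cyc a) \<noteq> 1" using ac a card_cyc ord_eq_1 by metis
  ultimately have "card (cyc a) = card H" using H prime_nat_iff by metis
  then show ?thesis using sub fH card_subset_eq by blast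
qed

lemma cyc_eq_cyc:
  assumes fin: "finite (carrier G)" and a: "a \<in> carrier G" "prime (ord a)" and b: "b \<in> cyc a" "b \<noteq> \<one>"
  shows "cyc b = cyc a" "ord b = ord a"
proof -
  show 1: "cyc b = cyc a"
    using cyc_eq_subgroup[OF fin subgroup_cyc[OF a(1)] _ a(2) b] a by (simp add: card_cyc)
  have "b \<in> carrier G" using subgroup.mem_carrier[OF subgroup_cyc[OF a(1)] b(1)] .
  then show "ord b = ord a" using 1 a card_cyc[of a] card_cyc[of b] by simp
qed

lemma conjug_cyc:
  assumes "finite (carrier G)" "g \<in> carrier G" "a \<in> carrier G"
  shows "conjug g ` cyc a = cyc (conjug g a)"
  using assms by (auto simp: cyc_eq conjug_pow image_image)

lemma setnorm_cyc_iff: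
  assumes "finite (carrier G)" "a \<in> carrier G"
  shows "g \<in> setnorm (cyc a) \<longleftrightarrow> g \<in> carrier G \<and> conjug g a \<in> cyc a"
proof
  assume "g \<in> setnorm (cyc a)"
  then show "g \<in> carrier G \<and> conjug g a \<in> cyc a" by (auto simp: setnorm_def)
next
  assume g: "g \<in> carrier G \<and> conjug g a \<in> cyc a"
  then have "conjug g ` cyc a \<subseteq> cyc a"
    using assms by (simp add: conjug_cyc cyc_subset subgroup_cyc)
  then show "g \<in> setnorm (cyc a)" using g by (simp add: setnorm_def)
qed

lemma commute_in_setnorm_cyc:
  assumes "finite (carrier G)" "a \<in> carrier G" "g \<in> carrier G" "g \<otimes> a = a \<otimes> g"
  shows "g \<in> setnorm (cyc a)"
  using assms by (metis setnorm_cyc_iff conjug_fix_iff in_cyc)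

lemma finite_cyc: "finite (carrier G) \<Longrightarrow> a \<in> carrier G \<Longrightarrow> finite (cyc a)"
  using finite_subset[OF subgroup.subset[OF subgroup_cyc]] .

lemma subgroup_setnorm_cyc:
  assumes "finite (carrier G)" "a \<in> carrier G"
  shows "subgroup (setnorm (cyc a)) G"
  by (rule subgroup_setnorm) (simp_all add: assms finite_cyc subgroup_cyc subgroup.subset)

text \<open>For a prime factor \<open>p\<close> of \<open>ord x\<close>, the power with exponent
  \<open>ord x div p\<close> has order \<open>p\<close>. Later arguments use it to replace an
  element by one of prime order that lies in the same subgroups.\<close>

lemma exists_prime_power:
  assumes fin: "finite (carrier G)" and x: "x \<in> carrier G" "x \<noteq> \<one>"
  obtains n :: nat where "prime (ord (x [^] n))"
proof -
  have "ord x \<noteq> 1" using x ord_eq_1 by metis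
  then obtain p where p: "prime p" "p dvd ord x" using prime_factor_nat by blast
  have "ord x > 0" using ord_ge_1[OF fin] x by force
  with p have "ord (x [^] (ord x div p)) = ord x div (ord x div p)"
    using x by (intro ord_pow) (auto simp: div_dvd_iff_mult dvd_div_eq_0_iff)
  also have "\<dots> = p" using p \<open>ord x > 0\<close> by (auto elim!: dvdE)
  finally show ?thesis using p that by metis
qed

lemma ord_eq_prime:
  assumes "x \<in> carrier G" "x \<noteq> \<one>" "x [^] p = \<one>" "prime (p::nat)"
  shows "ord x = p"
proof -
  have "ord x dvd p" using assms by (simp add: pow_eq_id[symmetric])
  then show ?thesis using assms by (metis prime_nat_iff ord_eq_1)
qed

end

subsection \<open>Actions of groups of prime power order\<close>

text \<open>Orbit counting: the size of an orbit divides \<open>p ^ n\<close>, so an orbit that is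
  not a single fixed point contributes a multiple of \<open>p\<close>.\<close>

lemma (in group_action) fixed_points_cong:
  assumes "finite E" "order G = p ^ n" "prime (p::nat)"
  shows "[card E = card {x \<in> E. \<forall>g\<in>carrier G. \<phi> g x = x}] (mod p)"
proof -
  interpret group G using group_hom group_hom.axioms by blast
  let ?F = "{x \<in> E. \<forall>g\<in>carrier G. \<phi> g x = x}"
  let ?O = "orbits G E \<phi>"
  have finO: "finite ?O" using assms(1) by (simp add: orbits_def setcompr_eq_image)
  have sing: "orbit G \<phi> x = {x}" if "x \<in> ?F" for x
    using that one_closed by (auto simp: orbit_def intro!: exI[of _ \<one>])
  have *: "p dvd card Q" if "Q \<in> ?O" "\<not> Q \<subseteq> ?F" for Q
  proof -
    obtain x where x: "x \<in> E" "Q = orbit G \<phi> x" using \<open>Q \<in> ?O\<close> by (auto simp: orbits_def)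
    have "card Q dvd p ^ n" using orbit_stabilizer_theorem[OF x(1)] assms x by (metis dvd_triv_left)
    moreover have "card Q \<noteq> 1"
    proof
      assume "card Q = 1"
      then obtain y where y: "Q = {y}" by (rule card_1_singletonE)
      then have "x = y" using orbit_refl[OF x(1)] x by simp
      then have "\<forall>g\<in>carrier G. \<phi> g x = x" using x y unfolding orbit_def by blast
      then show False using x y \<open>x = y\<close> that by auto
    qed
    ultimately show ?thesis using assms(3) by (metis divides_primepow_nat dvd_power gr_zeroI power_0)
  qed
  have "card E = (\<Sum>Q\<in>?O. card Q)" using disjoint_sum[OF assms(1), of "\<lambda>_. 1::nat"] by simp
  also have "\<dots> = (\<Sum>Q\<in>{Q\<in>?O. Q \<subseteq> ?F}. card Q) + (\<Sum>Q\<in>{Q\<in>?O. \<not> Q \<subseteq> ?F}. card Q)"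
    using finO by (subst sum.union_disjoint[symmetric]) (auto intro!: sum.cong)
  also have "{Q\<in>?O. Q \<subseteq> ?F} = (\<lambda>x. {x}) ` ?F" (is "?L = ?R")
  proof
    show "?R \<subseteq> ?L" using sing by (auto simp: orbits_def)
    show "?L \<subseteq> ?R"
    proof
      fix Q assume Q: "Q \<in> ?L"
      then obtain x where x: "x \<in> E" "Q = orbit G \<phi> x" by (auto simp: orbits_def)
      then have "x \<in> ?F" using Q orbit_refl by blast
      then have "Q = {x}" using sing[of x] x(2) by (simp only:)
      then show "Q \<in> ?R" using \<open>x \<in> ?F\<close> by (rule image_eqI)
    qed
  qed
  also have "(\<Sum>Q\<in>(\<lambda>x. {x}) ` ?F. card Q) = card ?F"
    by (subst sum.reindex) simp_all
  finally have "card E = card ?F + (\<Sum>Q\<in>{Q\<in>?O. \<not> Q \<subseteq> ?F}. card Q)" .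
  moreover have "p dvd (\<Sum>Q\<in>{Q\<in>?O. \<not> Q \<subseteq> ?F}. card Q)" using * by (intro dvd_sum) auto
  ultimately show ?thesis by (auto simp: cong_def elim!: dvdE)
qed

context group
begin

text \<open>The action is a plain function here so that conjugation and translation of cosets can be
  plugged in directly. Restricting it to \<open>E\<close> produces the extensional maps of which
  \<open>Bij E\<close> consists, with \<open>f (inv g)\<close> as the inverse of
  \<open>f g\<close>.\<close>

lemma p_group_fixed_points:
  assumes P: "subgroup P G" "card P = p ^ n" "prime (p::nat)" and E: "finite E"
    and act: "\<And>g x. g \<in> P \<Longrightarrow> x \<in> E \<Longrightarrow> f g x \<in> E" "\<And>x. x \<in> E \<Longrightarrow> f \<one> x = x"
      "\<And>g h x. g \<in> P \<Longrightarrow> h \<in> P \<Longrightarrow> x \<in> E \<Longrightarrow> f (g \<otimes> h) x = f g (f h x)"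
  shows "[card E = card {x \<in> E. \<forall>g\<in>P. f g x = x}] (mod p)"
proof -
  interpret P: subgroup P G by fact
  let ?P = "G\<lparr>carrier := P\<rparr>" and ?\<phi> = "\<lambda>g. \<lambda>x\<in>E. f g x"
  interpret GP: group ?P using P by (simp add: subgroup_imp_group)
  have bij: "?\<phi> g \<in> Bij E" if g: "g \<in> P" for g
  proof -
    have "f (inv g) (f g x) = x" "f g (f (inv g) x) = x" if "x \<in> E" for x
      using act(3)[of "inv g" g x, symmetric] act(3)[of g "inv g" x, symmetric] act(2) that g
      by (simp_all add: P.mem_carrier)
    then have "bij_betw (?\<phi> g) E E"
      by (intro bij_betw_byWitness[where f' = "f (inv g)"]) (use act g in auto)
    then show ?thesis by (auto simp: Bij_def)
  qed
  have "group_action ?P E ?\<phi>"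
    unfolding group_action_def
  proof (intro group_hom.intro GP.group_axioms group_BijGroup group_hom_axioms.intro homI)
    fix g h assume gh: "g \<in> carrier ?P" "h \<in> carrier ?P"
    then show "?\<phi> (g \<otimes>\<^bsub>?P\<^esub> h) = ?\<phi> g \<otimes>\<^bsub>BijGroup E\<^esub> ?\<phi> h"
      using bij act by (auto simp: BijGroup_def compose_def fun_eq_iff)
  qed (use bij in \<open>auto simp: BijGroup_def\<close>)
  then interpret A: group_action ?P E ?\<phi> .
  have "{x \<in> E. \<forall>g\<in>carrier ?P. ?\<phi> g x = x} = {x \<in> E. \<forall>g\<in>P. f g x = x}" by auto
  then show ?thesis using A.fixed_points_cong[OF E _ P(3), of n] P by (simp add: order_def)
qed

text \<open>For conjugation of \<open>P\<close> on itself the fixed points form the center. Their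
  number is divisible by \<open>p\<close> and they include the unit, so there is another
  one.\<close>

lemma p_group_center:
  assumes P: "subgroup P G" "card P = p ^ n" "prime (p::nat)" "P \<noteq> {\<one>}"
  obtains z where "z \<in> P" "z \<noteq> \<one>" "\<And>x. x \<in> P \<Longrightarrow> x \<otimes> z = z \<otimes> x"
proof -
  interpret P: subgroup P G by fact
  have "finite P" using P by (metis card.infinite not_prime_0 power_not_zero)
  let ?Z = "{z \<in> P. \<forall>g\<in>P. conjug g z = z}"
  have "[card P = card ?Z] (mod p)"
    by (rule p_group_fixed_points[OF P(1-3) \<open>finite P\<close>])
      (simp_all add: conjug_conjug P.mem_carrier, simp add: conjug_def)
  moreover have "n \<noteq> 0"
  proof
    assume "n = 0"
    then have "card P = 1" using P by simp
    then show False using P(4) P.one_closed by (metis card_1_singletonE singletonD)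
  qed
  ultimately have "p dvd card ?Z" using P cong_dvd_iff[of "card P" "card ?Z" p] by auto
  moreover have "\<one> \<in> ?Z" by (simp add: P.mem_carrier)
  ultimately have "?Z \<noteq> {\<one>}" using P(3) by force
  with \<open>\<one> \<in> ?Z\<close> obtain z where z: "z \<in> ?Z" "z \<noteq> \<one>" by blast
  then have "x \<otimes> z = z \<otimes> x" if "x \<in> P" for x
    using that conjug_fix_iff[of x z] by (simp add: P.mem_carrier)
  with z show ?thesis using that by blast
qed

section \<open>Sylow subgroups and their conjugacy inside a subgroup\<close>

lemma sylow_subgroup_exists:
  assumes Y: "subgroup Y G" "finite Y" "prime (p::nat)" "p ^ n dvd card Y"
  obtains P where "subgroup P G" "P \<subseteq> Y" "card P = p ^ n"
proof -
  let ?Y = "G\<lparr>carrier := Y\<rparr>"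
  obtain m where "card Y = p ^ n * m" using Y by (auto elim: dvdE)
  then obtain P where "subgroup P ?Y" "card P = p ^ n"
    using sylow_thm[of p ?Y n m] Y subgroup_imp_group by (auto simp: order_def)
  then show ?thesis using that[of P] incl_subgroup[OF Y(1)] subgroup.subset by fastforce
qed

lemma cauchy:
  assumes "subgroup Y G" "finite Y" "prime (p::nat)" "p dvd card Y"
  obtains x where "x \<in> Y" "ord x = p"
proof -
  obtain P where P: "subgroup P G" "P \<subseteq> Y" "card P = p ^ 1"
    using sylow_subgroup_exists[of Y p 1] assms by auto
  have "P \<noteq> {\<one>}" using P assms(3) by force
  then obtain x where x: "x \<in> P" "x \<noteq> \<one>"
    using subgroup.one_closed[OF P(1)] by blast
  have xc: "x \<in> carrier G" using subgroup.mem_carrier[OF P(1) x(1)] .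
  have "ord x dvd p"
    using card_dvd_of_subset[OF subgroup_cyc[OF xc] P(1) cyc_subset[OF P(1) x(1)]] P by (simp add: card_cyc xc)
  moreover have "ord x \<noteq> 1" using x xc ord_eq_1 by metis
  ultimately have "ord x = p" using assms(3) prime_nat_iff by metis
  then show ?thesis using that P x by blast
qed

text \<open>\<open>P\<close> acts on the right cosets of \<open>Q\<close>, whose number is prime to
  \<open>p\<close>, so some coset \<open>Q t\<close> is fixed, and this says that
  \<open>t P t^-1\<close> lies in \<open>Q\<close>. Here \<open>P\<close> may be any subgroup of
  \<open>p\<close>-power order, while \<open>Q\<close> is Sylow.\<close>

lemma sylow_conjugate_carrier:
  assumes fin: "finite (carrier G)" and p: "prime (p::nat)"
    and P: "subgroup P G" "card P = p ^ a" and Q: "subgroup Q G" "card Q = p ^ b" "\<not> p ^ Suc b dvd order G"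
  obtains g where "g \<in> carrier G" "conjug g ` P \<subseteq> Q"
proof -
  interpret P: subgroup P G by fact
  interpret Q: subgroup Q G by fact
  let ?E = "rcosets Q"
  \<comment> \<open>The inverse turns right translation of cosets into a left action.\<close>
  let ?f = "\<lambda>g C. C #> inv g"
  have finE: "finite ?E" using fin by (simp add: RCOSETS_def)
  have sub: "C \<subseteq> carrier G" if "C \<in> ?E" for C using that rcosets_part_G[OF Q(1)] by blast
  have clo: "C #> g \<in> ?E" if "C \<in> ?E" "g \<in> carrier G" for C g
  proof -
    obtain t where "t \<in> carrier G" "C = Q #> t" using \<open>C \<in> ?E\<close> by (auto simp: RCOSETS_def)
    then have "C #> g = Q #> (t \<otimes> g)" "t \<otimes> g \<in> carrier G"
      using \<open>g \<in> carrier G\<close> by (simp_all add: coset_mult_assoc Q.subset)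
    then show ?thesis using rcosetsI[OF Q.subset] by simp
  qed
  have "[card ?E = card {C \<in> ?E. \<forall>g\<in>P. ?f g C = C}] (mod p)"
  proof (rule p_group_fixed_points[OF P p finE])
    show "?f g C \<in> ?E" if "g \<in> P" "C \<in> ?E" for g C using that clo by simp
    show "?f \<one> C = C" if "C \<in> ?E" for C using that sub by simp
    show "?f (g \<otimes> h) C = ?f g (?f h C)" if "g \<in> P" "h \<in> P" "C \<in> ?E" for g h C
      using that sub by (simp add: coset_mult_assoc inv_mult_group)
  qed
  moreover have "\<not> p dvd card ?E"
  proof
    assume "p dvd card ?E"
    then have "p * p ^ b dvd card ?E * card Q" using Q by simp
    then show False using Q(3) unfolding lagrange[OF Q(1)] by simp
  qed
  ultimately have "\<not> p dvd card {C \<in> ?E. \<forall>g\<in>P. ?f g C = C}" by (simp add: cong_dvd_iff)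
  then have "{C \<in> ?E. \<forall>g\<in>P. ?f g C = C} \<noteq> {}" by (metis card.empty dvd_0_right)
  then obtain C where C: "C \<in> ?E" "\<And>g. g \<in> P \<Longrightarrow> ?f g C = C" by blast
  then obtain t where t: "t \<in> carrier G" "C = Q #> t" by (auto simp: RCOSETS_def)
  have "conjug t g \<in> Q" if g: "g \<in> P" for g
  proof -
    have gc: "g \<in> carrier G" using g by auto
    have "C #> g = C" using C(2)[of "inv g"] g by (simp add: P.mem_carrier)
    then have "Q #> (t \<otimes> g) = Q #> t" using t gc by (simp add: coset_mult_assoc Q.subset)
    then have "t \<otimes> g \<in> Q #> t" using t gc Q by (metis m_closed rcos_self)
    then show ?thesis unfolding conjug_def using Q.rcos_module_imp[OF group_axioms t(1)] by blast
  qed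
  then show ?thesis using that t by blast
qed

lemma sylow_conjugate:
  assumes Y: "subgroup Y G" "finite Y" and p: "prime (p::nat)"
    and P: "subgroup P G" "P \<subseteq> Y" "card P = p ^ a"
    and Q: "subgroup Q G" "Q \<subseteq> Y" "card Q = p ^ b" "\<not> p ^ Suc b dvd card Y"
  obtains g where "g \<in> Y" "conjug g ` P \<subseteq> Q"
proof -
  let ?Y = "G\<lparr>carrier := Y\<rparr>"
  interpret Y: group ?Y using Y by (simp add: subgroup_imp_group)
  have "subgroup P ?Y" "subgroup Q ?Y" using Y P Q by (simp_all add: subgroup_incl)
  then obtain g where g: "g \<in> Y" "Y.conjug g ` P \<subseteq> Q"
    using Y.sylow_conjugate_carrier[of p P a Q b] Y p P Q by (auto simp: order_def)
  have "Y.conjug g x = conjug g x" for x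
    using g m_inv_consistent[OF Y(1)] by (simp add: conjug_def Y.conjug_def)
  then show ?thesis using g that by (metis (no_types, lifting) image_cong)
qed

subsection \<open>The transfer and abelian groups of odd prime power order\<close>

text \<open>This is the transfer into the abelian subgroup \<open>R\<close>: the product of
  \<open>rep C g rep(C g)^-1\<close> over all cosets \<open>C\<close>. It is multiplicative because
  right translation by \<open>g\<close> permutes the cosets. A central \<open>x\<close> in
  \<open>R\<close> fixes every coset, so each factor equals \<open>x\<close>.\<close>

lemma transfer_hom:
  assumes fin: "finite (carrier G)" and R: "subgroup R G"
    and comm: "\<And>x y. x \<in> R \<Longrightarrow> y \<in> R \<Longrightarrow> x \<otimes> y = y \<otimes> x"
  obtains \<phi> where "\<And>g. g \<in> carrier G \<Longrightarrow> \<phi> g \<in> R"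
    "\<And>g h. g \<in> carrier G \<Longrightarrow> h \<in> carrier G \<Longrightarrow> \<phi> (g \<otimes> h) = \<phi> g \<otimes> \<phi> h"
    "\<And>x. x \<in> R \<Longrightarrow> (\<And>g. g \<in> carrier G \<Longrightarrow> g \<otimes> x = x \<otimes> g) \<Longrightarrow> \<phi> x = x [^] card (rcosets R)"
proof -
  interpret R: subgroup R G by fact
  let ?R = "G\<lparr>carrier := R\<rparr>"
  interpret RG: comm_group ?R
    by (rule group.group_comm_groupI) (use comm subgroup_imp_group[OF R] in simp_all)
  let ?C = "rcosets R"
  have finC: "finite ?C" using fin by (simp add: RCOSETS_def)
  define rep where "rep C = (SOME t. t \<in> C)" for C :: "'a set"
  have repC: "rep C \<in> C" if "C \<in> ?C" for C
    unfolding rep_def using R.rcosets_non_empty[OF that] by (simp add: some_in_eq)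
  have repc: "rep C \<in> carrier G" if "C \<in> ?C" for C
    using repC[OF that] R.rcosets_carrier[OF group_axioms that] by blast
  have repeq: "C = R #> rep C" if C: "C \<in> ?C" for C
  proof -
    obtain t where t: "t \<in> carrier G" "C = R #> t" using C by (auto simp: RCOSETS_def)
    then show ?thesis using repr_independence[OF _ t(1) R] repC[OF C] by simp
  qed
  have clo: "C #> g \<in> ?C" if "C \<in> ?C" "g \<in> carrier G" for C g
  proof -
    obtain t where "t \<in> carrier G" "C = R #> t" using \<open>C \<in> ?C\<close> by (auto simp: RCOSETS_def)
    then have "C #> g = R #> (t \<otimes> g)" "t \<otimes> g \<in> carrier G"
      using \<open>g \<in> carrier G\<close> by (simp_all add: coset_mult_assoc R.subset)
    then show ?thesis using rcosetsI[OF R.subset] by simp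
  qed
  have sub: "C \<subseteq> carrier G" if "C \<in> ?C" for C using R.rcosets_carrier[OF group_axioms that] .
  define f where "f g C = rep C \<otimes> g \<otimes> inv (rep (C #> g))" for g C
  have fR: "f g C \<in> R" if "g \<in> carrier G" "C \<in> ?C" for g C
  proof -
    have "rep C \<otimes> g \<in> C #> g" using repC[OF that(2)] by (auto simp: r_coset_def)
    then have "rep C \<otimes> g \<in> R #> rep (C #> g)" using repeq[OF clo[OF that(2,1)]] by simp
    then show ?thesis unfolding f_def
      by (intro R.rcos_module_imp[OF group_axioms]) (auto simp: that clo repc)
  qed
  define \<phi> where "\<phi> g = finprod ?R (f g) ?C" for g
  show thesis
  proof (rule that)
    show "\<phi> g \<in> R" if "g \<in> carrier G" for g
      using RG.finprod_closed[of "f g" ?C] fR that by (simp add: \<phi>_def)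
    show "\<phi> (g \<otimes> h) = \<phi> g \<otimes> \<phi> h" if gh: "g \<in> carrier G" "h \<in> carrier G" for g h
    proof -
      have "f (g \<otimes> h) C = f g C \<otimes> f h (C #> g)" if C: "C \<in> ?C" for C
        using C gh by (simp add: f_def clo repc coset_mult_assoc sub group_word_simps)
      then have "\<phi> (g \<otimes> h) = finprod ?R (\<lambda>C. f g C \<otimes>\<^bsub>?R\<^esub> f h (C #> g)) ?C"
        unfolding \<phi>_def by (intro RG.finprod_cong') (use fR clo gh in auto)
      also have "\<dots> = finprod ?R (f g) ?C \<otimes> finprod ?R (\<lambda>C. f h (C #> g)) ?C"
        using RG.finprod_multf[of "f g" ?C "\<lambda>C. f h (C #> g)"] fR clo gh by (simp add: Pi_def)
      also have "finprod ?R (\<lambda>C. f h (C #> g)) ?C = finprod ?R (f h) ((\<lambda>C. C #> g) ` ?C)"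
      proof (rule RG.finprod_reindex[symmetric])
        show "inj_on (\<lambda>C. C #> g) ?C"
        proof (rule inj_onI)
          fix C D assume "C \<in> ?C" "D \<in> ?C" "C #> g = D #> g"
          then have "C #> g #> inv g = D #> g #> inv g" by simp
          then show "C = D" using \<open>C \<in> ?C\<close> \<open>D \<in> ?C\<close> gh by (simp add: coset_mult_assoc sub)
        qed
      qed (use fR clo gh in auto)
      also have "(\<lambda>C. C #> g) ` ?C = ?C"
      proof
        show "?C \<subseteq> (\<lambda>C. C #> g) ` ?C"
        proof
          fix C assume C: "C \<in> ?C"
          have "C = (C #> inv g) #> g" using C gh by (simp add: coset_mult_assoc sub)
          then show "C \<in> (\<lambda>C. C #> g) ` ?C" using clo[OF C, of "inv g"] gh by blast
        qed
      qed (use clo gh in auto)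
      finally show ?thesis by (simp add: \<phi>_def)
    qed
    show "\<phi> x = x [^] card ?C" if x: "x \<in> R" and cen: "\<And>g. g \<in> carrier G \<Longrightarrow> g \<otimes> x = x \<otimes> g" for x
    proof -
      have "f x C = x" if C: "C \<in> ?C" for C
      proof -
        have "C #> x = R #> (rep C \<otimes> x)"
          using repeq[OF C] repc[OF C] x by (metis coset_mult_assoc R.subset R.mem_carrier)
        also have "\<dots> = R #> x #> rep C"
          using cen[OF repc[OF C]] repc[OF C] x by (simp add: coset_mult_assoc R.subset R.mem_carrier)
        also have "\<dots> = C" using x R.rcos_const[OF group_axioms] repeq[OF C] by simp
        finally have "C #> x = C" .
        then show ?thesis using cen[OF repc[OF C]] repc[OF C] x
          by (simp add: f_def m_assoc R.mem_carrier)
      qed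
      then have "\<phi> x = finprod ?R (\<lambda>_. x) ?C"
        unfolding \<phi>_def by (intro RG.finprod_cong') (use x in auto)
      also have "\<dots> = x [^]\<^bsub>?R\<^esub> card ?C" using x by (intro RG.finprod_const) simp
      also have "\<dots> = x [^] card ?C" by (simp add: nat_pow_consistent[symmetric])
      finally show ?thesis .
    qed
  qed
qed

section \<open>Groups of odd prime power order with a single subgroup of prime order\<close>

lemma quasi_commuting_pow:
  assumes c: "u \<in> carrier G" "v \<in> carrier G" "d \<in> carrier G"
    and dc: "d \<otimes> u = u \<otimes> d" "d \<otimes> v = v \<otimes> d" and vu: "v \<otimes> u = d \<otimes> (u \<otimes> v)"
  shows "v [^] n \<otimes> u = d [^] (n::nat) \<otimes> (u \<otimes> v [^] n)"
proof (induction n)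
  case (Suc n)
  have "v [^] Suc n \<otimes> u = v [^] n \<otimes> (v \<otimes> u)" using c by (simp add: m_assoc)
  also have "\<dots> = v [^] n \<otimes> d \<otimes> (u \<otimes> v)" using c by (simp add: vu m_assoc)
  also have "v [^] n \<otimes> d = d \<otimes> v [^] n" using c dc by (intro group_commutes_pow) auto
  also have "d \<otimes> v [^] n \<otimes> (u \<otimes> v) = d \<otimes> (v [^] n \<otimes> u) \<otimes> v" using c by (simp add: m_assoc)
  also have "\<dots> = d \<otimes> d [^] n \<otimes> (u \<otimes> (v [^] n \<otimes> v))" unfolding Suc using c by (simp add: m_assoc)
  also have "d \<otimes> d [^] n = d [^] Suc n" using c by (metis nat_pow_Suc2)
  finally show ?case by simp
qed (use c in simp)

text \<open>The exponent of \<open>d\<close> counts the pairs consisting of a \<open>v\<close> and a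
  later \<open>u\<close> in the word \<open>uv...uv\<close>; each such pair is transposed once and
  releases one factor \<open>d\<close>.\<close>

lemma quasi_commuting_mult_pow:
  assumes c: "u \<in> carrier G" "v \<in> carrier G" "d \<in> carrier G"
    and dc: "d \<otimes> u = u \<otimes> d" "d \<otimes> v = v \<otimes> d" and vu: "v \<otimes> u = d \<otimes> (u \<otimes> v)"
  shows "(u \<otimes> v) [^] n = d [^] (n * (n - 1) div 2) \<otimes> (u [^] n \<otimes> v [^] (n::nat))"
proof (induction n)
  case (Suc n)
  let ?e = "d [^] (n * (n - 1) div 2)"
  have comm: "u [^] n \<otimes> d [^] n = d [^] n \<otimes> u [^] n"
    using c dc by (intro group_commutes_pow group_commutes_pow[symmetric]) auto
  have "(u \<otimes> v) [^] Suc n = ?e \<otimes> (u [^] n \<otimes> (v [^] n \<otimes> u) \<otimes> v)"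
    unfolding nat_pow_Suc Suc using c by (simp add: m_assoc)
  also have "\<dots> = ?e \<otimes> (u [^] n \<otimes> (d [^] n \<otimes> (u \<otimes> v [^] n)) \<otimes> v)"
    by (simp only: quasi_commuting_pow[OF assms])
  also have "\<dots> = ?e \<otimes> (u [^] n \<otimes> d [^] n) \<otimes> (u \<otimes> (v [^] n \<otimes> v))" using c by (simp add: m_assoc)
  also have "\<dots> = ?e \<otimes> d [^] n \<otimes> (u [^] n \<otimes> u \<otimes> (v [^] n \<otimes> v))" unfolding comm using c by (simp add: m_assoc)
  also have "?e \<otimes> d [^] n = d [^] (Suc n * (Suc n - 1) div 2)"
  proof -
    have "even (n * (n - 1))" by (cases n) auto
    moreover have "Suc n * (Suc n - 1) = n * (n - 1) + 2 * n" by (cases n) auto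
    ultimately have "Suc n * (Suc n - 1) div 2 = n * (n - 1) div 2 + n" by simp
    then show ?thesis using c by (simp add: nat_pow_mult)
  qed
  finally show ?case by simp
qed simp

lemma inv_commute:
  assumes "x \<in> carrier G" "y \<in> carrier G" "x \<otimes> y = y \<otimes> x"
  shows "inv x \<otimes> y = y \<otimes> inv x"
proof -
  have "inv x \<otimes> y = inv x \<otimes> (y \<otimes> x) \<otimes> inv x" using assms(1,2) by (simp add: m_assoc)
  also have "\<dots> = inv x \<otimes> (x \<otimes> y) \<otimes> inv x" by (simp only: assms(3))
  also have "\<dots> = y \<otimes> inv x" using assms(1,2) by (simp add: cancel_inv_left)
  finally show ?thesis .
qed

text \<open>The substitution \<open>u \<mapsto> u y\<^sup>m\<close> lowers the order of \<open>u\<close> and keeps the commutator with \<open>y\<close>;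
  \<open>r\<close> has to be odd in order to divide the binomial coefficient in the class two power formula.\<close>

lemma quasi_commuting_pair_descent:
  assumes ord: "order G = r ^ n" and r: "prime r" "odd r"
    and uniq: "\<And>x y. \<lbrakk>x \<in> carrier G; y \<in> carrier G; x \<noteq> \<one>; y \<noteq> \<one>; x [^] r = \<one>; y [^] r = \<one>\<rbrakk>
        \<Longrightarrow> \<exists>j::nat. y = x [^] j"
    and car: "u \<in> carrier G" "y \<in> carrier G" "c \<in> carrier G" and c: "c \<noteq> \<one>" "c [^] r = \<one>"
    and cen: "c \<otimes> u = u \<otimes> c" "c \<otimes> y = y \<otimes> c" and eq: "u \<otimes> y = c \<otimes> (y \<otimes> u)"
    and le: "ord u \<le> ord y"
  obtains w where "w \<in> carrier G" "c \<otimes> w = w \<otimes> c" "w \<otimes> y = c \<otimes> (y \<otimes> w)" "ord w < ord u"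
proof -
  have r0: "r > 1" using r prime_gt_1_nat by blast
  obtain \<alpha> where \<alpha>: "ord u = r ^ \<alpha>"
    using ord_dvd_group_order[OF car(1)] ord r by (metis divides_primepow_nat)
  obtain \<beta> where \<beta>: "ord y = r ^ \<beta>"
    using ord_dvd_group_order[OF car(2)] ord r by (metis divides_primepow_nat)
  have "u \<noteq> \<one>"
  proof
    assume "u = \<one>"
    then have "c \<otimes> y = y" using eq car by simp
    then show False using car c r_cancel_one' by metis
  qed
  then have "\<alpha> \<noteq> 0" using \<alpha> car(1) ord_eq_1 by (metis power_0)
  then have a1: "\<alpha> \<ge> 1" by simp
  have ab: "\<alpha> \<le> \<beta>" using le \<alpha> \<beta> r0 by simp
  define N where "N = r ^ (\<alpha> - 1)"
  have rN: "r ^ \<alpha> = r * N" using a1 by (simp add: N_def flip: power_Suc)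
  have N0: "N > 0" using r0 by (simp add: N_def)
  let ?u1 = "inv (u [^] N)" and ?y1 = "y [^] (r ^ (\<beta> - 1))"
  have u1: "u [^] N \<noteq> \<one>"
  proof
    assume "u [^] N = \<one>"
    then have "r * N dvd N" using car \<alpha> rN by (simp add: pow_eq_id)
    then have "r * N \<le> 1 * N" using N0 by (simp add: dvd_imp_le)
    then show False using N0 r0 by simp
  qed
  have y1: "?y1 \<noteq> \<one>"
  proof
    assume "?y1 = \<one>"
    then have "r ^ \<beta> dvd r ^ (\<beta> - 1)" using car \<beta> by (simp add: pow_eq_id)
    then have "\<beta> \<le> \<beta> - 1" using r0 by (metis power_dvd_imp_le)
    then show False using ab a1 by simp
  qed
  have "(u [^] N) [^] r = \<one>"
    using car pow_ord_eq_1[OF car(1)] \<alpha> rN by (simp add: nat_pow_pow mult.commute)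
  then have "?u1 [^] r = \<one>" using car by (simp add: nat_pow_inv)
  moreover have "?y1 [^] r = \<one>"
  proof -
    have "r ^ (\<beta> - 1) * r = r ^ \<beta>" using ab a1 by (simp flip: power_Suc2)
    then show ?thesis using car pow_ord_eq_1[OF car(2)] \<beta> by (simp add: nat_pow_pow)
  qed
  ultimately obtain j :: nat where j: "?u1 = ?y1 [^] j"
    using uniq[of ?y1 ?u1] u1 y1 car by (auto simp: inv_eq_1_iff)
  \<comment> \<open>The exponent is chosen so that the \<open>N\<close>-th power of
    \<open>y [^] m\<close> is the inverse of \<open>u [^] N\<close>: the factor
    \<open>r ^ (\<beta> - \<alpha>)\<close> times \<open>N\<close> is
    \<open>r ^ (\<beta> - 1)\<close>. This is where \<open>ord u \<le> ord y\<close> enters.\<close>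
  define m where "m = j * r ^ (\<beta> - \<alpha>)"
  let ?v = "y [^] m"
  have "(\<beta> - \<alpha>) + (\<alpha> - 1) = \<beta> - 1" using ab a1 by simp
  then have mN: "m * N = r ^ (\<beta> - 1) * j" by (simp add: m_def N_def flip: power_add)
  have vN: "?v [^] N = ?u1" unfolding j using car mN by (simp add: nat_pow_pow)
  let ?d = "inv c [^] m"
  have ic: "inv c \<otimes> u = u \<otimes> inv c" "inv c \<otimes> y = y \<otimes> inv c"
    using car cen inv_commute by simp_all
  have cv: "c \<otimes> ?v = ?v \<otimes> c" using group_commutes_pow[of y c m] car cen by simp
  have "y \<otimes> u = inv c \<otimes> (u \<otimes> y)" using eq car by (simp add: cancel_inv_left)
  then have yu: "y [^] m \<otimes> u = ?d \<otimes> (u \<otimes> y [^] m)"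
    using car ic by (intro quasi_commuting_pow) auto
  have comm: "?d \<otimes> x = x \<otimes> ?d" if "x \<in> carrier G" "inv c \<otimes> x = x \<otimes> inv c" for x
    using that car by (intro group_commutes_pow) auto
  have "inv c \<otimes> ?v = ?v \<otimes> inv c" using car cv inv_commute by simp
  then have pw: "(u \<otimes> ?v) [^] N = ?d [^] (N * (N - 1) div 2) \<otimes> (u [^] N \<otimes> ?v [^] N)"
    using car ic yu comm by (intro quasi_commuting_mult_pow) auto
  \<comment> \<open>For \<open>\<alpha> = 1\<close> the exponent is 0 because \<open>N = 1\<close>.
    Otherwise \<open>N\<close> is an odd multiple of \<open>r\<close>, so \<open>r\<close> divides
    \<open>N (N - 1) / 2\<close>, and the \<open>r\<close>-th power of \<open>c\<close> is
    trivial.\<close>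
  have "?d [^] (N * (N - 1) div 2) = \<one>"
  proof (cases "\<alpha> = 1")
    case False
    then have "r dvd N" using a1 by (simp add: N_def dvd_power)
    have "odd N" using r by (simp add: N_def)
    then have "even (N - 1)" by simp
    then have "N * (N - 1) div 2 = N * ((N - 1) div 2)" by (simp add: div_mult_swap)
    then have "r dvd N * (N - 1) div 2" using \<open>r dvd N\<close> by simp
    then obtain k where k: "N * (N - 1) div 2 = r * k" by (rule dvdE)
    have "?d [^] (r * k) = (inv c [^] r) [^] (m * k)" using car by (simp add: nat_pow_pow mult.left_commute)
    then show ?thesis unfolding k using c car by (simp add: nat_pow_inv)
  qed (simp add: N_def)
  then have uvN: "(u \<otimes> ?v) [^] N = \<one>" using pw vN car by simp
  show thesis
  proof
    have "ord (u \<otimes> ?v) dvd N" using uvN car by (simp add: pow_eq_id)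
    then have "ord (u \<otimes> ?v) \<le> N" using N0 by (rule dvd_imp_le)
    also have "N < ord u" unfolding \<alpha> rN using r0 N0 by simp
    finally show "ord (u \<otimes> ?v) < ord u" .
    have "c \<otimes> (u \<otimes> ?v) = u \<otimes> c \<otimes> ?v" using car(1,2,3) by (simp add: m_assoc[symmetric] cen(1))
    also have "\<dots> = u \<otimes> ?v \<otimes> c" using car(1,2,3) by (simp add: m_assoc cv)
    finally show "c \<otimes> (u \<otimes> ?v) = u \<otimes> ?v \<otimes> c" .
    have "?v \<otimes> y = y \<otimes> ?v" using car by (intro group_commutes_pow) auto
    then have "u \<otimes> ?v \<otimes> y = u \<otimes> y \<otimes> ?v" using car by (simp add: m_assoc)
    also have "\<dots> = c \<otimes> (y \<otimes> (u \<otimes> ?v))" using car(1,2,3) by (simp add: eq m_assoc)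
    finally show "u \<otimes> ?v \<otimes> y = c \<otimes> (y \<otimes> (u \<otimes> ?v))" .
  qed (use car in auto)
qed

text \<open>Infinite descent on the product of the two orders. The element of smaller order is
  replaced; if that is \<open>y\<close>, the roles are exchanged, which turns \<open>c\<close> into
  its inverse.\<close>

lemma no_quasi_commuting_pair:
  assumes ord: "order G = r ^ n" and r: "prime r" "odd r"
    and uniq: "\<And>x y. \<lbrakk>x \<in> carrier G; y \<in> carrier G; x \<noteq> \<one>; y \<noteq> \<one>; x [^] r = \<one>; y [^] r = \<one>\<rbrakk>
        \<Longrightarrow> \<exists>j::nat. y = x [^] j"
    and uy: "u \<in> carrier G" "y \<in> carrier G" "c \<in> carrier G" "c \<noteq> \<one>" "c [^] r = \<one>"
    and cen: "c \<otimes> u = u \<otimes> c" "c \<otimes> y = y \<otimes> c" and eq: "u \<otimes> y = c \<otimes> (y \<otimes> u)"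
  shows False
  using uy cen eq
proof (induction "ord u * ord y" arbitrary: u y c rule: less_induct)
  case less
  have fin: "finite (carrier G)" using ord r order_gt_0_iff_finite by (simp add: prime_gt_0_nat)
  note car = less.prems(1-3)
  have pos: "0 < ord x" if "x \<in> carrier G" for x using ord_ge_1[OF fin that] by simp
  show False
  proof (cases "ord u \<le> ord y")
    case True
    from quasi_commuting_pair_descent[OF ord r uniq less.prems True]
    obtain w where w: "w \<in> carrier G" "c \<otimes> w = w \<otimes> c" "w \<otimes> y = c \<otimes> (y \<otimes> w)" "ord w < ord u"
      by blast
    show False
      by (rule less.hyps[of w y c]) (use w less.prems pos in auto)
  next
    case False
    have eq': "y \<otimes> u = inv c \<otimes> (u \<otimes> y)" using less.prems(8) car by (simp add: cancel_inv_left)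
    have c': "inv c \<in> carrier G" "inv c \<noteq> \<one>" "inv c [^] r = \<one>" "inv c \<otimes> u = u \<otimes> inv c"
      "inv c \<otimes> y = y \<otimes> inv c"
      using car less.prems(4-7) by (simp_all add: inv_eq_1_iff nat_pow_inv inv_commute)
    from False have "ord y \<le> ord u" by simp
    from quasi_commuting_pair_descent[OF ord r uniq car(2,1) c'(1,2,3,5,4) eq' this]
    obtain w where w: "w \<in> carrier G" "inv c \<otimes> w = w \<otimes> inv c" "w \<otimes> u = inv c \<otimes> (u \<otimes> w)" "ord w < ord y"
      by blast
    show False
      by (rule less.hyps[of w u "inv c"]) (use w c' car pos in \<open>auto simp: mult.commute\<close>)
  qed
qed

text \<open>The hypothesis \<open>uniq\<close> expresses that there is at most one subgroup of order
  \<open>r\<close>. If the center is proper, take a central element of order \<open>r\<close> in the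
  central quotient and a preimage \<open>u\<close> of it. All commutators of \<open>u\<close> are
  central, and their \<open>r\<close>-th powers are trivial because \<open>u [^] r\<close> is
  central, so a nontrivial one contradicts \<open>no_quasi_commuting_pair\<close>.\<close>

lemma odd_p_group_abelian:
  assumes ord: "order G = r ^ n" and r: "prime r" "odd r"
    and uniq: "\<And>x y. \<lbrakk>x \<in> carrier G; y \<in> carrier G; x \<noteq> \<one>; y \<noteq> \<one>; x [^] r = \<one>; y [^] r = \<one>\<rbrakk>
        \<Longrightarrow> \<exists>j::nat. y = x [^] j"
    and xy: "x \<in> carrier G" "y \<in> carrier G"
  shows "x \<otimes> y = y \<otimes> x"
proof (rule ccontr)
  assume noncomm: "x \<otimes> y \<noteq> y \<otimes> x"
  have fin: "finite (carrier G)" using ord r order_gt_0_iff_finite by (simp add: prime_gt_0_nat)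
  let ?Z = "cent (carrier G)"
  have subZ: "subgroup ?Z G" by (rule subgroup_cent) simp
  interpret Z: subgroup ?Z G by (rule subZ)
  have Zc: "z \<otimes> g = g \<otimes> z" if "z \<in> ?Z" "g \<in> carrier G" for z g using that by (rule centD)
  have "?Z \<lhd> G"
  proof (rule normal_invI[OF subZ])
    fix g z assume g: "g \<in> carrier G" "z \<in> ?Z"
    then have "g \<otimes> z \<otimes> inv g = z" using Zc[of z g] conjug_fix_iff[of g z] Z.mem_carrier by (simp add: conjug_def)
    then show "g \<otimes> z \<otimes> inv g \<in> ?Z" using g by simp
  qed
  then interpret N: normal ?Z G .
  let ?Q = "G Mod ?Z"
  interpret Q: group ?Q by (rule N.factorgroup_is_group)
  have carQ: "carrier ?Q = rcosets ?Z" by (simp add: FactGroup_def)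
  have "card (rcosets ?Z) dvd r ^ n" using lagrange[OF subZ] ord by (metis dvd_triv_left)
  then obtain k where k: "card (carrier ?Q) = r ^ k" using r carQ by (metis divides_primepow_nat)
  have finQ: "finite (carrier ?Q)" using fin by (simp add: carQ RCOSETS_def)
  have ne: "carrier ?Q \<noteq> {\<one>\<^bsub>?Q\<^esub>}"
  proof
    assume a: "carrier ?Q = {\<one>\<^bsub>?Q\<^esub>}"
    have "?Z #> x \<in> carrier ?Q" using xy by (simp add: carrier_FactGroup)
    then have "?Z #> x = ?Z" using a by simp
    then have "x \<in> ?Z" using rcos_self[OF xy(1) subZ] by simp
    then show False using noncomm Zc[of x y] xy by simp
  qed
  obtain z where z: "z \<in> carrier ?Q" "z \<noteq> \<one>\<^bsub>?Q\<^esub>"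
    "\<And>x. x \<in> carrier ?Q \<Longrightarrow> x \<otimes>\<^bsub>?Q\<^esub> z = z \<otimes>\<^bsub>?Q\<^esub> x"
    using Q.p_group_center[OF Q.subgroup_self k r(1) ne] by blast
  obtain i :: nat where i: "prime (Q.ord (z [^]\<^bsub>?Q\<^esub> i))" using Q.exists_prime_power[OF finQ z(1,2)] by blast
  let ?w = "z [^]\<^bsub>?Q\<^esub> i"
  have w: "?w \<in> carrier ?Q" using z by simp
  have "Q.ord ?w dvd r ^ k" using Q.ord_dvd_group_order[OF w] k by (simp add: order_def)
  then have ow: "Q.ord ?w = r" using i r(1) by (metis prime_dvd_power primes_dvd_imp_eq)
  have wc: "t \<otimes>\<^bsub>?Q\<^esub> ?w = ?w \<otimes>\<^bsub>?Q\<^esub> t" if "t \<in> carrier ?Q" for t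
    using Q.group_commutes_pow[of z t i] z that by simp
  obtain u where u: "u \<in> carrier G" "?w = ?Z #> u" using w by (auto simp: carrier_FactGroup)
  have "?Z #> (u [^] r) = ?w [^]\<^bsub>?Q\<^esub> r" using N.FactGroup_pow[OF u(1), of r] u by simp
  also have "\<dots> = ?Z" using Q.pow_ord_eq_1[OF w] ow by simp
  finally have ur: "u [^] r \<in> ?Z" using rcos_self[OF _ subZ, of "u [^] r"] u by simp
  have "u \<notin> ?Z"
  proof
    assume "u \<in> ?Z"
    then have "?w = \<one>\<^bsub>?Q\<^esub>" using u Z.rcos_const[OF group_axioms] by simp
    then have "Q.ord ?w = 1" by (metis Q.ord_id)
    then show False using ow r by simp
  qed
  then obtain v where v: "v \<in> carrier G" "u \<otimes> v \<noteq> v \<otimes> u" using u(1) centI[of u "carrier G"] by blast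
  have "?Z #> (u \<otimes> v) = ?Z #> (v \<otimes> u)"
    using wc[of "?Z #> v"] u v by (simp add: carrier_FactGroup N.rcos_sum)
  then have "u \<otimes> v \<in> ?Z #> (v \<otimes> u)" using u v subZ by (metis m_closed rcos_self)
  then have cZ: "u \<otimes> v \<otimes> inv (v \<otimes> u) \<in> ?Z" using u v by (intro Z.rcos_module_imp[OF group_axioms]) auto
  let ?c = "u \<otimes> v \<otimes> inv (v \<otimes> u)"
  have cc: "?c \<in> carrier G" using u v by simp
  have cne: "?c \<noteq> \<one>"
  proof
    assume "?c = \<one>"
    then have "?c \<otimes> (v \<otimes> u) = v \<otimes> u" using u v by simp
    then show False using u v by (simp add: group_word_simps)
  qed
  have eq: "u \<otimes> v = ?c \<otimes> (v \<otimes> u)" using u v by (simp add: group_word_simps)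
  have "u [^] r \<otimes> v = ?c [^] r \<otimes> (v \<otimes> u [^] r)"
    by (rule quasi_commuting_pow[OF v(1) u(1) cc Zc[OF cZ v(1)] Zc[OF cZ u(1)] eq])
  then have "?c [^] r \<otimes> (v \<otimes> u [^] r) = v \<otimes> u [^] r" using Zc[OF ur v(1)] by simp
  then have "?c [^] r = \<one>" using r_cancel_one[of "v \<otimes> u [^] r" "?c [^] r"] u v cc by simp
  then show False
    using no_quasi_commuting_pair[OF ord r uniq u(1) v(1) cc cne _ Zc[OF cZ u(1)] Zc[OF cZ v(1)] eq] by blast
qed

end

subsection \<open>Fixed point free actions on abelian groups\<close>

lemma (in comm_monoid) finprod_swap:
  assumes "finite A" "finite B" "\<And>i j. i \<in> A \<Longrightarrow> j \<in> B \<Longrightarrow> f i j \<in> carrier G"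
  shows "finprod G (\<lambda>i. finprod G (f i) B) A = finprod G (\<lambda>j. finprod G (\<lambda>i. f i j) A) B"
  using assms(1,3)
proof (induction A rule: finite_induct)
  case empty
  then show ?case by (simp add: finprod_one_eqI)
next
  case (insert a A)
  have "finprod G (\<lambda>i. finprod G (f i) B) (insert a A)
      = finprod G (f a) B \<otimes> finprod G (\<lambda>j. finprod G (\<lambda>i. f i j) A) B"
    using insert by (subst finprod_insert) (auto intro!: finprod_closed)
  also have "\<dots> = finprod G (\<lambda>j. f a j \<otimes> finprod G (\<lambda>i. f i j) A) B"
    using insert.prems by (intro finprod_multf[symmetric]) (auto intro!: finprod_closed)
  also have "\<dots> = finprod G (\<lambda>j. finprod G (\<lambda>i. f i j) (insert a A)) B"
    using insert.prems insert.hyps by (intro finprod_cong') (auto intro!: finprod_closed)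
  finally show ?case .
qed

context group
begin

definition fpf_on :: "'a set \<Rightarrow> 'a set \<Rightarrow> bool" where
  "fpf_on Y V \<longleftrightarrow> (\<forall>y\<in>Y. \<forall>v\<in>V. y \<noteq> \<one> \<longrightarrow> conjug y v = v \<longrightarrow> v = \<one>)"

lemma fpf_onD: "fpf_on Y V \<Longrightarrow> y \<in> Y \<Longrightarrow> v \<in> V \<Longrightarrow> y \<noteq> \<one> \<Longrightarrow> conjug y v = v \<Longrightarrow> v = \<one>"
  by (auto simp: fpf_on_def)

context
  fixes Y V
  assumes fin: "finite (carrier G)" and Y: "subgroup Y G" and V: "subgroup V G"
    and commV: "\<And>v w. v \<in> V \<Longrightarrow> w \<in> V \<Longrightarrow> v \<otimes> w = w \<otimes> v"
    and norm: "Y \<subseteq> setnorm V" and fpf: "fpf_on Y V"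
begin

private abbreviation (input) "VG \<equiv> G\<lparr>carrier := V\<rparr>"

private lemma comm_group_VG: "comm_group VG"
  by (rule group.group_comm_groupI) (use commV subgroup_imp_group[OF V] in simp_all)

private lemma conjug_in: "y \<in> Y \<Longrightarrow> v \<in> V \<Longrightarrow> conjug y v \<in> V"
  using norm setnormD by blast

private lemma conjug_finprod:
  assumes "y \<in> Y" "finite A" "\<And>i. i \<in> A \<Longrightarrow> f i \<in> V"
  shows "conjug y (finprod VG f A) = finprod VG (\<lambda>i. conjug y (f i)) A"
  using assms(2,3)
proof (induction A rule: finite_induct)
  case empty
  interpret VG: comm_group VG by (rule comm_group_VG)
  show ?case using assms(1) subgroup.mem_carrier[OF Y] by simp
next
  case (insert a A)
  interpret VG: comm_group VG by (rule comm_group_VG)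
  have "finprod VG f A \<in> V" using VG.finprod_closed[of f A] insert by auto
  then show ?case
    using insert assms(1) subgroup.mem_carrier[OF Y] subgroup.mem_carrier[OF V]
    by (simp add: conjug_mult conjug_in Pi_def)
qed

text \<open>Conjugation by a nontrivial \<open>g\<close> in \<open>E\<close> permutes the factors,
  so the product is a fixed point of \<open>g\<close>.\<close>

private lemma orbit_product_trivial:
  assumes E: "subgroup E G" "E \<subseteq> Y" "E \<noteq> {\<one>}" and v: "v \<in> V"
  shows "finprod VG (\<lambda>e. conjug e v) E = \<one>"
proof -
  interpret VG: comm_group VG by (rule comm_group_VG)
  interpret E: subgroup E G by fact
  have finE: "finite E" using finite_subset[OF E.subset fin] .
  have vc: "v \<in> carrier G" using subgroup.mem_carrier[OF V v] .
  obtain g where g: "g \<in> E" "g \<noteq> \<one>" using E.one_closed E(3) by blast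
  have gY: "g \<in> Y" using g E by blast
  let ?w = "finprod VG (\<lambda>e. conjug e v) E"
  have fV: "conjug e v \<in> V" if "e \<in> E" for e using that E v conjug_in by blast
  have "conjug g ?w = finprod VG (\<lambda>e. conjug g (conjug e v)) E"
    by (rule conjug_finprod[OF gY finE fV])
  also have "\<dots> = finprod VG (\<lambda>e. conjug (g \<otimes> e) v) E"
    using g fV vc by (intro VG.finprod_cong') (auto simp: conjug_conjug)
  also have "\<dots> = finprod VG (\<lambda>e. conjug e v) ((\<lambda>e. g \<otimes> e) ` E)"
    using g fV by (intro VG.finprod_reindex[symmetric]) (auto simp: inj_on_def E.mem_carrier)
  also have "(\<lambda>e. g \<otimes> e) ` E = E"
  proof
    show "E \<subseteq> (\<lambda>e. g \<otimes> e) ` E"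
    proof
      fix e assume e: "e \<in> E"
      then have "e = g \<otimes> (inv g \<otimes> e)" using g by (simp add: cancel_inv_left E.mem_carrier)
      then show "e \<in> (\<lambda>e. g \<otimes> e) ` E" using e g by blast
    qed
  qed (use g in auto)
  finally show ?thesis
    using fpf_onD[OF fpf gY _ g(2)] VG.finprod_closed[of "\<lambda>e. conjug e v" E] fV by (simp add: Pi_def)
qed

text \<open>The cosets \<open>t\<^sub>j E\<close> for \<open>0 < j < q\<close> are covered by the cyclic groups generated by the elements
  \<open>h i\<close>; since the orbit products of all these groups and of \<open>E\<close> are trivial, only the \<open>card E\<close>
  contributions of the unit remain.\<close>

private lemma pow_card_eq_one:
  assumes E: "subgroup E G" "E \<subseteq> Y" "E \<noteq> {\<one>}" and h: "\<And>i. i \<in> E \<Longrightarrow> h i \<in> Y"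
    and q: "prime q" "\<And>i. i \<in> E \<Longrightarrow> ord (h i) = q"
    and t: "\<And>j. 0 < j \<Longrightarrow> j < q \<Longrightarrow> t j \<in> Y"
      "\<And>j i. 0 < j \<Longrightarrow> j < q \<Longrightarrow> i \<in> E \<Longrightarrow> inv (t j) \<otimes> h i [^] j \<in> E"
      "\<And>j. 0 < j \<Longrightarrow> j < q \<Longrightarrow> inj_on (\<lambda>i. h i [^] j) E"
    and v: "v \<in> V"
  shows "v [^] card E = \<one>"
proof -
  interpret VG: comm_group VG by (rule comm_group_VG)
  interpret E: subgroup E G by fact
  interpret Y: subgroup Y G by (rule Y)
  have finE: "finite E" using finite_subset[OF E.subset fin] .
  have vc: "v \<in> carrier G" using subgroup.mem_carrier[OF V v] .
  have q0: "q > 0" using q by (simp add: prime_gt_0_nat)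
  let ?f = "\<lambda>i j. conjug (h i [^] (j::nat)) v"
  have hp: "h i [^] j \<in> Y" if "i \<in> E" for i and j :: nat
    using subgroup_pow_closed[OF Y h[OF that]] .
  have fV: "?f i j \<in> V" if "i \<in> E" for i j using hp[OF that] v conjug_in by blast
  have "finprod VG (?f i) {..<q} = \<one>" if i: "i \<in> E" for i
  proof -
    have hc: "h i \<in> carrier G" using h[OF i] by simp
    have inj: "inj_on (\<lambda>j::nat. h i [^] j) {..<q}"
      using ord_inj[OF hc] q(2)[OF i] q0 by (rule_tac inj_on_subset) auto
    have "(\<lambda>j::nat. h i [^] j) ` {..<q} = cyc (h i)"
    proof (rule card_subset_eq)
      show "finite (cyc (h i))" using finite_cyc[OF fin hc] .
      show "(\<lambda>j::nat. h i [^] j) ` {..<q} \<subseteq> cyc (h i)" using cyc_eq[OF fin hc] by auto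
      show "card ((\<lambda>j::nat. h i [^] j) ` {..<q}) = card (cyc (h i))"
        using card_image[OF inj] card_cyc[OF hc] q(2)[OF i] by simp
    qed
    moreover have "finprod VG (\<lambda>e. conjug e v) ((\<lambda>j::nat. h i [^] j) ` {..<q}) = finprod VG (?f i) {..<q}"
      using fV[OF i] inj by (intro VG.finprod_reindex) auto
    moreover have "finprod VG (\<lambda>e. conjug e v) (cyc (h i)) = \<one>"
    proof (rule orbit_product_trivial[OF subgroup_cyc[OF hc] cyc_subset[OF Y h[OF i]] _ v])
      show "cyc (h i) \<noteq> {\<one>}"
        using cyc_ne_one prime_ord_ne_one q(2)[OF i] q(1) by blast
    qed
    ultimately show ?thesis by simp
  qed
  then have "finprod VG (\<lambda>i. finprod VG (?f i) {..<q}) E = \<one>"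
    using VG.finprod_one_eqI[of E] by simp
  \<comment> \<open>Exchanging the products isolates the column \<open>j = 0\<close>, in which every
    entry is \<open>v\<close>. A column with \<open>j > 0\<close> is the orbit product of
    \<open>E\<close>, conjugated by \<open>t j\<close>.\<close>
  then have "finprod VG (\<lambda>j. finprod VG (\<lambda>i. ?f i j) E) {..<q} = \<one>"
    using VG.finprod_swap[of E "{..<q}" ?f] finE fV by simp
  also have "finprod VG (\<lambda>j. finprod VG (\<lambda>i. ?f i j) E) {..<q}
      = finprod VG (\<lambda>j. if j = 0 then v [^] card E else \<one>) {..<q}"
  proof (rule VG.finprod_cong')
    fix j assume j: "j \<in> {..<q}"
    show "finprod VG (\<lambda>i. ?f i j) E = (if j = 0 then v [^] card E else \<one>)"
    proof (cases "j = 0")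
      case True
      have "finprod VG (\<lambda>i. ?f i 0) E = finprod VG (\<lambda>i. v) E"
        using v vc by (intro VG.finprod_cong') auto
      also have "\<dots> = v [^]\<^bsub>VG\<^esub> card E" using v by (intro VG.finprod_const) simp
      finally show ?thesis using True by (simp add: nat_pow_consistent[symmetric])
    next
      case False
      then have j': "0 < j" "j < q" using j by auto
      note tj = t[OF j']
      have tc: "t j \<in> carrier G" using tj(1) by simp
      let ?k = "\<lambda>i. inv (t j) \<otimes> h i [^] j"
      have kE: "?k ` E = E"
      proof (rule endo_inj_surj[OF finE])
        show "inj_on ?k E"
        proof (rule inj_onI)
          fix x y assume xy: "x \<in> E" "y \<in> E" "?k x = ?k y"
          then have "h x [^] j = h y [^] j"
            using tc Y.mem_carrier[OF hp] by simp
          then show "x = y" using tj(3) xy by (auto simp: inj_on_def)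
        qed
      qed (use tj(2) in auto)
      have injk: "inj_on ?k E" using kE finE by (simp add: eq_card_imp_inj_on)
      have kV: "conjug (?k i) v \<in> V" if "i \<in> E" for i
        using conjug_in[OF subsetD[OF E(2) tj(2)[OF that]] v] .
      have "finprod VG (\<lambda>i. ?f i j) E = finprod VG (\<lambda>i. conjug (t j) (conjug (?k i) v)) E"
      proof (rule VG.finprod_cong')
        fix i assume i: "i \<in> E"
        have "h i [^] j = t j \<otimes> ?k i" using tc Y.mem_carrier[OF hp[OF i]] by (simp add: cancel_inv_left)
        then show "?f i j = conjug (t j) (conjug (?k i) v)"
          using tc vc Y.mem_carrier[OF hp[OF i]] by (simp add: conjug_conjug)
      next
        show "(\<lambda>i. conjug (t j) (conjug (?k i) v)) \<in> E \<rightarrow> carrier VG"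
          using conjug_in[OF tj(1) kV] by simp
      qed simp
      also have "\<dots> = conjug (t j) (finprod VG (\<lambda>i. conjug (?k i) v) E)"
        by (rule conjug_finprod[OF tj(1) finE kV, symmetric])
      also have "finprod VG (\<lambda>i. conjug (?k i) v) E = finprod VG (\<lambda>e. conjug e v) (?k ` E)"
        using kV injk by (intro VG.finprod_reindex[symmetric]) auto
      also have "\<dots> = \<one>" unfolding kE by (rule orbit_product_trivial[OF E v])
      finally show ?thesis using False tc by simp
    qed
  next
    show "(\<lambda>j. if j = 0 then v [^] card E else \<one>) \<in> {..<q} \<rightarrow> carrier VG"
      using VG.nat_pow_closed[of v "card E"] v subgroup.one_closed[OF V]
      by (auto simp: nat_pow_consistent[symmetric])
  qed simp
  also have "\<dots> = v [^] card E"
  proof -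
    have vk: "v [^] card E \<in> V" using VG.nat_pow_closed[of v "card E"] v by (simp add: nat_pow_consistent[symmetric])
    have "{..<q} = insert 0 {0<..<q}" using q0 by auto
    then have "finprod VG (\<lambda>j. if j = 0 then v [^] card E else \<one>) {..<q}
       = v [^] card E \<otimes> finprod VG (\<lambda>j. if j = 0 then v [^] card E else \<one>) {0<..<q}"
      using vk by (simp add: Pi_def subgroup.one_closed[OF V])
    also have "finprod VG (\<lambda>j. if j = 0 then v [^] card E else \<one>) {0<..<q} = \<one>"
      using VG.finprod_one_eqI[of "{0<..<q}" "\<lambda>j. if j = 0 then v [^] card E else \<one>"] by simp
    finally show ?thesis using vk V by (simp add: subgroup.mem_carrier)
  qed
  finally show ?thesis .
qed

text \<open>These are the classical conditions on subgroups of order \<open>pq\<close> and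
  \<open>p^2\<close>. If \<open>a\<close> and \<open>b\<close> fail to commute, the group they
  generate is covered by \<open>cyc a\<close> and the cyclic groups of the conjugates of
  \<open>b\<close> under \<open>cyc a\<close>. If they commute, have equal order and are
  independent, it is covered by \<open>cyc a\<close> and the groups generated by the products
  \<open>b i\<close>. Either cover gives \<open>v [^] ord a = 1\<close> for a nontrivial
  \<open>v\<close> in \<open>V\<close>, although \<open>ord a\<close> is prime to
  \<open>card V\<close>.\<close>

lemma fpf_prime_order_commute:
  assumes Vne: "V \<noteq> {\<one>}" and ab: "a \<in> Y" "b \<in> Y" "prime (ord a)" "prime (ord b)" "b \<in> setnorm (cyc a)"
  shows "a \<otimes> b = b \<otimes> a" "ord a = ord b \<Longrightarrow> b \<in> cyc a"
proof -
  interpret Y: subgroup Y G by (rule Y)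
  have ac: "a \<in> carrier G" and bc: "b \<in> carrier G" using ab by auto
  let ?E = "cyc a" and ?p = "ord a" and ?q = "ord b"
  have E: "subgroup ?E G" "?E \<subseteq> Y" "?E \<noteq> {\<one>}"
  proof -
    show "subgroup ?E G" by (rule subgroup_cyc[OF ac])
    show "?E \<subseteq> Y" by (rule cyc_subset[OF Y ab(1)])
    show "?E \<noteq> {\<one>}" using cyc_ne_one prime_ord_ne_one ab(3) by blast
  qed
  interpret E: subgroup ?E G by (rule E(1))
  have finE: "finite ?E" by (rule finite_cyc[OF fin ac])
  have cardE: "card ?E = ?p" by (rule card_cyc[OF ac])
  have Ecomm: "x \<otimes> y = y \<otimes> x" if "x \<in> ?E" "y \<in> ?E" for x y
    using that ac by (auto simp: cyc_eq[OF fin ac] nat_pow_mult add.commute)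
  obtain v where v: "v \<in> V" "v \<noteq> \<one>" using Vne subgroup.one_closed[OF V] by blast
  have vc: "v \<in> carrier G" using subgroup.mem_carrier[OF V v(1)] .
  text \<open>The group \<open>cyc a\<close> acts on \<open>V\<close> with a single fixed point, so \<open>ord a\<close> is coprime to \<open>card V\<close>.\<close>
  have no_pow: "v [^] ?p \<noteq> \<one>"
  proof
    assume "v [^] ?p = \<one>"
    then have "ord v = ?p" using ord_eq_prime[OF vc v(2)] ab(3) by blast
    then have "?p dvd card V"
      using card_dvd_of_subset[OF subgroup_cyc[OF vc] V cyc_subset[OF V v(1)]] card_cyc[OF vc] by simp
    moreover have "[card V = card {x \<in> V. \<forall>g\<in>?E. conjug g x = x}] (mod ?p)"
    proof (rule p_group_fixed_points[OF E(1) _ ab(3), of 1])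
      show "finite V" using finite_subset[OF subgroup.subset[OF V] fin] .
      show "conjug g x \<in> V" if "g \<in> ?E" "x \<in> V" for g x using that E(2) conjug_in by blast
    qed (use cardE subgroup.mem_carrier[OF V] in \<open>auto simp: conjug_conjug\<close>)
    moreover have "{x \<in> V. \<forall>g\<in>?E. conjug g x = x} = {\<one>}"
    proof -
      have "a \<noteq> \<one>" using prime_ord_ne_one ab(3) by blast
      then have "x = \<one>" if "x \<in> V" "\<forall>g\<in>?E. conjug g x = x" for x
        using fpf_onD[OF fpf ab(1) that(1)] that(2) in_cyc by blast
      moreover have "\<one> \<in> {x \<in> V. \<forall>g\<in>?E. conjug g x = x}"
        using subgroup.one_closed[OF V] by simp
      ultimately show ?thesis by blast
    qed
    ultimately have "?p dvd 1" using cong_dvd_iff[of "card V" 1 ?p] by simp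
    then show False using ab(3) by simp
  qed
  show comm: "a \<otimes> b = b \<otimes> a"
  proof (rule ccontr)
    assume nc: "a \<otimes> b \<noteq> b \<otimes> a"
    have "v [^] card ?E = \<one>"
    proof (rule pow_card_eq_one[OF E _ ab(4) _ _ _ _ v(1), of "\<lambda>i. conjug i b" "\<lambda>j. b [^] j"])
      show "conjug i b \<in> Y" if "i \<in> ?E" for i
        using that E ab unfolding conjug_def by auto
      show "ord (conjug i b) = ?q" if "i \<in> ?E" for i
        using that bc by (simp add: ord_conjug E.mem_carrier)
      show "b [^] j \<in> Y" for j :: nat using subgroup_pow_closed[OF Y ab(2)] .
      fix j :: nat assume j: "0 < j" "j < ?q"
      let ?f = "b [^] j"
      have fc: "?f \<in> carrier G" using bc by simp
      have sN: "subgroup (setnorm ?E) G" by (rule subgroup_setnorm_cyc[OF fin ac])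
      have "?f \<in> setnorm ?E" using subgroup_pow_closed[OF sN ab(5)] .
      then have fN: "inv ?f \<in> setnorm ?E" using subgroup.m_inv_closed[OF sN] by blast
      show "inv ?f \<otimes> conjug i b [^] j \<in> ?E" if i: "i \<in> ?E" for i
      proof -
        have ic: "i \<in> carrier G" using i by simp
        have "inv ?f \<otimes> conjug i b [^] j = conjug (inv ?f) i \<otimes> inv i"
          using ic bc fc conjug_pow[OF ic bc, of j] by (simp add: conjug_def m_assoc)
        then show ?thesis using setnormD[OF fN i] i by simp
      qed
      have fne: "?f \<noteq> \<one>" using j bc by (simp add: pow_eq_id nat_dvd_not_less)
      have fcyc: "?f \<in> cyc b" using cyc_eq[OF fin bc] by blast
      have bf: "b \<in> cyc ?f" using cyc_eq_cyc(1)[OF fin bc ab(4) fcyc fne] in_cyc by blast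
      \<comment> \<open>If conjugates of \<open>b [^] j\<close> by different elements agree, a
        nontrivial element of \<open>cyc a\<close> commutes with \<open>b [^] j\<close>. By
        primality these two generate \<open>cyc a\<close> and \<open>cyc b\<close>, so
        \<open>a\<close> would commute with \<open>b\<close>.\<close>
      show "inj_on (\<lambda>i. conjug i b [^] j) ?E"
      proof (rule inj_onI)
        fix x y assume xy: "x \<in> ?E" "y \<in> ?E" "conjug x b [^] j = conjug y b [^] j"
        have xc: "x \<in> carrier G" "y \<in> carrier G" using xy by auto
        let ?z = "inv y \<otimes> x"
        have "conjug x ?f = conjug y ?f" using xy xc bc by (simp add: conjug_pow)
        then have "conjug ?z ?f = ?f" using xc fc by (metis conjug_conjug conjug_inv_conjug(1) inv_closed)
        then have zf: "?z \<otimes> ?f = ?f \<otimes> ?z" using xc fc by (simp add: conjug_fix_iff)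
        show "x = y"
        proof (rule ccontr)
          assume "x \<noteq> y"
          then have "?z \<noteq> \<one>" using xc by (metis inv_equality inv_inv inv_closed)
          then have "a \<in> cyc ?z" using cyc_eq_cyc(1)[OF fin ac ab(3), of ?z] xy in_cyc[of a] by simp
          moreover have "cyc ?z \<subseteq> cent {?f}"
            using zf xc fc by (intro cyc_subset subgroup_cent centI) auto
          ultimately have "a \<otimes> ?f = ?f \<otimes> a" using centD by blast
          then have "?f \<in> cent {a}" using fc by (intro centI) auto
          then have "cyc ?f \<subseteq> cent {a}" using ac by (intro cyc_subset subgroup_cent) auto
          then have "b \<otimes> a = a \<otimes> b" using bf centD by blast
          then show False using nc by simp
        qed
      qed
    qed
    then show False using no_pow cardE by simp
  qed
  show "b \<in> cyc a" if pq: "ord a = ord b"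
  proof (rule ccontr)
    assume nb: "b \<notin> cyc a"
    have comm': "b \<otimes> x = x \<otimes> b" if "x \<in> ?E" for x
    proof -
      have "cyc a \<subseteq> cent {b}" using ac bc comm by (intro cyc_subset subgroup_cent centI) auto
      then show ?thesis using that centD[of x "{b}" b] by auto
    qed
    have "v [^] card ?E = \<one>"
    proof (rule pow_card_eq_one[OF E _ ab(4) _ _ _ _ v(1), of "\<lambda>i. b \<otimes> i" "\<lambda>j. b [^] j"])
      show "b \<otimes> i \<in> Y" if "i \<in> ?E" for i using that E ab by auto
      show "b [^] j \<in> Y" for j :: nat using subgroup_pow_closed[OF Y ab(2)] .
      have pow: "(b \<otimes> i) [^] n = b [^] n \<otimes> i [^] n" if "i \<in> ?E" for i and n :: nat
        using that bc comm'[OF that] by (intro pow_mult_distrib) auto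
      have ipow: "i [^] ?p = \<one>" if i: "i \<in> ?E" for i
      proof -
        obtain n :: nat where n: "i = a [^] n" using i unfolding cyc_eq[OF fin ac] by (rule rangeE)
        have "i [^] ?p = a [^] (?p * n)" unfolding n nat_pow_pow[OF ac] by (simp only: mult.commute)
        also have "\<dots> = (a [^] ?p) [^] n" by (rule nat_pow_pow[OF ac, symmetric])
        also have "\<dots> = \<one>" unfolding pow_ord_eq_1[OF ac] by (rule nat_pow_one)
        finally show ?thesis .
      qed
      show "ord (b \<otimes> i) = ?q" if i: "i \<in> ?E" for i
      proof (rule ord_eq_prime[OF _ _ _ ab(4)])
        show "b \<otimes> i \<in> carrier G" using bc i by simp
        show "b \<otimes> i \<noteq> \<one>"
        proof
          assume "b \<otimes> i = \<one>"
          then have "b = inv i" using bc i by (simp add: inv_equality)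
          then show False using nb i by simp
        qed
        show "(b \<otimes> i) [^] ?q = \<one>" using pow[OF i] ipow[OF i] bc pq by simp
      qed
      fix j :: nat assume j: "0 < j" "j < ?q"
      have pE: "i [^] j \<in> ?E" if "i \<in> ?E" for i using subgroup_pow_closed[OF E(1) that] .
      show "inv (b [^] j) \<otimes> (b \<otimes> i) [^] j \<in> ?E" if i: "i \<in> ?E" for i
        using pow[OF i] pE[OF i] bc i by (simp add: cancel_inv_left)
      show "inj_on (\<lambda>i. (b \<otimes> i) [^] j) ?E"
      proof (rule inj_onI)
        fix x y assume xy: "x \<in> ?E" "y \<in> ?E" "(b \<otimes> x) [^] j = (b \<otimes> y) [^] j"
        have xc: "x \<in> carrier G" "y \<in> carrier G" using xy by auto
        have "x [^] j = y [^] j" using xy pow bc xc by simp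
        moreover have "(x \<otimes> inv y) [^] j = x [^] j \<otimes> inv (y [^] j)"
          using pow_mult_distrib[OF Ecomm[of x "inv y"], of j] xc xy by (simp add: nat_pow_inv)
        ultimately have z: "(x \<otimes> inv y) [^] j = \<one>" using xc by simp
        show "x = y"
        proof (rule ccontr)
          assume "x \<noteq> y"
          then have "x \<otimes> inv y \<noteq> \<one>" using xc by (metis inv_equality inv_inv inv_closed)
          then have "ord (x \<otimes> inv y) = ?p" using cyc_eq_cyc(2)[OF fin ac ab(3), of "x \<otimes> inv y"] xy by simp
          then have "?p dvd j" using z xc by (simp add: pow_eq_id)
          then show False using j pq by (simp add: nat_dvd_not_less)
        qed
      qed
    qed
    then show False using no_pow cardE by simp
  qed
qed

end

subsection \<open>Uniqueness of subgroups of prime order\<close>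

text \<open>The pairs \<open>(g, x)\<close> with \<open>g\<close> in \<open>Y\<close> and
  \<open>x\<close> in \<open>A - {1}\<close> are counted by the value of \<open>conjug g x\<close>.
  By \<open>TI\<close> the first components of two pairs with the same value differ by a right
  factor in \<open>A\<close>, so each fibre has \<open>card A\<close> elements.\<close>

lemma card_conjugates_of_TI_subgroup:
  assumes fin: "finite (carrier G)" and Y: "subgroup Y G" and A: "subgroup A G" "A \<subseteq> Y"
    and TI: "\<And>g x. g \<in> Y \<Longrightarrow> x \<in> A \<Longrightarrow> x \<noteq> \<one> \<Longrightarrow> conjug g x \<in> A \<Longrightarrow> g \<in> A"
  shows "card (\<Union>g\<in>Y. conjug g ` (A - {\<one>})) * card A = card Y * (card A - 1)"
proof -
  interpret Y: subgroup Y G by fact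
  interpret A: subgroup A G by fact
  have finY: "finite Y" and finA: "finite A" using finite_subset[OF Y.subset fin] finite_subset[OF A.subset fin] .
  let ?S = "Y \<times> (A - {\<one>})"
  let ?f = "\<lambda>(g, x). conjug g x"
  have finS: "finite ?S" using finY finA by simp
  have fib: "card {s \<in> ?S. ?f s = u} = card A" if u: "u \<in> ?f ` ?S" for u
  proof -
    obtain g x where gx: "g \<in> Y" "x \<in> A" "x \<noteq> \<one>" "u = conjug g x" using u by auto
    have gc: "g \<in> carrier G" and xc: "x \<in> carrier G" using gx by auto
    let ?h = "\<lambda>k. (g \<otimes> k, conjug (inv k) x)"
    have "?h ` A = {s \<in> ?S. ?f s = u}"
    proof (intro equalityI subsetI)
      fix s assume "s \<in> ?h ` A"
      then obtain k where k: "k \<in> A" "s = ?h k" by blast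
      have kc: "k \<in> carrier G" using k by simp
      have "conjug (inv k) x \<in> A" using k gx by (simp add: conjug_def)
      moreover have "conjug (inv k) x \<noteq> \<one>" using kc xc gx by (simp add: conjug_eq_one_iff)
      moreover have "g \<otimes> k \<in> Y" using gx k A by blast
      moreover have "conjug (g \<otimes> k) (conjug (inv k) x) = u"
        using kc gc xc gx by (simp add: conjug_conjug m_assoc)
      ultimately show "s \<in> {s \<in> ?S. ?f s = u}" using k by simp
    next
      fix s assume "s \<in> {s \<in> ?S. ?f s = u}"
      then obtain h y where hy: "s = (h, y)" "h \<in> Y" "y \<in> A" "y \<noteq> \<one>" "conjug h y = conjug g x"
        using gx by auto
      have hc: "h \<in> carrier G" and yc: "y \<in> carrier G" using hy by auto
      let ?k = "inv g \<otimes> h"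
      have "conjug ?k y = conjug (inv g) (conjug h y)" using gc hc yc by (simp add: conjug_conjug)
      then have ky: "conjug ?k y = x" using hy gc xc by simp
      have kA: "?k \<in> A" using TI[of ?k y] hy gx ky by simp
      have "conjug (inv ?k) x = y" unfolding ky[symmetric] using gc hc yc by simp
      moreover have "g \<otimes> ?k = h" using gc hc by (simp add: cancel_inv_left)
      ultimately show "s \<in> ?h ` A" using kA hy by (intro image_eqI[of _ _ ?k]) simp_all
    qed
    moreover have "inj_on ?h A" using gc by (auto simp: inj_on_def)
    ultimately show ?thesis using card_image[of ?h A] by simp
  qed
  have "card ?S = (\<Sum>u\<in>?f ` ?S. card {s \<in> ?S. ?f s = u})"
    using sum.image_gen[OF finS, of "\<lambda>_. 1::nat" ?f] by simp
  also have "\<dots> = card (?f ` ?S) * card A" using fib by simp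
  finally have "card (?f ` ?S) * card A = card Y * (card A - 1)"
    using finA by (simp add: card_cartesian_product)
  moreover have "?f ` ?S = (\<Union>g\<in>Y. conjug g ` (A - {\<one>}))" by auto
  ultimately show ?thesis by simp
qed

lemma transfer_hom_subgroup:
  assumes fin: "finite Y" and Y: "subgroup Y G" and R: "subgroup R G" "R \<subseteq> Y"
    and comm: "\<And>x y. x \<in> R \<Longrightarrow> y \<in> R \<Longrightarrow> x \<otimes> y = y \<otimes> x"
  obtains \<phi> m where "m * card R = card Y" "\<forall>g\<in>Y. \<phi> g \<in> R"
    "\<forall>g\<in>Y. \<forall>h\<in>Y. \<phi> (g \<otimes> h) = \<phi> g \<otimes> \<phi> h"
    "\<forall>x\<in>R. (\<forall>g\<in>Y. g \<otimes> x = x \<otimes> g) \<longrightarrow> \<phi> x = x [^] (m::nat)"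
proof -
  let ?Y = "G\<lparr>carrier := Y\<rparr>"
  interpret GY: group ?Y using Y by (rule subgroup_imp_group)
  have RY: "subgroup R ?Y" using R Y by (simp add: subgroup_incl)
  have "card (rcosets\<^bsub>?Y\<^esub> R) * card R = card Y" using GY.lagrange[OF RY] by (simp add: order_def)
  moreover have finc: "finite (carrier ?Y)" using fin by simp
  have "\<exists>\<phi>. (\<forall>g\<in>Y. \<phi> g \<in> R) \<and> (\<forall>g\<in>Y. \<forall>h\<in>Y. \<phi> (g \<otimes> h) = \<phi> g \<otimes> \<phi> h) \<and>
    (\<forall>x\<in>R. (\<forall>g\<in>Y. g \<otimes> x = x \<otimes> g) \<longrightarrow> \<phi> x = x [^] card (rcosets\<^bsub>?Y\<^esub> R))"
  proof (rule GY.transfer_hom[OF finc RY])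
    fix \<phi>
    assume \<phi>: "\<And>g. g \<in> carrier ?Y \<Longrightarrow> \<phi> g \<in> R"
      "\<And>g h. g \<in> carrier ?Y \<Longrightarrow> h \<in> carrier ?Y \<Longrightarrow> \<phi> (g \<otimes>\<^bsub>?Y\<^esub> h) = \<phi> g \<otimes>\<^bsub>?Y\<^esub> \<phi> h"
      "\<And>x. x \<in> R \<Longrightarrow> (\<And>g. g \<in> carrier ?Y \<Longrightarrow> g \<otimes>\<^bsub>?Y\<^esub> x = x \<otimes>\<^bsub>?Y\<^esub> g)
        \<Longrightarrow> \<phi> x = x [^]\<^bsub>?Y\<^esub> card (rcosets\<^bsub>?Y\<^esub> R)"
    show ?thesis
    proof (intro exI[of _ \<phi>] conjI ballI impI)
      fix x assume "x \<in> R" "\<forall>g\<in>Y. g \<otimes> x = x \<otimes> g"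
      then show "\<phi> x = x [^] card (rcosets\<^bsub>?Y\<^esub> R)"
        using \<phi>(3)[of x] by (simp add: nat_pow_consistent[symmetric])
    qed (use \<phi>(1,2) in simp_all)
  qed (simp add: comm)
  ultimately show thesis using that by blast
qed

text \<open>Write \<open>r\<close> for \<open>ord a\<close>. All elements of prime order commute
  with \<open>a\<close>, so unless \<open>a\<close> is central, \<open>IH\<close> applies to the
  centralizer of \<open>a\<close> in \<open>Y\<close>. For central \<open>a\<close>,
  \<open>cyc a\<close> is the only subgroup of order \<open>r\<close>, hence a Sylow
  \<open>r\<close>-subgroup \<open>R\<close> is abelian, and the transfer into \<open>R\<close> does
  not kill \<open>a\<close>. Its kernel is a proper subgroup that contains all elements of prime
  order different from \<open>r\<close>.\<close>

lemma prime_order_unique_of_normal: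
  assumes fin: "finite (carrier G)" and Y: "subgroup Y G" "odd (card Y)"
    and comm: "\<And>a b. \<lbrakk>a \<in> Y; b \<in> Y; prime (ord a); prime (ord b); b \<in> setnorm (cyc a)\<rbrakk> \<Longrightarrow> a \<otimes> b = b \<otimes> a"
    and same: "\<And>a b. \<lbrakk>a \<in> Y; b \<in> Y; prime (ord a); prime (ord b); b \<in> setnorm (cyc a); ord a = ord b\<rbrakk>
      \<Longrightarrow> b \<in> cyc a"
    and IH: "\<And>Z x y. \<lbrakk>subgroup Z G; Z \<subset> Y; x \<in> Z; y \<in> Z; prime (ord x); ord y = ord x\<rbrakk> \<Longrightarrow> y \<in> cyc x"
    and a: "a \<in> Y" "prime (ord a)" "Y \<subseteq> setnorm (cyc a)"
    and xy: "x \<in> Y" "y \<in> Y" "prime (ord x)" "ord y = ord x"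
  shows "y \<in> cyc x"
proof -
  interpret Y: subgroup Y G by (rule Y)
  have finY: "finite Y" using finite_subset[OF Y.subset fin] .
  have ac: "a \<in> carrier G" using a by simp
  let ?r = "ord a"
  have acomm: "a \<otimes> b = b \<otimes> a" if "b \<in> Y" "prime (ord b)" for b
    using comm[OF a(1) that(1) a(2) that(2)] a(3) that(1) by blast
  show ?thesis
  proof (cases "Y \<subseteq> cent {a}")
    case False
    have "subgroup (Y \<inter> cent {a}) G" using Y ac by (intro subgroups_Inter_pair subgroup_cent) auto
    moreover have "Y \<inter> cent {a} \<subset> Y" using False by blast
    moreover have "x \<in> Y \<inter> cent {a}" "y \<in> Y \<inter> cent {a}"
      using xy acomm[of x] acomm[of y] by (auto intro!: centI)
    ultimately show ?thesis using IH xy(3,4) by blast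
  next
    case True
    have cen: "g \<otimes> a = a \<otimes> g" if "g \<in> Y" for g using True that centD[of g "{a}" a] by blast
    have r_cyc: "b \<in> cyc a" if "b \<in> Y" "ord b = ?r" for b
      by (rule same[OF a(1) that(1) a(2) _ subsetD[OF a(3) that(1)]]) (use that(2) a(2) in simp_all)
    show ?thesis
    proof (cases "ord x = ?r")
      case True
      have "x \<noteq> \<one>" using xy(3) by (rule prime_ord_ne_one)
      then have "cyc x = cyc a" using cyc_eq_cyc(1)[OF fin ac a(2) r_cyc[OF xy(1) True]] by blast
      then show ?thesis using r_cyc[OF xy(2)] xy(4) True by simp
    next
      case False
      have "card Y \<noteq> 0" using finY xy(1) card_0_eq by blast
      then obtain m where m: "card Y = ?r ^ multiplicity ?r (card Y) * m" "\<not> ?r dvd m"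
        using multiplicity_decompose'[of "card Y" ?r] a(2) not_prime_unit[of ?r] by blast
      let ?n = "multiplicity ?r (card Y)"
      have rdvd: "?r dvd card Y"
        using card_dvd_of_subset[OF subgroup_cyc[OF ac] Y(1) cyc_subset[OF Y(1) a(1)]] card_cyc[OF ac] by simp
      then have n0: "?n \<noteq> 0" using m by (metis mult_1 power_0)
      have odd_r: "odd ?r" using rdvd Y(2) by (meson dvd_trans)
      obtain R where R: "subgroup R G" "R \<subseteq> Y" "card R = ?r ^ ?n"
        using sylow_subgroup_exists[OF Y(1) finY a(2), of ?n] multiplicity_dvd by blast
      interpret R: subgroup R G by (rule R(1))
      let ?R = "G\<lparr>carrier := R\<rparr>"
      interpret GR: group ?R using R(1) by (rule subgroup_imp_group)
      have Rcomm: "u \<otimes> v = v \<otimes> u" if "u \<in> R" "v \<in> R" for u v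
      proof -
        have "u \<otimes>\<^bsub>?R\<^esub> v = v \<otimes>\<^bsub>?R\<^esub> u"
        proof (rule GR.odd_p_group_abelian[of ?r ?n])
          fix s t assume st: "s \<in> carrier ?R" "t \<in> carrier ?R" "s \<noteq> \<one>\<^bsub>?R\<^esub>" "t \<noteq> \<one>\<^bsub>?R\<^esub>"
            "s [^]\<^bsub>?R\<^esub> ?r = \<one>\<^bsub>?R\<^esub>" "t [^]\<^bsub>?R\<^esub> ?r = \<one>\<^bsub>?R\<^esub>"
          then have st': "s \<in> Y" "t \<in> Y" "s \<in> carrier G" "t \<in> carrier G" "s \<noteq> \<one>" "t \<noteq> \<one>"
              "s [^] ?r = \<one>" "t [^] ?r = \<one>"
            using R(2) by (auto simp: nat_pow_consistent[symmetric])
          have "ord s = ?r" "ord t = ?r" using st' a(2) by (auto intro!: ord_eq_prime)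
          then have "s \<in> cyc a" "t \<in> cyc a" using r_cyc st' by auto
          then have "t \<in> cyc s" using cyc_eq_cyc(1)[OF fin ac a(2) _ st'(5)] by blast
          then obtain j :: nat where "t = s [^] j" using cyc_eq[OF fin st'(3)] by blast
          then show "\<exists>j::nat. t = s [^]\<^bsub>?R\<^esub> j" by (auto simp: nat_pow_consistent[symmetric])
        qed (use R(3) a(2) odd_r that in \<open>auto simp: order_def\<close>)
        then show ?thesis by simp
      qed
      obtain s where s: "s \<in> R" "ord s = ?r"
        using cauchy[OF R(1) _ a(2)] finite_subset[OF R(2) finY] R(3) n0 by (auto simp: dvd_power)
      have aR: "a \<in> R"
      proof -
        have "s \<noteq> \<one>" using s(2) a(2) prime_ord_ne_one[of s] by simp
        then have "cyc s = cyc a" using cyc_eq_cyc(1)[OF fin ac a(2) r_cyc] s R(2) by blast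
        then show ?thesis using cyc_subset[OF R(1) s(1)] in_cyc[of a] by blast
      qed
      obtain \<phi> k where k: "k * card R = card Y" and \<phi>': "\<forall>g\<in>Y. \<phi> g \<in> R"
          "\<forall>g\<in>Y. \<forall>h\<in>Y. \<phi> (g \<otimes> h) = \<phi> g \<otimes> \<phi> h"
          "\<forall>x\<in>R. (\<forall>g\<in>Y. g \<otimes> x = x \<otimes> g) \<longrightarrow> \<phi> x = x [^] (k::nat)"
        using transfer_hom_subgroup[OF finY Y(1) R(1,2)] Rcomm by metis
      note \<phi> = bspec[OF \<phi>'(1)] bspec[OF bspec[OF \<phi>'(2)]]
      have "card R > 0" using R(3) a(2) by (simp add: prime_gt_0_nat)
      then have "k = m" using k m(1) R(3) by (metis mult.commute mult_cancel_left not_gr_zero)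
      \<comment> \<open>The transfer sends the central element \<open>a\<close> to its
        \<open>m\<close>-th power, where \<open>m\<close> is the index of \<open>R\<close> and
        therefore prime to \<open>ord a\<close>.\<close>
      then have \<phi>a: "\<phi> a \<noteq> \<one>" using \<phi>'(3) aR cen \<open>k = m\<close> m(2) ac by (simp add: pow_eq_id)
      have \<phi>c: "\<phi> g \<in> carrier G" if "g \<in> Y" for g using \<phi>(1)[OF that] by simp
      have \<phi>1: "\<phi> \<one> = \<one>"
      proof -
        have "\<phi> \<one> \<otimes> \<phi> \<one> = \<phi> \<one>" using \<phi>(2)[of \<one> \<one>] by simp
        then show ?thesis using \<phi>c[of \<one>] by simp
      qed
      let ?K = "{g \<in> Y. \<phi> g = \<one>}"
      have K: "subgroup ?K G"
      proof (rule subgroupI)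
        show "?K \<noteq> {}" using \<phi>1 Y.one_closed by blast
        show "inv g \<in> ?K" if "g \<in> ?K" for g
        proof -
          have g: "g \<in> Y" "\<phi> g = \<one>" using that by auto
          have "\<phi> (inv g) = \<phi> (inv g) \<otimes> \<phi> g" using g \<phi>c[of "inv g"] by simp
          also have "\<dots> = \<phi> (inv g \<otimes> g)" using \<phi>(2)[of "inv g" g] g by simp
          finally show ?thesis using g \<phi>1 by simp
        qed
      qed (use \<phi>(2) in auto)
      have Kprop: "?K \<subset> Y" using a(1) \<phi>a by blast
      \<comment> \<open>The order of \<open>\<phi> b\<close> divides both a power of
        \<open>ord a\<close> and the different prime \<open>ord x\<close>.\<close>
      have Kin: "b \<in> ?K" if b: "b \<in> Y" "ord b = ord x" for b
      proof -
        have bc: "b \<in> carrier G" using b by simp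
        have pw: "\<phi> (b [^] n) = \<phi> b [^] n" for n :: nat
          using \<phi>(2)[OF subgroup_pow_closed[OF Y(1) b(1)] b(1)] by (induction n) (simp_all add: \<phi>1)
        have "\<phi> b [^] ord x = \<one>" using pw[of "ord x"] bc b(2)[symmetric] \<phi>1 by simp
        then have 1: "ord (\<phi> b) dvd ord x" using \<phi>c[OF b(1)] by (simp add: pow_eq_id)
        have 2: "ord (\<phi> b) dvd ?r ^ ?n"
          using card_dvd_of_subset[OF subgroup_cyc[OF \<phi>c[OF b(1)]] R(1) cyc_subset[OF R(1) \<phi>(1)[OF b(1)]]]
            card_cyc[OF \<phi>c[OF b(1)]] R(3) by simp
        have "coprime (ord x) (?r ^ ?n)" using False xy(3) a(2) by (simp add: primes_coprime)
        then have "ord (\<phi> b) = 1" using 1 2 by (metis coprime_common_divisor nat_dvd_1_iff_1)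
        then show ?thesis using b \<phi>c[OF b(1)] ord_eq_1 by blast
      qed
      show ?thesis by (rule IH[OF K Kprop Kin[OF xy(1) refl] Kin[OF xy(2,4)] xy(3,4)])
    qed
  qed
qed

text \<open>Induction on \<open>card Y\<close>. If no subgroup of prime order is normal, their
  normalizers \<open>H a\<close> are proper and enjoy uniqueness by induction. It follows that two
  of them are equal or meet trivially, and that the conjugates of one cover at least half of
  \<open>Y\<close> but not all of \<open>Y - {1}\<close>. An uncovered element gives a second
  family, and the two families together are too large for \<open>Y - {1}\<close>.\<close>

lemma prime_order_unique:
  assumes fin: "finite (carrier G)" and Y: "subgroup Y G" "odd (card Y)"
    and comm: "\<And>a b. \<lbrakk>a \<in> Y; b \<in> Y; prime (ord a); prime (ord b); b \<in> setnorm (cyc a)\<rbrakk> \<Longrightarrow> a \<otimes> b = b \<otimes> a"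
    and same: "\<And>a b. \<lbrakk>a \<in> Y; b \<in> Y; prime (ord a); prime (ord b); b \<in> setnorm (cyc a); ord a = ord b\<rbrakk>
      \<Longrightarrow> b \<in> cyc a"
    and xy: "x \<in> Y" "y \<in> Y" "prime (ord x)" "ord y = ord x"
  shows "y \<in> cyc x"
  using Y comm same xy
proof (induction "card Y" arbitrary: Y x y rule: less_induct)
  case less
  note Y = less.prems(1,2) and comm = less.prems(3) and same = less.prems(4) and xy = less.prems(5-8)
  interpret Y: subgroup Y G by (rule Y)
  have finY: "finite Y" using finite_subset[OF Y.subset fin] .
  have IH: "v \<in> cyc u" if Z: "subgroup Z G" "Z \<subset> Y" "u \<in> Z" "v \<in> Z" "prime (ord u)" "ord v = ord u" for Z u v
  proof (rule less.hyps[OF _ Z(1) _ _ _ Z(3-6)])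
    show "card Z < card Y" using Z finY by (simp add: psubset_card_mono)
    have "card Z dvd card Y" using card_dvd_of_subset[OF Z(1) Y(1)] Z(2) by blast
    then show "odd (card Z)" using Y(2) by (meson dvd_trans)
    have ZY: "a \<in> Y" if "a \<in> Z" for a using Z(2) that by blast
    show "a \<otimes> b = b \<otimes> a"
      if "a \<in> Z" "b \<in> Z" "prime (ord a)" "prime (ord b)" "b \<in> setnorm (cyc a)" for a b
      by (rule comm[OF ZY[OF that(1)] ZY[OF that(2)] that(3-5)])
    show "b \<in> cyc a"
      if "a \<in> Z" "b \<in> Z" "prime (ord a)" "prime (ord b)" "b \<in> setnorm (cyc a)" "ord a = ord b" for a b
      by (rule same[OF ZY[OF that(1)] ZY[OF that(2)] that(3-6)])
  qed
  show ?case
  proof (cases "\<exists>a\<in>Y. prime (ord a) \<and> Y \<subseteq> setnorm (cyc a)")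
    case True
    then obtain a where a: "a \<in> Y" "prime (ord a)" "Y \<subseteq> setnorm (cyc a)" by blast
    show ?thesis by (rule prime_order_unique_of_normal[OF fin Y comm same IH a xy])
  next
    case False
    define H where "H a = Y \<inter> setnorm (cyc a)" for a
    have Hsub: "subgroup (H a) G" if "a \<in> Y" for a
      unfolding H_def using that Y(1) fin by (intro subgroups_Inter_pair subgroup_setnorm_cyc) auto
    have Hprop: "H a \<subset> Y" if "a \<in> Y" "prime (ord a)" for a
      using False that unfolding H_def by blast
    have Huniq: "v \<in> cyc u" if "a \<in> Y" "prime (ord a)" "u \<in> H a" "v \<in> H a" "prime (ord u)" "ord v = ord u" for a u v
      by (rule IH[OF Hsub[OF that(1)] Hprop[OF that(1,2)] that(3-6)])
    have in_H: "b \<in> H a" if "a \<in> Y" "b \<in> Y" "b \<otimes> a = a \<otimes> b" for a b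
      unfolding H_def using that fin by (auto intro!: commute_in_setnorm_cyc)
    have Hconj: "conjug g ` H a = H (conjug g a)" if "g \<in> Y" "a \<in> Y" for g a
    proof -
      have sub: "conjug g ` H a \<subseteq> H (conjug g a)" if "g \<in> Y" "a \<in> Y" for g a
      proof
        fix z assume "z \<in> conjug g ` H a"
        then obtain h where h: "h \<in> Y" "h \<in> setnorm (cyc a)" "z = conjug g h" by (auto simp: H_def)
        have c: "g \<in> carrier G" "a \<in> carrier G" "h \<in> carrier G" using that h by auto
        have zY: "z \<in> Y" unfolding h(3) conjug_def using that h by simp
        have "conjug z (conjug g a) = conjug g (conjug h a)"
          using c by (simp add: h(3) conjug_def group_word_simps)
        also have "\<dots> \<in> conjug g ` cyc a" using setnormD[OF h(2) in_cyc] by (rule imageI)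
        also have "\<dots> = cyc (conjug g a)" using conjug_cyc[OF fin] c by simp
        finally show "z \<in> H (conjug g a)" using zY c fin by (simp add: H_def setnorm_cyc_iff)
      qed
      have c: "g \<in> carrier G" "a \<in> carrier G" using that by auto
      have gaY: "conjug g a \<in> Y" unfolding conjug_def using that by simp
      have "H (conjug g a) \<subseteq> conjug g ` H a"
      proof
        fix z assume z: "z \<in> H (conjug g a)"
        then have "conjug (inv g) z \<in> H (conjug (inv g) (conjug g a))" using sub[of "inv g" "conjug g a"] that gaY by blast
        then have "conjug (inv g) z \<in> H a" using c by simp
        moreover have "z = conjug g (conjug (inv g) z)" using z c by (simp add: H_def)
        ultimately show "z \<in> conjug g ` H a" by blast
      qed
      then show ?thesis using sub[OF that] by blast
    qed
    \<comment> \<open>An element of \<open>H a\<close> conjugates \<open>c\<close> to an element of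
      \<open>H a\<close> of the same prime order, which lies in \<open>cyc c\<close> by uniqueness
      in \<open>H a\<close>.\<close>
    have Hmono: "H a \<subseteq> H c" if ac: "a \<in> Y" "prime (ord a)" "c \<in> H a" "prime (ord c)" for a c
    proof
      fix g assume g: "g \<in> H a"
      have cc: "c \<in> carrier G" and gc: "g \<in> carrier G" using ac g by (auto simp: H_def)
      have "conjug g c \<in> H a"
        unfolding conjug_def using g ac Hsub[OF ac(1)] by (simp add: subgroup.m_closed subgroup.m_inv_closed)
      then have "conjug g c \<in> cyc c" using Huniq[OF ac(1,2,3) _ ac(4)] ord_conjug[OF gc cc] by simp
      then show "g \<in> H c" using g gc cc fin by (simp add: H_def setnorm_cyc_iff)
    qed
    have Heq: "H c = H a" if ac: "a \<in> Y" "prime (ord a)" "c \<in> H a" "prime (ord c)" for a c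
    proof
      have cY: "c \<in> Y" "c \<in> setnorm (cyc a)" using ac by (auto simp: H_def)
      show "H a \<subseteq> H c" by (rule Hmono[OF ac])
      have "a \<in> H c" using in_H[OF cY(1) ac(1)] comm[OF ac(1) cY(1) ac(2,4) cY(2)] by simp
      then show "H c \<subseteq> H a" using Hmono[OF cY(1) ac(4) _ ac(2)] by blast
    qed
    have Hmeet: "H a = H c" if ac: "a \<in> Y" "prime (ord a)" "c \<in> Y" "prime (ord c)" and z: "z \<in> H a" "z \<in> H c" "z \<noteq> \<one>" for a c z
    proof -
      have "z \<in> carrier G" using z by (auto simp: H_def)
      then obtain n :: nat where n: "prime (ord (z [^] n))" using exists_prime_power[OF fin] z(3) by blast
      have "z [^] n \<in> H a" "z [^] n \<in> H c"
        using subgroup_pow_closed[OF Hsub[OF ac(1)] z(1)] subgroup_pow_closed[OF Hsub[OF ac(3)] z(2)] by auto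
      then show ?thesis using Heq[OF ac(1,2) _ n] Heq[OF ac(3,4) _ n] by simp
    qed
    have aH: "a \<in> H a" if "a \<in> Y" for a using in_H[OF that that] by simp
    \<comment> \<open>\<open>conjug g z\<close> lies in both \<open>H a\<close> and
      \<open>H (conjug g a)\<close>, so these coincide. Then \<open>conjug g a\<close> is an element
      of \<open>H a\<close> of the same order as \<open>a\<close>, hence in
      \<open>cyc a\<close>.\<close>
    have TI: "g \<in> H a" if a: "a \<in> Y" "prime (ord a)" and g: "g \<in> Y" "z \<in> H a" "z \<noteq> \<one>" "conjug g z \<in> H a" for a g z
    proof -
      have c: "a \<in> carrier G" "g \<in> carrier G" "z \<in> carrier G" using a g by (auto simp: H_def)
      have gaY: "conjug g a \<in> Y" unfolding conjug_def using a g by simp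
      have og: "ord (conjug g a) = ord a" using c by (simp add: ord_conjug)
      have "conjug g z \<in> H (conjug g a)" using Hconj[OF g(1) a(1)] g(2) by blast
      then have eq: "H (conjug g a) = H a"
        using Hmeet[OF gaY _ a, of "conjug g z"] g og a c by (simp add: conjug_eq_one_iff)
      have "conjug g a \<in> H a" using aH[OF gaY] eq by simp
      then have "conjug g a \<in> cyc a" using Huniq[OF a aH[OF a(1)] _ a(2) og] by blast
      then show ?thesis using g c fin by (simp add: H_def setnorm_cyc_iff)
    qed
    have HY: "H a \<subseteq> Y" for a by (simp add: H_def)
    let ?U = "\<lambda>a. \<Union>g\<in>Y. conjug g ` (H a - {\<one>})"
    have cardU: "card (?U a) * card (H a) = card Y * (card (H a) - 1)" if "a \<in> Y" "prime (ord a)" for a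
      by (rule card_conjugates_of_TI_subgroup[OF fin Y(1) Hsub[OF that(1)] HY TI[OF that]])
    have Usub: "?U a \<subseteq> Y - {\<one>}" if "a \<in> Y" for a
    proof
      fix u assume "u \<in> ?U a"
      then obtain g z where u: "g \<in> Y" "z \<in> H a" "z \<noteq> \<one>" "u = conjug g z" by blast
      then have "z \<in> Y" using HY by blast
      then show "u \<in> Y - {\<one>}" using u(1,3,4) by (simp add: conjug_eq_one_iff) (simp add: conjug_def)
    qed
    have card2: "2 \<le> card (H a)" if a: "a \<in> Y" "prime (ord a)" for a
    proof -
      have "card {\<one>, a} \<le> card (H a)"
        using finY aH[OF a(1)] subgroup.one_closed[OF Hsub[OF a(1)]] by (intro card_mono) (auto simp: H_def)
      then show ?thesis using prime_ord_ne_one[OF a(2)] by simp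
    qed
    \<comment> \<open>By \<open>cardU\<close>, \<open>?U a\<close> has
      \<open>card Y (1 - 1 / card (H a))\<close> elements. The lower bound comes from
      \<open>2 \<le> card (H a)\<close>, the upper bound \<open>small\<close> from
      \<open>card (H a) < card Y\<close>.\<close>
    have half: "card Y \<le> 2 * card (?U a)" if a: "a \<in> Y" "prime (ord a)" for a
    proof -
      obtain k where k: "card (H a) = Suc (Suc k)" using card2[OF a] by (metis Suc_le_D numeral_2_eq_2 Suc_le_mono)
      have "card Y * card (H a) \<le> card Y * (2 * (card (H a) - 1))" unfolding k by simp
      also have "\<dots> = 2 * card (?U a) * card (H a)" using cardU[OF a] by simp
      finally show ?thesis using k by (simp only: mult_le_cancel2)
    qed
    have small: "card (?U a) < card Y - 1" if a: "a \<in> Y" "prime (ord a)" for a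
    proof -
      obtain k where k: "card (H a) = Suc k" using card2[OF a] by (metis Suc_le_D numeral_2_eq_2)
      have "Suc k < card Y" using psubset_card_mono[OF finY Hprop[OF a]] k by simp
      have "card (?U a) * Suc k + Suc k < card Y * k + card Y"
        using cardU[OF a] \<open>Suc k < card Y\<close> unfolding k by simp
      then have "Suc (card (?U a)) * Suc k < card Y * Suc k" by simp
      then have "Suc (card (?U a)) < card Y" by (simp only: mult_less_cancel2)
      then show ?thesis by simp
    qed
    have fU: "finite (?U a)" if "a \<in> Y" for a using finite_subset[OF Usub[OF that]] finY by blast
    have "card (Y - {\<one>}) = card Y - 1" using finY by (simp add: card_Diff_singleton)
    then have "?U x \<noteq> Y - {\<one>}" using small[OF xy(1,3)] by auto
    then obtain z where z: "z \<in> Y" "z \<noteq> \<one>" "z \<notin> ?U x" using Usub[OF xy(1)] by blast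
    then obtain n :: nat where n: "prime (ord (z [^] n))" using exists_prime_power[OF fin] Y.mem_carrier by blast
    let ?z = "z [^] n"
    have zY: "?z \<in> Y" using subgroup_pow_closed[OF Y(1) z(1)] .
    have zH: "z \<in> H ?z" using in_H[OF zY z(1)] group_commutes_pow[of z z n] z by simp
    \<comment> \<open>A common element would make a conjugate of \<open>H x\<close> equal to
      \<open>H ?z\<close>, which contains \<open>z\<close>; but \<open>z\<close> was chosen outside
      all conjugates of \<open>H x\<close>.\<close>
    have disj: "?U x \<inter> ?U ?z = {}"
    proof (rule ccontr)
      assume "?U x \<inter> ?U ?z \<noteq> {}"
      then obtain g h s t where gh: "g \<in> Y" "h \<in> Y" "s \<in> H x" "s \<noteq> \<one>" "t \<in> H ?z" "t \<noteq> \<one>" "conjug g s = conjug h t"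
        by blast
      have c: "g \<in> carrier G" "h \<in> carrier G" "s \<in> carrier G" "t \<in> carrier G" "x \<in> carrier G"
        using gh xy by (auto simp: H_def)
      let ?k = "inv h \<otimes> g"
      have kY: "?k \<in> Y" using gh by simp
      have "conjug ?k s = conjug (inv h) (conjug g s)" using c by (simp add: conjug_conjug)
      then have ks: "conjug ?k s = t" using gh c by simp
      have kxY: "conjug ?k x \<in> Y" unfolding conjug_def[of ?k x] using kY xy by simp
      have ko: "prime (ord (conjug ?k x))" using c xy by (simp add: ord_conjug)
      have "t \<in> H (conjug ?k x)" using Hconj[OF kY xy(1)] gh(3) ks by blast
      then have "H (conjug ?k x) = H ?z" using Hmeet[OF kxY ko zY n _ gh(5,6)] by blast
      then have "z \<in> conjug ?k ` H x" using zH Hconj[OF kY xy(1)] by simp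
      then obtain s' where s': "s' \<in> H x" "z = conjug ?k s'" by blast
      then have "s' \<noteq> \<one>" using z(2) c by auto
      then have "z \<in> ?U x" using s' kY by blast
      then show False using z by blast
    qed
    have "card (?U x) + card (?U ?z) = card (?U x \<union> ?U ?z)"
      using card_Un_disjoint[OF fU[OF xy(1)] fU[OF zY] disj] by simp
    also have "\<dots> \<le> card (Y - {\<one>})" using Usub[OF xy(1)] Usub[OF zY] finY by (intro card_mono) auto
    also have "\<dots> < card Y" using card_Diff1_less[OF finY Y.one_closed] .
    finally have "2 * card (?U x) + 2 * card (?U ?z) < 2 * card Y" by simp
    then have False using half[OF xy(1,3)] half[OF zY n] by linarith
    then show ?thesis ..
  qed
qed

subsection \<open>Construction of Frobenius complements\<close>

lemma fpf_commutator_inj: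
  assumes x: "x \<in> carrier G" and M: "subgroup M G" and fpf: "\<And>m. m \<in> M \<Longrightarrow> conjug x m = m \<Longrightarrow> m = \<one>"
  shows "inj_on (\<lambda>n. inv n \<otimes> conjug x n) M"
proof (rule inj_onI)
  fix n k assume nk: "n \<in> M" "k \<in> M" and eq: "inv n \<otimes> conjug x n = inv k \<otimes> conjug x k"
  interpret M: subgroup M G by (rule M)
  have c: "n \<in> carrier G" "k \<in> carrier G" using nk by auto
  have "conjug x (k \<otimes> inv n) = conjug x k \<otimes> inv (conjug x n)"
    using c x by (simp add: conjug_mult conjug_inv)
  also have "conjug x k = k \<otimes> (inv n \<otimes> conjug x n)" unfolding eq using c x by (simp add: cancel_inv_left)
  also have "k \<otimes> (inv n \<otimes> conjug x n) \<otimes> inv (conjug x n) = k \<otimes> inv n" using c x by (simp add: m_assoc)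
  finally have "k \<otimes> inv n = \<one>" using fpf[of "k \<otimes> inv n"] nk by simp
  then show "n = k" using c by (metis inv_equality inv_inv inv_closed)
qed

text \<open>The injective map of \<open>fpf_commutator_inj\<close> sends the finite set
  \<open>M\<close> to itself and is therefore onto. In other words, every element of the coset
  \<open>M x\<close> is conjugate to \<open>x\<close> under \<open>M\<close>.\<close>

lemma fpf_commutator_surj:
  assumes x: "x \<in> setnorm M" and M: "subgroup M G" "finite M"
    and fpf: "\<And>m. m \<in> M \<Longrightarrow> conjug x m = m \<Longrightarrow> m = \<one>" and m: "m \<in> M"
  obtains n where "n \<in> M" "m = inv n \<otimes> conjug x n"
proof -
  interpret M: subgroup M G by (rule M)
  have xc: "x \<in> carrier G" using x by (simp add: setnorm_def)
  have "(\<lambda>n. inv n \<otimes> conjug x n) ` M = M"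
    by (rule endo_inj_surj[OF M(2) _ fpf_commutator_inj[OF xc M(1) fpf]]) (use setnormD[OF x] in auto)
  then have "m \<in> (\<lambda>n. inv n \<otimes> conjug x n) ` M" using m by simp
  then show thesis using that by blast
qed

lemma setnorm_conjug_image:
  assumes "S \<subseteq> carrier G" "g \<in> carrier G" "x \<in> carrier G" "inv g \<otimes> x \<otimes> g \<in> setnorm S"
  shows "x \<in> setnorm (conjug g ` S)"
proof (rule setnormI[OF assms(3)])
  fix y assume "y \<in> conjug g ` S"
  then obtain s where s: "s \<in> S" "y = conjug g s" by blast
  have sc: "s \<in> carrier G" using s assms by blast
  have "conjug x y = conjug g (conjug (inv g \<otimes> x \<otimes> g) s)"
    using sc assms(2,3) s by (simp add: conjug_conjug group_word_simps)
  then show "conjug x y \<in> conjug g ` S" using setnormD[OF assms(4) s(1)] by blast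
qed

lemma setnorm_conjug_imageD:
  assumes "S \<subseteq> carrier G" "g \<in> carrier G" "x \<in> setnorm (conjug g ` S)"
  shows "inv g \<otimes> x \<otimes> g \<in> setnorm S"
proof -
  have x: "x \<in> carrier G" using assms(3) by (simp add: setnorm_def)
  have "conjug (inv g) ` conjug g ` S = S" using assms(1,2) by (force simp: image_image subset_iff)
  moreover have "inv g \<otimes> x \<otimes> g \<in> setnorm (conjug (inv g) ` conjug g ` S)"
  proof (rule setnorm_conjug_image)
    show "conjug g ` S \<subseteq> carrier G" using assms(1,2) by auto
    have "inv (inv g) \<otimes> (inv g \<otimes> x \<otimes> g) \<otimes> inv g = x" using assms(2) x by (simp add: group_word_simps)
    then show "inv (inv g) \<otimes> (inv g \<otimes> x \<otimes> g) \<otimes> inv g \<in> setnorm (conjug g ` S)" using assms(3) by simp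
  qed (use assms(2) x in auto)
  ultimately show ?thesis by simp
qed

text \<open>For a Sylow subgroup \<open>S\<close>, some \<open>m\<close> in \<open>M\<close>
  conjugates \<open>x S x^-1\<close> back to \<open>S\<close>, so \<open>m x\<close> normalizes
  \<open>S\<close>. By \<open>fpf_commutator_surj\<close>, \<open>m x = k^-1 x k\<close> for some
  \<open>k\<close> in \<open>M\<close>, hence \<open>x\<close> normalizes
  \<open>k S k^-1\<close>.\<close>

lemma invariant_sylow_exists:
  assumes x: "x \<in> setnorm M" and M: "subgroup M G" "finite M"
    and fpf: "\<And>m. m \<in> M \<Longrightarrow> conjug x m = m \<Longrightarrow> m = \<one>"
    and s: "prime (s::nat)" "s ^ n dvd card M" "\<not> s ^ Suc n dvd card M"
  obtains S where "subgroup S G" "S \<subseteq> M" "card S = s ^ n" "x \<in> setnorm S"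
proof -
  interpret M: subgroup M G by (rule M)
  have xc: "x \<in> carrier G" using x by (simp add: setnorm_def)
  obtain S where S: "subgroup S G" "S \<subseteq> M" "card S = s ^ n"
    using sylow_subgroup_exists[OF M s(1,2)] .
  have Sc: "S \<subseteq> carrier G" using S(1) by (rule subgroup.subset)
  have "conjug x ` S \<subseteq> M" using S(2) setnormD[OF x] by blast
  moreover have "card (conjug x ` S) = s ^ n" using card_image[OF inj_on_conjug[OF xc Sc]] S(3) by simp
  ultimately obtain m where m: "m \<in> M" "conjug m ` conjug x ` S \<subseteq> S"
    using sylow_conjugate[OF M s(1) subgroup_conjug[OF xc S(1)] _ _ S s(3)] by blast
  have mc: "m \<in> carrier G" using m by simp
  have mx: "m \<otimes> x \<in> setnorm S"
  proof (rule setnormI)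
    fix y assume y: "y \<in> S"
    then have "conjug m (conjug x y) \<in> S" using m(2) by blast
    then show "conjug (m \<otimes> x) y \<in> S" using conjug_conjug[OF mc xc subsetD[OF Sc y]] by simp
  qed (use mc xc in simp)
  obtain k where k: "k \<in> M" "m = inv k \<otimes> conjug x k" using fpf_commutator_surj[OF x M fpf m(1)] .
  have kc: "k \<in> carrier G" using k by simp
  have "inv k \<otimes> x \<otimes> k = m \<otimes> x" unfolding k(2) using kc xc by (simp add: conjug_def group_word_simps)
  then have "x \<in> setnorm (conjug k ` S)" using setnorm_conjug_image[OF Sc kc xc] mx by simp
  moreover have "conjug k ` S \<subseteq> M" using S(2) k(1) unfolding conjug_def by auto
  moreover have "card (conjug k ` S) = s ^ n" using card_image[OF inj_on_conjug[OF kc Sc]] S(3) by simp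
  ultimately show thesis using that subgroup_conjug[OF kc S(1)] by blast
qed

text \<open>Let \<open>T = g S g^-1\<close>. Invariance of both puts \<open>g^-1 x g x^-1\<close>
  into the normalizer \<open>U\<close> of \<open>S\<close> in \<open>M\<close>. As \<open>U\<close>
  is invariant under \<open>x\<close>, surjectivity on \<open>U\<close> writes this element as
  \<open>k^-1 x k x^-1\<close> with \<open>k\<close> in \<open>U\<close>, and injectivity on
  \<open>M\<close> gives \<open>g = k\<close>.\<close>

lemma invariant_sylow_unique:
  assumes x: "x \<in> setnorm M" and M: "subgroup M G" "finite M"
    and fpf: "\<And>m. m \<in> M \<Longrightarrow> conjug x m = m \<Longrightarrow> m = \<one>"
    and s: "prime (s::nat)" "\<not> s ^ Suc n dvd card M"
    and S: "subgroup S G" "S \<subseteq> M" "card S = s ^ n" "x \<in> setnorm S"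
    and T: "subgroup T G" "T \<subseteq> M" "card T = s ^ n" "x \<in> setnorm T"
  shows "S = T"
proof -
  interpret M: subgroup M G by (rule M)
  have xc: "x \<in> carrier G" using x by (simp add: setnorm_def)
  have Sc: "S \<subseteq> carrier G" using S(1) by (rule subgroup.subset)
  have finS: "finite S" "finite T" using finite_subset[OF S(2) M(2)] finite_subset[OF T(2) M(2)] .
  obtain g where g: "g \<in> M" "conjug g ` S \<subseteq> T"
    using sylow_conjugate[OF M s(1) S(1-3) T(1-3) s(2)] .
  have gc: "g \<in> carrier G" using g by simp
  have "card (conjug g ` S) = card T" using card_image[OF inj_on_conjug[OF gc Sc]] S(3) T(3) by simp
  then have gS: "conjug g ` S = T" using card_subset_eq[OF finS(2) g(2)] by simp
  have "inv g \<otimes> x \<otimes> g \<in> setnorm S" using setnorm_conjug_imageD[OF Sc gc] T(4) gS by simp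
  let ?U = "M \<inter> setnorm S"
  have N: "subgroup (setnorm S) G" by (rule subgroup_setnorm[OF finS(1) Sc])
  have U: "subgroup ?U G" using M(1) N by (rule subgroups_Inter_pair)
  have u: "inv g \<otimes> conjug x g \<in> ?U"
  proof
    show "inv g \<otimes> conjug x g \<in> M" using g(1) setnormD[OF x g(1)] by simp
    have "inv g \<otimes> conjug x g = inv g \<otimes> x \<otimes> g \<otimes> inv x" using gc xc by (simp add: conjug_def group_word_simps)
    also have "\<dots> \<in> setnorm S"
      by (rule subgroup.m_closed[OF N]) (fact, rule subgroup.m_inv_closed[OF N S(4)])
    finally show "inv g \<otimes> conjug x g \<in> setnorm S" .
  qed
  have "x \<in> setnorm ?U"
  proof (rule setnormI[OF xc])
    fix y assume y: "y \<in> ?U"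
    have "conjug x y \<in> setnorm S" unfolding conjug_def
      using y S(4) N by (auto intro!: subgroup.m_closed[OF N] subgroup.m_inv_closed[OF N])
    then show "conjug x y \<in> ?U" using setnormD[OF x] y by blast
  qed
  then obtain k where k: "k \<in> ?U" "inv g \<otimes> conjug x g = inv k \<otimes> conjug x k"
    using fpf_commutator_surj[OF _ U _ _ u] fpf M(2) by blast
  then have "g = k" using inj_onD[OF fpf_commutator_inj[OF xc M(1) fpf] k(2) g(1)] by blast
  then have "conjug g ` S = S" using conjug_image_eq[OF finS(1) Sc] k(1) by blast
  then show ?thesis using gS by simp
qed

text \<open>\<open>V\<close> is the center of an \<open>x\<close>-invariant Sylow subgroup
  \<open>S\<close> for some prime divisor of \<open>card M\<close>. An element that normalizes
  \<open>M\<close> and \<open>cyc x\<close> carries \<open>S\<close> to a Sylow subgroup that is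
  again \<open>x\<close>-invariant, hence to \<open>S\<close> by uniqueness. This yields the last
  clause, which lets the whole normalizer of \<open>cyc x\<close> act on \<open>V\<close> once
  \<open>M\<close> is normal.\<close>

lemma exists_normalized_abelian_subgroup:
  assumes fin: "finite (carrier G)" and x: "x \<in> setnorm M" and M: "subgroup M G" "M \<noteq> {\<one>}"
    and fpf: "\<And>m. m \<in> M \<Longrightarrow> conjug x m = m \<Longrightarrow> m = \<one>"
  obtains V where "subgroup V G" "V \<subseteq> M" "V \<noteq> {\<one>}" "\<forall>v\<in>V. \<forall>w\<in>V. v \<otimes> w = w \<otimes> v"
    "x \<in> setnorm V" "setnorm M \<inter> setnorm (cyc x) \<subseteq> setnorm V"
proof -
  interpret M: subgroup M G by (rule M)
  have finM: "finite M" using finite_subset[OF M.subset fin] .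
  have xc: "x \<in> carrier G" using x by (simp add: setnorm_def)
  have "card M \<noteq> 0" using finM M.one_closed card_0_eq by blast
  have "card M \<noteq> 1" using M(2) M.one_closed by (metis card_1_singletonE singletonD)
  then obtain s where s: "prime s" "s dvd card M" using prime_factor_nat by blast
  obtain m where m: "card M = s ^ multiplicity s (card M) * m" "\<not> s dvd m"
    using multiplicity_decompose'[of "card M" s] \<open>card M \<noteq> 0\<close> s(1) not_prime_unit[of s] by blast
  let ?n = "multiplicity s (card M)"
  have n0: "?n \<noteq> 0" using m s(2) by (metis mult_1 power_0)
  have "\<not> s ^ Suc ?n dvd s ^ ?n * m" using m(2) s(1) by (simp add: prime_gt_0_nat)
  then have smax: "\<not> s ^ Suc ?n dvd card M" using m(1) by simp
  obtain S where S: "subgroup S G" "S \<subseteq> M" "card S = s ^ ?n" "x \<in> setnorm S"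
    using invariant_sylow_exists[OF x M(1) finM fpf s(1) multiplicity_dvd smax] .
  interpret S: subgroup S G by (rule S)
  have finS: "finite S" using finite_subset[OF S(2) finM] .
  have normS: "y \<in> setnorm S" if y: "y \<in> setnorm M" "y \<in> setnorm (cyc x)" for y
  proof -
    have yc: "y \<in> carrier G" using y by (simp add: setnorm_def)
    have "cyc x \<subseteq> setnorm S" by (rule cyc_subset[OF subgroup_setnorm[OF finS S.subset] S(4)])
    moreover have "inv y \<in> setnorm (cyc x)"
      using subgroup.m_inv_closed[OF subgroup_setnorm_cyc[OF fin xc] y(2)] .
    then have "conjug (inv y) x \<in> cyc x" using setnormD in_cyc by blast
    moreover have "conjug (inv y) x = inv y \<otimes> x \<otimes> y" using yc by (simp add: conjug_def)
    ultimately have 1: "x \<in> setnorm (conjug y ` S)" using setnorm_conjug_image[OF S.subset yc xc] by auto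
    have "conjug y ` S \<subseteq> M" using S(2) setnormD[OF y(1)] by blast
    moreover have "card (conjug y ` S) = s ^ ?n" using card_image[OF inj_on_conjug[OF yc S.subset]] S(3) by simp
    ultimately have "S = conjug y ` S"
      using invariant_sylow_unique[OF x M(1) finM fpf s(1) smax S subgroup_conjug[OF yc S(1)] _ _ 1] by blast
    then show ?thesis using yc by (auto intro!: setnormI)
  qed
  let ?V = "S \<inter> cent S"
  have normV: "y \<in> setnorm ?V" if y: "y \<in> setnorm S" for y
  proof (rule setnormI)
    show yc: "y \<in> carrier G" using y by (simp add: setnorm_def)
    fix v assume v: "v \<in> ?V"
    have vc: "v \<in> carrier G" using v by simp
    have "conjug y v \<otimes> u = u \<otimes> conjug y v" if u: "u \<in> S" for u
    proof -
      obtain w where w: "w \<in> S" "u = conjug y w" using conjug_image_eq[OF finS S.subset y] u by blast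
      have "v \<otimes> w = w \<otimes> v" using v w(1) centD[of v S w] by blast
      then show ?thesis using w yc vc by (simp flip: conjug_mult add: S.mem_carrier)
    qed
    then have "conjug y v \<in> cent S" using yc vc by (intro centI) auto
    then show "conjug y v \<in> ?V" using setnormD[OF y] v by blast
  qed
  show thesis
  proof (rule that)
    show "subgroup ?V G" by (rule subgroups_Inter_pair[OF S(1) subgroup_cent[OF S.subset]])
    show "?V \<subseteq> M" using S(2) by blast
    show "?V \<noteq> {\<one>}"
    proof -
      have "S \<noteq> {\<one>}"
      proof
        assume "S = {\<one>}"
        then have "s ^ ?n = 1" using S(3) by simp
        then show False using n0 s(1) by simp
      qed
      then obtain z where z: "z \<in> S" "z \<noteq> \<one>" "\<And>x. x \<in> S \<Longrightarrow> x \<otimes> z = z \<otimes> x"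
        using p_group_center[OF S(1,3) s(1)] by blast
      have "z \<in> cent S" by (rule centI[OF S.mem_carrier[OF z(1)] z(3)[symmetric]])
      then show ?thesis using z(1,2) by blast
    qed
    show "\<forall>v\<in>?V. \<forall>w\<in>?V. v \<otimes> w = w \<otimes> v" using centD[of _ S] by blast
    show "x \<in> setnorm ?V" by (rule normV[OF S(4)])
    show "setnorm M \<inter> setnorm (cyc x) \<subseteq> setnorm ?V" using normS normV by blast
  qed
qed

text \<open>The property of \<open>B\<close> is modelled on the set of vertices of the Engel graph that cannot be reached
  from \<open>M\<close>.\<close>

context
  fixes M B
  assumes fin: "finite (carrier G)" and M: "M \<lhd> G" "M \<noteq> {\<one>}"
    and BM: "B \<inter> M = {}" and Bc: "B \<subseteq> carrier G" "\<one> \<notin> B"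
    and B: "\<And>b y. \<lbrakk>b \<in> B; y \<in> setnorm (cyc b); y \<noteq> \<one>\<rbrakk> \<Longrightarrow> y \<in> B"
begin

private lemma commuting_in_B: "\<lbrakk>b \<in> B; y \<in> carrier G; y \<noteq> \<one>; y \<otimes> b = b \<otimes> y\<rbrakk> \<Longrightarrow> y \<in> B"
  using B[of b y] commute_in_setnorm_cyc[OF fin] Bc by blast

text \<open>A nontrivial fixed point commutes with \<open>b\<close> and would thus belong to
  \<open>B\<close>, which is disjoint from \<open>M\<close>.\<close>

private lemma fpf_M: "\<lbrakk>b \<in> B; m \<in> M; conjug b m = m\<rbrakk> \<Longrightarrow> m = \<one>"
proof (rule ccontr)
  assume b: "b \<in> B" "m \<in> M" "conjug b m = m" "m \<noteq> \<one>"
  interpret M: normal M G by (rule M)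
  have c: "b \<in> carrier G" "m \<in> carrier G" using b Bc by auto
  have "b \<otimes> m = m \<otimes> b" using b(3) c by (simp add: conjug_fix_iff)
  then have "m \<in> B" using commuting_in_B[OF b(1) c(2) b(4)] by simp
  then show False using BM b by blast
qed

private lemma setnorm_M: "g \<in> carrier G \<Longrightarrow> g \<in> setnorm M"
  by (rule setnormI) (use normal.inv_op_closed2[OF M(1)] in \<open>simp_all add: conjug_def\<close>)

text \<open>Every element of \<open>M\<close> has the form \<open>n^-1 t n t^-1\<close>, so the
  involution \<open>t\<close> inverts \<open>M\<close>, and so do its conjugates. If
  \<open>x \<noteq> 1\<close> lies in the centralizer of \<open>t\<close> and in its conjugate by
  \<open>g\<close>, then \<open>d = t (g t g^-1)\<close> commutes with \<open>x\<close> and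
  centralizes \<open>M\<close>. As \<open>x\<close> is in \<open>B\<close>,
  \<open>d \<noteq> 1\<close> would put \<open>d\<close> into \<open>B\<close>, whose elements have
  no nontrivial fixed points on \<open>M\<close>. So \<open>g t g^-1 = t\<close>.\<close>

lemma complement_of_involution:
  assumes t: "t \<in> B" "ord t = 2"
  shows "\<exists>H. subgroup H G \<and> H \<noteq> {\<one>} \<and> H \<noteq> carrier G \<and> (\<forall>g\<in>carrier G - H. H \<inter> conjug g ` H = {\<one>})"
proof -
  interpret M: normal M G by (rule M)
  have tc: "t \<in> carrier G" and tne: "t \<noteq> \<one>" using t Bc by auto
  have finM: "finite M" using finite_subset[OF M.subset fin] .
  have tt: "t \<otimes> t = \<one>" using pow_ord_eq_1[OF tc] t(2) tc by (simp add: numeral_2_eq_2)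
  have inverts: "conjug t m = inv m" if m: "m \<in> M" for m
  proof -
    obtain n where n: "n \<in> M" "m = inv n \<otimes> conjug t n"
      using fpf_commutator_surj[OF setnorm_M[OF tc] M.subgroup_axioms finM fpf_M[OF t(1)] m] .
    have nc: "n \<in> carrier G" using n by simp
    have "conjug t (conjug t n) = n" using conjug_conjug[OF tc tc nc] tt nc by simp
    then show ?thesis using nc tc by (simp add: n(2) conjug_mult conjug_inv inv_mult_group)
  qed
  let ?H = "cent {t}"
  obtain m0 where m0: "m0 \<in> M" "m0 \<noteq> \<one>" using M(2) M.one_closed by blast
  have "m0 \<notin> ?H"
  proof
    assume "m0 \<in> ?H"
    then have "m0 \<otimes> t = t \<otimes> m0" using centD by blast
    then have "m0 \<in> B" using commuting_in_B[OF t(1) _ m0(2)] m0(1) by simp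
    then show False using BM m0 by blast
  qed
  then have "?H \<noteq> carrier G" using m0 M.mem_carrier by blast
  moreover have tH: "t \<in> ?H" using tc by (intro centI) auto
  then have "?H \<noteq> {\<one>}" using tne by blast
  moreover have subH: "subgroup ?H G" using tc by (intro subgroup_cent) auto
  moreover have "?H \<inter> conjug g ` ?H = {\<one>}" if g: "g \<in> carrier G - ?H" for g
  proof (rule ccontr)
    have gc: "g \<in> carrier G" using g by blast
    have "\<one> \<in> ?H \<inter> conjug g ` ?H"
      using subgroup.one_closed[OF subH] subgroup.one_closed[OF subgroup_conjug[OF gc subH]] by blast
    moreover assume "?H \<inter> conjug g ` ?H \<noteq> {\<one>}"
    ultimately obtain x where x: "x \<in> ?H" "x \<in> conjug g ` ?H" "x \<noteq> \<one>" by blast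
    then obtain h where h: "h \<in> ?H" "x = conjug g h" by blast
    have c: "x \<in> carrier G" "h \<in> carrier G" using x h cent_subset by blast+
    let ?t = "conjug g t" and ?d = "t \<otimes> conjug g t"
    have tgc: "?t \<in> carrier G" using gc tc by simp
    have xt: "x \<otimes> t = t \<otimes> x" using x(1) centD by blast
    have "h \<otimes> t = t \<otimes> h" using h(1) centD by blast
    then have xtg: "x \<otimes> ?t = ?t \<otimes> x" using h(2) gc tc c by (simp flip: conjug_mult)
    have xB: "x \<in> B" using commuting_in_B[OF t(1) c(1) x(3) xt] .
    have "?d \<otimes> x = t \<otimes> (x \<otimes> ?t)" using tc tgc c(1) by (simp add: m_assoc xtg)
    also have "\<dots> = x \<otimes> t \<otimes> ?t" using tc tgc c(1) by (simp add: m_assoc[symmetric] xt)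
    also have "\<dots> = x \<otimes> ?d" using tc tgc c(1) by (simp add: m_assoc)
    finally have dx: "?d \<otimes> x = x \<otimes> ?d" .
    have mc: "m0 \<in> carrier G" using m0 by simp
    have im: "conjug (inv g) m0 \<in> M" using setnormD[OF setnorm_M m0(1)] gc by simp
    have "conjug ?t m0 = conjug g (conjug t (conjug (inv g) m0))"
      using gc tc mc by (simp add: conjug_def group_word_simps)
    also have "\<dots> = inv m0" using inverts[OF im] gc mc by (simp flip: conjug_inv)
    finally have "conjug ?d m0 = conjug t (inv m0)" using conjug_conjug[OF tc tgc mc] by simp
    then have dm: "conjug ?d m0 = m0" using inverts[of "inv m0"] m0(1) mc by simp
    have "?d = \<one>"
    proof (rule ccontr)
      assume "?d \<noteq> \<one>"
      then have "?d \<in> B" using commuting_in_B[OF xB _ _ dx] tc tgc by simp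
      then show False using fpf_M[OF _ m0(1) dm] m0(2) by blast
    qed
    then have "?t = t" using tt tc tgc by (metis l_cancel_one' m_assoc l_one r_one inv_unique)
    then have "g \<otimes> t = t \<otimes> g" using gc tc by (simp add: conjug_fix_iff)
    then have "g \<in> ?H" using gc by (intro centI) auto
    then show False using g by blast
  qed
  ultimately show ?thesis by blast
qed

text \<open>The complement is the normalizer \<open>H\<close> of \<open>cyc b\<close> for some
  \<open>b\<close> in \<open>B\<close> of prime order. If \<open>z\<close> of prime order lies in
  \<open>H\<close> and in \<open>g H g^-1\<close>, uniqueness in \<open>H\<close> and its conjugate
  makes \<open>b\<close> and \<open>g b g^-1\<close> normalize \<open>cyc z\<close>. Uniqueness in
  the normalizer of \<open>cyc z\<close> then puts \<open>g b g^-1\<close> into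
  \<open>cyc b\<close>, that is, \<open>g\<close> into \<open>H\<close>.\<close>

lemma complement_of_odd:
  assumes b0: "b0 \<in> B" and odd: "\<And>t. t \<in> B \<Longrightarrow> ord t \<noteq> 2"
  shows "\<exists>H. subgroup H G \<and> H \<noteq> {\<one>} \<and> H \<noteq> carrier G \<and> (\<forall>g\<in>carrier G - H. H \<inter> conjug g ` H = {\<one>})"
proof -
  interpret M: normal M G by (rule M)
  let ?W = "\<lambda>c. setnorm (cyc c)"
  have Wsub: "subgroup (?W c) G" if "c \<in> B" for c using subgroup_setnorm_cyc[OF fin] that Bc by blast
  \<comment> \<open>Apart from the unit, the normalizer of \<open>cyc c\<close> lies in
    \<open>B\<close>. So it acts on \<open>V\<close> without fixed points, and by Cauchy's theorem
    its order is odd because \<open>B\<close> contains no involution.\<close>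
  have good: "y \<in> cyc x"
    if c: "c \<in> B" and xy: "x \<in> ?W c" "y \<in> ?W c" "prime (ord x)" "ord y = ord x" for c x y
  proof -
    have cc: "c \<in> carrier G" using c Bc by blast
    interpret W: subgroup "?W c" G by (rule Wsub[OF c])
    obtain V where V: "subgroup V G" "V \<subseteq> M" "V \<noteq> {\<one>}" "\<forall>v\<in>V. \<forall>w\<in>V. v \<otimes> w = w \<otimes> v"
      "c \<in> setnorm V" "setnorm M \<inter> ?W c \<subseteq> setnorm V"
      using exists_normalized_abelian_subgroup[OF fin setnorm_M[OF cc] M.subgroup_axioms M(2) fpf_M[OF c]] .
    have nV: "?W c \<subseteq> setnorm V" using V(6) setnorm_M W.subset by blast
    have fpf: "fpf_on (?W c) V"
      unfolding fpf_on_def using fpf_M B[OF c] V(2) by blast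
    have oddW: "odd (card (?W c))"
    proof
      assume "even (card (?W c))"
      then obtain t where "t \<in> ?W c" "ord t = 2"
        using cauchy[OF Wsub[OF c] _ two_is_prime_nat] finite_subset[OF W.subset fin] by blast
      then show False using odd B[OF c] ord_id by (metis numeral_One numeral_eq_iff semiring_norm(85))
    qed
    note pq = fpf_prime_order_commute[OF fin Wsub[OF c] V(1) bspec[OF bspec[OF V(4)]] nV fpf V(3)]
    show ?thesis by (rule prime_order_unique[OF fin Wsub[OF c] oddW pq(1) pq(2) xy])
  qed
  have b0c: "b0 \<in> carrier G" "b0 \<noteq> \<one>" using b0 Bc by auto
  obtain n :: nat where n: "prime (ord (b0 [^] n))" using exists_prime_power[OF fin b0c] .
  let ?b = "b0 [^] n"
  have bc: "?b \<in> carrier G" using b0c by simp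
  have "?b \<otimes> b0 = b0 \<otimes> ?b" using group_commutes_pow[of b0 b0 n] b0c by simp
  then have bB: "?b \<in> B" using commuting_in_B[OF b0 bc prime_ord_ne_one[OF n]] by simp
  let ?H = "?W ?b"
  have subH: "subgroup ?H G" by (rule Wsub[OF bB])
  interpret H: subgroup ?H G by (rule subH)
  have bH: "?b \<in> ?H" using commute_in_setnorm_cyc[OF fin bc bc] by simp
  obtain m0 where m0: "m0 \<in> M" "m0 \<noteq> \<one>" using M(2) M.one_closed by blast
  have "m0 \<notin> ?H" using B[OF bB _ m0(2)] m0(1) BM by blast
  then have "?H \<noteq> carrier G" using m0 M.mem_carrier by blast
  moreover have "?H \<noteq> {\<one>}" using bH prime_ord_ne_one[OF n] by blast
  moreover have "?H \<inter> conjug g ` ?H = {\<one>}" if g: "g \<in> carrier G - ?H" for g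
  proof (rule ccontr)
    have gc: "g \<in> carrier G" using g by blast
    have subgH: "subgroup (conjug g ` ?H) G" by (rule subgroup_conjug[OF gc subH])
    have "\<one> \<in> ?H \<inter> conjug g ` ?H" using H.one_closed subgroup.one_closed[OF subgH] by blast
    moreover assume "?H \<inter> conjug g ` ?H \<noteq> {\<one>}"
    ultimately obtain x where x: "x \<in> ?H" "x \<in> conjug g ` ?H" "x \<noteq> \<one>" by blast
    have xc: "x \<in> carrier G" using x by simp
    obtain k :: nat where k: "prime (ord (x [^] k))" using exists_prime_power[OF fin xc x(3)] .
    let ?z = "x [^] k"
    have zH: "?z \<in> ?H" "?z \<in> conjug g ` ?H"
      using subgroup_pow_closed[OF subH x(1)] subgroup_pow_closed[OF subgH x(2)] .
    have zc: "?z \<in> carrier G" using xc by simp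
    have zB: "?z \<in> B" using B[OF bB zH(1) prime_ord_ne_one[OF k]] .
    have conj_cyc: "conjug h w \<in> cyc w" if "h \<in> ?H" "w \<in> ?H" "prime (ord w)" for h w
    proof (rule good[OF bB that(2) _ that(3)])
      show "conjug h w \<in> ?H" unfolding conjug_def using that by simp
      show "ord (conjug h w) = ord w" using that by (intro ord_conjug) auto
    qed
    have 1: "?b \<in> ?W ?z" using conj_cyc[OF bH zH(1) k] bc setnorm_cyc_iff[OF fin zc] by blast
    obtain w where w: "w \<in> ?H" "?z = conjug g w" using zH(2) by blast
    have wc: "w \<in> carrier G" using w by simp
    have "prime (ord w)" using k w ord_conjug[OF gc wc] by simp
    then have "conjug ?b w \<in> cyc w" using conj_cyc[OF bH w(1)] by blast
    then have "conjug g (conjug ?b w) \<in> cyc ?z" unfolding w(2) conjug_cyc[OF fin gc wc, symmetric] by (rule imageI)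
    moreover have "conjug g (conjug ?b w) = conjug (conjug g ?b) ?z"
      unfolding w(2) using gc wc bc by (simp add: conjug_def group_word_simps)
    ultimately have 2: "conjug g ?b \<in> ?W ?z" using setnorm_cyc_iff[OF fin zc] gc bc by simp
    have "conjug g ?b \<in> cyc ?b" by (rule good[OF zB 1 2 n ord_conjug[OF gc bc]])
    then have "g \<in> ?H" using gc setnorm_cyc_iff[OF fin bc] by blast
    then show False using g by blast
  qed
  ultimately show ?thesis using subH by blast
qed

lemma frobenius_complement_exists:
  assumes "B \<noteq> {}"
  shows "\<exists>H. subgroup H G \<and> H \<noteq> {\<one>} \<and> H \<noteq> carrier G \<and> (\<forall>g\<in>carrier G - H. H \<inter> conjug g ` H = {\<one>})"
proof (cases "\<exists>t\<in>B. ord t = 2")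
  case True
  then show ?thesis using complement_of_involution by (elim bexE)
next
  case False
  obtain b where b: "b \<in> B" using assms by blast
  show ?thesis by (rule complement_of_odd[OF b]) (use False in blast)
qed

end

subsection \<open>Almost simple groups and commuting elements\<close>

text \<open>Conjugation embeds \<open>G\<close> into the automorphism group of \<open>N\<close>
  because the centralizer of \<open>N\<close> is trivial; for the same reason \<open>N\<close> is
  nonabelian. The hypothesis \<open>simple\<close> expresses normality in \<open>N\<close> by
  \<open>setnorm\<close>, so that it can be checked inside \<open>G\<close>.\<close>

lemma almost_simple_groupI:
  assumes fin: "finite (carrier G)" and N: "N \<lhd> G" "N \<noteq> {\<one>}" and C: "cent N = {\<one>}"
    and simple: "\<And>L. \<lbrakk>subgroup L G; L \<subseteq> N; N \<subseteq> setnorm L\<rbrakk> \<Longrightarrow> L = N \<or> L = {\<one>}"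
  shows "almost_simple_group G"
proof -
  interpret N: normal N G by (rule N(1))
  \<comment> \<open>\<open>almost_simple_group\<close> quantifies over records of type
    \<open>'a monoid\<close>, so the simple group is built as a new record; updating the carrier of
    \<open>G\<close> would keep its extension fields.\<close>
  let ?S = "\<lparr>carrier = N, monoid.mult = (\<otimes>), one = \<one>\<rparr>"
  interpret S: group ?S
    by (rule groupI) (auto simp: m_assoc intro!: bexI[of _ "inv _"])
  have invS: "inv\<^bsub>?S\<^esub> x = inv x" if "x \<in> N" for x
    by (rule S.inv_equality) (use that in auto)
  have finN: "finite N" using finite_subset[OF N.subset fin] .
  have conjN: "conjug g x \<in> N" if "g \<in> carrier G" "x \<in> N" for g x
    using N.inv_op_closed2[OF that] by (simp add: conjug_def)
  define \<alpha> where "\<alpha> g = restrict (conjug g) N" for g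
  let ?A = "AutoGroup ?S"
  interpret A: group ?A by (rule S.AutoGroup)
  have bij: "\<alpha> g \<in> Bij N" if g: "g \<in> carrier G" for g
  proof -
    have "bij_betw (conjug g) N N"
      by (rule bij_betw_byWitness[where f' = "conjug (inv g)"]) (use conjN g in auto)
    then show ?thesis by (auto simp: Bij_def \<alpha>_def)
  qed
  have au: "\<alpha> g \<in> auto ?S" if g: "g \<in> carrier G" for g
  proof -
    have "\<alpha> g \<in> hom ?S ?S" using conjN[OF g] g by (auto simp: hom_def \<alpha>_def conjug_mult)
    then show ?thesis using bij[OF g] by (simp add: auto_def)
  qed
  have hom: "\<alpha> \<in> hom G ?A"
  proof (rule homI)
    show "\<alpha> g \<in> carrier ?A" if "g \<in> carrier G" for g using au[OF that] by (simp add: AutoGroup_def)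
    show "\<alpha> (g \<otimes> h) = \<alpha> g \<otimes>\<^bsub>?A\<^esub> \<alpha> h" if gh: "g \<in> carrier G" "h \<in> carrier G" for g h
    proof -
      have "\<alpha> (g \<otimes> h) = compose N (\<alpha> g) (\<alpha> h)"
        unfolding \<alpha>_def compose_def using gh conjN by (auto simp: conjug_conjug fun_eq_iff)
      then show ?thesis using bij gh by (simp add: AutoGroup_def BijGroup_def)
    qed
  qed
  interpret \<alpha>: group_hom G ?A \<alpha> by unfold_locales (rule hom)
  have inj: "inj_on \<alpha> (carrier G)"
  proof (rule inj_onI)
    fix g h assume gh: "g \<in> carrier G" "h \<in> carrier G" "\<alpha> g = \<alpha> h"
    have "inv h \<otimes> g \<otimes> x = x \<otimes> (inv h \<otimes> g)" if x: "x \<in> N" for x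
    proof -
      have "conjug g x = conjug h x" using fun_cong[OF gh(3), of x] x by (simp add: \<alpha>_def)
      then have "conjug (inv h \<otimes> g) x = x" using gh x conjug_conjug[of "inv h" g x] by simp
      then show ?thesis using conjug_fix_iff[of "inv h \<otimes> g" x] gh x by simp
    qed
    then have "inv h \<otimes> g \<in> cent N" using gh by (intro centI) auto
    then have "inv h \<otimes> g = \<one>" using C by blast
    then show "g = h" using gh(1,2) by (metis inv_equality inv_inv inv_closed)
  qed
  let ?I = "\<alpha> ` carrier G"
  have "simple_group ?S"
  proof (intro simple_group.intro S.group_axioms simple_group_axioms.intro)
    obtain x where "x \<in> N" "x \<noteq> \<one>" using N(2) N.one_closed by blast
    then have "card {\<one>, x} \<le> card N" using finN by (intro card_mono) auto
    then show "1 < order ?S" using \<open>x \<noteq> \<one>\<close> by (simp add: order_def)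
  next
    fix L assume L: "L \<lhd> ?S"
    have subL: "subgroup L ?S" using L by (rule normal_imp_subgroup)
    have LN: "L \<subseteq> N" using subgroup.subset[OF subL] by simp
    have "subgroup L G"
    proof (rule subgroupI)
      show "L \<subseteq> carrier G" using LN N.subset by blast
      show "L \<noteq> {}" using subgroup.one_closed[OF subL] by blast
      show "inv a \<in> L" if "a \<in> L" for a using subgroup.m_inv_closed[OF subL that] invS that LN by auto
      show "a \<otimes> b \<in> L" if "a \<in> L" "b \<in> L" for a b using subgroup.m_closed[OF subL that] by simp
    qed
    moreover have "N \<subseteq> setnorm L"
    proof
      fix g assume g: "g \<in> N"
      show "g \<in> setnorm L"
      proof (rule setnormI)
        show "conjug g x \<in> L" if "x \<in> L" for x
          using normal.inv_op_closed2[OF L _ that, of g] g invS by (simp add: conjug_def)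
      qed (use g in simp)
    qed
    ultimately show "L = carrier ?S \<or> L = {\<one>\<^bsub>?S\<^esub>}" using simple LN by simp
  qed
  moreover have "\<not> comm_group ?S"
  proof
    assume "comm_group ?S"
    then interpret CS: comm_group ?S .
    have "N \<subseteq> cent N" using CS.m_comm by (auto intro!: centI)
    then show False using C N(2) N.one_closed by blast
  qed
  moreover have "subgroup ?I ?A" by (rule \<alpha>.img_is_subgroup)
  moreover have "inner_auto ?S \<subseteq> ?I"
  proof
    fix f assume "f \<in> inner_auto ?S"
    then obtain g where g: "g \<in> N" "f = (\<lambda>x\<in>N. g \<otimes> x \<otimes> inv\<^bsub>?S\<^esub> g)" by (auto simp: inner_auto_def)
    then have "f = \<alpha> g" by (simp add: \<alpha>_def invS conjug_def[abs_def])
    then show "f \<in> ?I" using g by auto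
  qed
  moreover have "G \<cong> ?A\<lparr>carrier := ?I\<rparr>"
  proof (rule is_isoI)
    show "\<alpha> \<in> iso G (?A\<lparr>carrier := ?I\<rparr>)"
      using hom inj by (auto simp: iso_def hom_def bij_betw_def)
  qed
  ultimately show ?thesis unfolding almost_simple_group_def by blast
qed

text \<open>A set of least size with \<open>P\<close> is also minimal under inclusion. The bound by
  \<open>card L\<close> serves to keep \<open>S\<close> different from \<open>N\<close> in
  \<open>commuting_hub_of_nonsimple\<close>.\<close>

lemma minimal_subset_exists:
  assumes "finite (carrier G)" "P L" "\<And>L. P L \<Longrightarrow> L \<subseteq> carrier G"
  obtains S where "P S" "card S \<le> card L" "\<And>T. P T \<Longrightarrow> T \<subseteq> S \<Longrightarrow> T = S"
proof -
  obtain S where S: "P S" "\<And>T. P T \<Longrightarrow> card S \<le> card T"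
    using arg_min_natI[of P L card] arg_min_nat_le[of P _ card] assms(2) by blast
  have "T = S" if "P T" "T \<subseteq> S" for T
    using that S card_subset_eq[of S T] finite_subset[OF assms(3)[OF S(1)] assms(1)]
    by (meson card_seteq)
  then show ?thesis using that S assms(2) by blast
qed

text \<open>A minimal normal subgroup \<open>N\<close> with trivial centralizer that is not simple is generated by
  pairwise commuting conjugates of a minimal normal subgroup \<open>S\<close> of \<open>N\<close>, so \<open>N = S (N \<inter> C(S))\<close>.\<close>

lemma conjug_commutator:
  "x \<in> carrier G \<Longrightarrow> y \<in> carrier G \<Longrightarrow> x \<otimes> conjug y (inv x) = conjug x y \<otimes> inv y"
  by (simp add: conjug_def m_assoc)

text \<open>Written as \<open>s c\<close> with \<open>c\<close> centralizing \<open>S\<close>, an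
  element of \<open>N - {1}\<close> commutes with \<open>s\<close> if \<open>s \<noteq> 1\<close>
  and with all of \<open>S\<close> otherwise. The element \<open>b\<close> comes from a conjugate
  different from \<open>S\<close> and commutes with \<open>S\<close>, so it is a hub that links any
  two elements of \<open>S\<close>.\<close>

lemma commuting_hub_of_nonsimple:
  assumes fin: "finite (carrier G)" and N: "N \<lhd> G"
    and min: "\<And>L. \<lbrakk>L \<lhd> G; L \<noteq> {\<one>}; L \<subseteq> N\<rbrakk> \<Longrightarrow> L = N"
    and L: "subgroup L G" "L \<subseteq> N" "N \<subseteq> setnorm L" "L \<noteq> N" "L \<noteq> {\<one>}"
  obtains S b where "S \<subseteq> carrier G" "b \<in> carrier G" "b \<noteq> \<one>" "b \<in> cent S"
    "\<forall>x\<in>N - {\<one>}. \<exists>s\<in>S. s \<noteq> \<one> \<and> x \<otimes> s = s \<otimes> x"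
proof -
  interpret N: normal N G by (rule N)
  have finN: "finite N" using finite_subset[OF N.subset fin] .
  let ?P = "\<lambda>L. subgroup L G \<and> L \<subseteq> N \<and> N \<subseteq> setnorm L \<and> L \<noteq> {\<one>}"
  have PL: "?P L" using L by blast
  obtain S where S: "?P S" "card S \<le> card L" "\<And>T. ?P T \<Longrightarrow> T \<subseteq> S \<Longrightarrow> T = S"
    using minimal_subset_exists[of ?P L, OF fin PL] subgroup.subset by (metis (no_types, lifting))
  interpret S: subgroup S G using S by blast
  have SN: "S \<subseteq> N" "N \<subseteq> setnorm S" "S \<noteq> {\<one>}" using S by auto
  have SneN: "S \<noteq> N"
  proof
    assume "S = N"
    then have "L = N" using card_seteq[OF finN L(2)] S(2) by simp
    then show False using L(4) by simp
  qed
  have finS: "finite S" using finite_subset[OF SN(1) finN] .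
  have conjN: "conjug g x \<in> N" if "g \<in> carrier G" "x \<in> N" for g x
    using N.inv_op_closed2[OF that] by (simp add: conjug_def)
  have PSg: "?P (conjug g ` S)" if g: "g \<in> carrier G" for g
  proof (intro conjI)
    show "subgroup (conjug g ` S) G" by (rule subgroup_conjug[OF g S.subgroup_axioms])
    show "conjug g ` S \<subseteq> N" using conjN[OF g] SN by blast
    show "N \<subseteq> setnorm (conjug g ` S)"
    proof
      fix n assume n: "n \<in> N"
      have "inv g \<otimes> n \<otimes> g \<in> N" using N.inv_op_closed1[OF g n] .
      then show "n \<in> setnorm (conjug g ` S)"
        by (intro setnorm_conjug_image[OF S.subset g N.mem_carrier[OF n]] subsetD[OF SN(2)])
    qed
    obtain s where "s \<in> S" "s \<noteq> \<one>" using SN(3) S.one_closed by blast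
    then have "conjug g s \<in> conjug g ` S" "conjug g s \<noteq> \<one>" using g by (auto simp: conjug_eq_one_iff)
    then show "conjug g ` S \<noteq> {\<one>}" by blast
  qed
  have SgN: "conjug g ` S \<subseteq> N" if "g \<in> carrier G" for g
    by (rule PSg[OF that, THEN conjunct2, THEN conjunct1])
  have commute: "x \<otimes> y = y \<otimes> x" if g: "g \<in> carrier G" "conjug g ` S \<noteq> S" and xy: "x \<in> conjug g ` S" "y \<in> S" for g x y
  proof -
    let ?T = "conjug g ` S"
    note PT = PSg[OF g(1)]
    have NT: "N \<subseteq> setnorm ?T" by (rule PT[THEN conjunct2, THEN conjunct2, THEN conjunct1])
    have TN: "?T \<subseteq> N" by (rule PT[THEN conjunct2, THEN conjunct1])
    interpret T: subgroup ?T G by (rule PT[THEN conjunct1])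
    have "S \<inter> ?T = {\<one>}"
    proof (rule ccontr)
      assume ne: "S \<inter> ?T \<noteq> {\<one>}"
      have "?P (S \<inter> ?T)"
      proof (intro conjI)
        show "subgroup (S \<inter> ?T) G" by (rule subgroups_Inter_pair[OF S.subgroup_axioms T.subgroup_axioms])
        show "S \<inter> ?T \<subseteq> N" using SN by blast
        show "N \<subseteq> setnorm (S \<inter> ?T)"
        proof
          fix n assume n: "n \<in> N"
          show "n \<in> setnorm (S \<inter> ?T)"
            using setnormD[OF subsetD[OF SN(2) n]] setnormD[OF subsetD[OF NT n]] n
            by (intro setnormI) auto
        qed
      qed (rule ne)
      then have "S \<inter> ?T = S" by (rule S(3)) (rule Int_lower1)
      then have "S \<subseteq> ?T" by blast
      then have "?T = S"
        using card_subset_eq[of ?T S] card_image[OF inj_on_conjug[OF g(1) S.subset]] finS by simp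
      then show False using g by simp
    qed
    have c: "x \<in> carrier G" "y \<in> carrier G" using xy by auto
    have xN: "x \<in> setnorm S" by (rule subsetD[OF SN(2) subsetD[OF TN xy(1)]])
    have yN: "y \<in> setnorm ?T" by (rule subsetD[OF NT subsetD[OF SN(1) xy(2)]])
    \<comment> \<open>This commutator lies in \<open>S\<close> since \<open>x\<close> normalizes
      \<open>S\<close>, and in \<open>?T\<close> since \<open>y\<close> normalizes
      \<open>?T\<close>.\<close>
    have "conjug x y \<otimes> inv y \<in> S"
      by (rule S.m_closed[OF setnormD[OF xN xy(2)] S.m_inv_closed[OF xy(2)]])
    moreover have "conjug x y \<otimes> inv y \<in> ?T"
    proof -
      have "conjug y (inv x) \<in> ?T" by (rule setnormD[OF yN T.m_inv_closed[OF xy(1)]])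
      then have "x \<otimes> conjug y (inv x) \<in> ?T" by (rule T.m_closed[OF xy(1)])
      then show ?thesis by (simp only: conjug_commutator[OF c])
    qed
    ultimately have "conjug x y \<otimes> inv y = \<one>" using \<open>S \<inter> ?T = {\<one>}\<close> by blast
    then have "conjug x y = y" using c by (metis conjug_closed inv_closed inv_equality inv_inv)
    then show ?thesis using c by (simp add: conjug_fix_iff)
  qed
  let ?C = "N \<inter> cent S"
  have Csub: "subgroup ?C G" by (rule subgroups_Inter_pair[OF N.subgroup_axioms subgroup_cent[OF S.subset]])
  interpret C: subgroup ?C G by (rule Csub)
  let ?J = "{s \<otimes> c | s c. s \<in> S \<and> c \<in> ?C}"
  have cs: "c \<otimes> s = s \<otimes> c" if "s \<in> S" "c \<in> ?C" for s c using that centD[of c S s] by blast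
  have Jsub: "subgroup ?J G"
  proof (rule subgroupI)
    show "?J \<subseteq> carrier G" by auto
    show "?J \<noteq> {}" using S.one_closed C.one_closed by blast
  next
    fix a assume "a \<in> ?J"
    then obtain s c where sc: "a = s \<otimes> c" "s \<in> S" "c \<in> ?C" by blast
    have "inv a = inv s \<otimes> inv c"
      using sc cs[OF sc(2,3)] inv_mult_group[of c s] C.mem_carrier[OF sc(3)] by simp
    then show "inv a \<in> ?J" using sc C.m_inv_closed by blast
  next
    fix a b assume "a \<in> ?J" "b \<in> ?J"
    then obtain s c t d where sc: "a = s \<otimes> c" "s \<in> S" "c \<in> ?C" "b = t \<otimes> d" "t \<in> S" "d \<in> ?C" by blast
    have car: "s \<in> carrier G" "c \<in> carrier G" "t \<in> carrier G" "d \<in> carrier G" using sc by auto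
    have "a \<otimes> b = s \<otimes> (c \<otimes> t) \<otimes> d" using car sc by (simp add: m_assoc)
    also have "\<dots> = s \<otimes> t \<otimes> (c \<otimes> d)" unfolding cs[OF sc(5,3)] using car by (simp add: m_assoc)
    finally show "a \<otimes> b \<in> ?J" using sc S.m_closed[OF sc(2,5)] C.m_closed[OF sc(3,6)] by blast
  qed
  let ?U = "\<Union>g\<in>carrier G. conjug g ` S"
  have Uc: "?U \<subseteq> carrier G" by auto
  \<comment> \<open>A conjugate of \<open>S\<close> either is \<open>S\<close> or centralizes
    \<open>S\<close>. So all conjugates lie in \<open>?J\<close>, and with them \<open>N\<close>,
    which they generate by minimality.\<close>
  have UJ: "?U \<subseteq> ?J"
  proof
    fix x assume "x \<in> ?U"
    then obtain g where g: "g \<in> carrier G" "x \<in> conjug g ` S" by blast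
    have xN: "x \<in> N" by (rule subsetD[OF SgN[OF g(1)] g(2)])
    show "x \<in> ?J"
    proof (cases "conjug g ` S = S")
      case True
      then have "x \<in> S" using g by simp
      moreover have "x = x \<otimes> \<one>" using xN by simp
      ultimately show ?thesis using C.one_closed by blast
    next
      case False
      have "x \<in> cent S" using commute[OF g(1) False g(2)] xN by (intro centI) auto
      moreover have "x = \<one> \<otimes> x" using xN by simp
      ultimately show ?thesis using xN S.one_closed by blast
    qed
  qed
  have gen: "generate G ?U \<lhd> G"
  proof (rule normal_generateI[OF Uc])
    fix h g assume "h \<in> ?U" "g \<in> carrier G"
    then obtain k s where k: "k \<in> carrier G" "s \<in> S" "h = conjug k s" by blast
    have "g \<otimes> h \<otimes> inv g = conjug (g \<otimes> k) s"
      using k \<open>g \<in> carrier G\<close> conjug_conjug[of g k s] by (simp add: conjug_def[of g])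
    then show "g \<otimes> h \<otimes> inv g \<in> ?U" using k \<open>g \<in> carrier G\<close> by blast
  qed
  have SU: "S \<subseteq> ?U"
  proof
    fix s assume s: "s \<in> S"
    then have "s = conjug \<one> s" by simp
    then show "s \<in> ?U" using s one_closed by blast
  qed
  obtain s0 where s0: "s0 \<in> S" "s0 \<noteq> \<one>" using SN(3) S.one_closed by blast
  have "s0 \<in> generate G ?U" by (rule generate.incl[OF subsetD[OF SU s0(1)]])
  then have gen1: "generate G ?U \<noteq> {\<one>}" using s0(2) by blast
  have "?U \<subseteq> N" using SgN by blast
  then have "generate G ?U \<subseteq> N" by (rule generate_subgroup_incl[OF _ N.subgroup_axioms])
  then have "generate G ?U = N" by (rule min[OF gen gen1])
  then have NJ: "N \<subseteq> ?J" using generate_subgroup_incl[OF UJ Jsub] by simp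
  \<comment> \<open>If all conjugates coincided with \<open>S\<close>, then \<open>S\<close> would
    be normal in \<open>G\<close> and equal to \<open>N\<close> by minimality of
    \<open>N\<close>.\<close>
  have "\<exists>g\<in>carrier G. conjug g ` S \<noteq> S"
  proof (rule ccontr)
    assume "\<not> ?thesis"
    then have inv: "conjug g ` S = S" if "g \<in> carrier G" for g using that by blast
    have "S \<lhd> G"
    proof (rule normal_invI[OF S.subgroup_axioms])
      fix g s assume "g \<in> carrier G" "s \<in> S"
      then have "conjug g s \<in> S" using inv[of g] by blast
      then show "g \<otimes> s \<otimes> inv g \<in> S" by (simp add: conjug_def)
    qed
    then show False using min[of S] SN SneN by blast
  qed
  then obtain g where g: "g \<in> carrier G" "conjug g ` S \<noteq> S" by blast
  let ?b = "conjug g s0"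
  show thesis
  proof (rule that[of S ?b])
    show "S \<subseteq> carrier G" by (rule S.subset)
    show bc: "?b \<in> carrier G" using g s0 by simp
    show "?b \<noteq> \<one>" using g s0 by (simp add: conjug_eq_one_iff)
    show "?b \<in> cent S" by (rule centI[OF bc commute[OF g imageI[OF s0(1)]]])
    show "\<forall>x\<in>N - {\<one>}. \<exists>s\<in>S. s \<noteq> \<one> \<and> x \<otimes> s = s \<otimes> x"
    proof
      fix x assume "x \<in> N - {\<one>}"
      then obtain s c where sc: "x = s \<otimes> c" "s \<in> S" "c \<in> ?C" using NJ by blast
      have car: "s \<in> carrier G" "c \<in> carrier G" using sc by auto
      show "\<exists>s\<in>S. s \<noteq> \<one> \<and> x \<otimes> s = s \<otimes> x"
      proof (cases "s = \<one>")
        case True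
        then have "x = c" using sc car by simp
        then show ?thesis using s0 cs[OF s0(1) sc(3)] by blast
      next
        case False
        have "x \<otimes> s = s \<otimes> (c \<otimes> s)" using car sc(1) by (simp add: m_assoc)
        also have "\<dots> = s \<otimes> x" unfolding cs[OF sc(2,3)] sc(1) ..
        finally show ?thesis using False sc(2) by blast
      qed
    qed
  qed
qed

definition commuting_graph :: "('a \<times> 'a) set" where
  "commuting_graph = {(x, y). x \<in> carrier G - {\<one>} \<and> y \<in> carrier G - {\<one>} \<and> x \<otimes> y = y \<otimes> x}"

text \<open>Let \<open>N\<close> be a minimal normal subgroup. If some \<open>c \<noteq> 1\<close>
  centralizes \<open>N\<close>, it links any two elements; \<open>c\<close> and hence the paths may
  leave \<open>N\<close>. Otherwise \<open>N\<close> is not simple, since \<open>G\<close> is not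
  almost simple, and the paths have the form \<open>x, s, b, t, y\<close> with \<open>s\<close> and
  \<open>t\<close> in \<open>S\<close> and the hub \<open>b\<close> of
  \<open>commuting_hub_of_nonsimple\<close>.\<close>

lemma commuting_connected_normal_subgroup:
  assumes fin: "finite (carrier G)" and ne: "carrier G \<noteq> {\<one>}" and nas: "\<not> almost_simple_group G"
  obtains N where "N \<lhd> G" "N \<noteq> {\<one>}"
    "\<forall>x\<in>N - {\<one>}. \<forall>y\<in>N - {\<one>}. (x, y) \<in> commuting_graph\<^sup>*"
proof -
  let ?P = "\<lambda>L. L \<lhd> G \<and> L \<noteq> {\<one>}"
  have P: "?P (carrier G)" using ne normal_self by blast
  obtain N where N: "?P N" "\<And>L. ?P L \<Longrightarrow> L \<subseteq> N \<Longrightarrow> L = N"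
    using minimal_subset_exists[of ?P "carrier G", OF fin P] normal_imp_subgroup subgroup.subset
    by (metis (no_types, lifting))
  interpret N: normal N G using N by blast
  show thesis
  proof (rule that[of N])
    show "N \<lhd> G" "N \<noteq> {\<one>}" using N by auto
    show "\<forall>x\<in>N - {\<one>}. \<forall>y\<in>N - {\<one>}. (x, y) \<in> commuting_graph\<^sup>*"
    proof (intro ballI)
      fix x y assume xy: "x \<in> N - {\<one>}" "y \<in> N - {\<one>}"
      have xyc: "x \<in> carrier G - {\<one>}" "y \<in> carrier G - {\<one>}" using xy by auto
      show "(x, y) \<in> commuting_graph\<^sup>*"
      proof (cases "cent N = {\<one>}")
        case False
        moreover have "\<one> \<in> cent N" by (rule subgroup.one_closed[OF subgroup_cent[OF N.subset]])
        ultimately obtain c where c: "c \<in> cent N" "c \<noteq> \<one>" by blast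
        have "c \<in> carrier G" using c cent_subset by blast
        moreover have "c \<otimes> x = x \<otimes> c" "c \<otimes> y = y \<otimes> c" using c xy centD by blast+
        ultimately have "(x, c) \<in> commuting_graph" "(c, y) \<in> commuting_graph"
          using xyc c(2) by (simp_all add: commuting_graph_def)
        then show ?thesis by (meson converse_rtrancl_into_rtrancl r_into_rtrancl)
      next
        case True
        then obtain L where L: "subgroup L G" "L \<subseteq> N" "N \<subseteq> setnorm L" "L \<noteq> N" "L \<noteq> {\<one>}"
          using almost_simple_groupI[OF fin N.normal_axioms _ True] N(1) nas by blast
        have min: "L = N" if "L \<lhd> G" "L \<noteq> {\<one>}" "L \<subseteq> N" for L using N(2) that by blast
        obtain S b where Sb: "S \<subseteq> carrier G" "b \<in> carrier G" "b \<noteq> \<one>" "b \<in> cent S"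
          and hub: "\<forall>x\<in>N - {\<one>}. \<exists>s\<in>S. s \<noteq> \<one> \<and> x \<otimes> s = s \<otimes> x"
          by (rule commuting_hub_of_nonsimple[OF fin N.normal_axioms min L])
        obtain s t where st: "s \<in> S" "s \<noteq> \<one>" "x \<otimes> s = s \<otimes> x" "t \<in> S" "t \<noteq> \<one>" "y \<otimes> t = t \<otimes> y"
          using hub xy by blast
        have "s \<in> carrier G" "t \<in> carrier G" "b \<otimes> s = s \<otimes> b" "b \<otimes> t = t \<otimes> b"
          using st Sb centD by blast+
        then have "(x, s) \<in> commuting_graph" "(s, b) \<in> commuting_graph" "(b, t) \<in> commuting_graph"
          "(t, y) \<in> commuting_graph"
          using xyc st Sb by (simp_all add: commuting_graph_def)
        then show ?thesis by (meson converse_rtrancl_into_rtrancl r_into_rtrancl)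
      qed
    qed
  qed
qed

end

subsection \<open>The Engel graph\<close>

lemma (in group) commutator_closed [simp]:
  "a \<in> carrier G \<Longrightarrow> b \<in> carrier G \<Longrightarrow> commutator G a b \<in> carrier G"
  by (simp add: commutator_def)

lemma (in group) engel_commutator_closed [simp]:
  "x \<in> carrier G \<Longrightarrow> y \<in> carrier G \<Longrightarrow> engel_commutator G x n y \<in> carrier G"
  by (induction n) simp_all

lemma engel_commutator_add:
  "engel_commutator G x (m + n) y = engel_commutator G (engel_commutator G x m y) n y"
  by (induction n) simp_all

lemma (in group_hom) hom_engel_commutator:
  "x \<in> carrier G \<Longrightarrow> y \<in> carrier G \<Longrightarrow>
    h (engel_commutator G x n y) = engel_commutator H (h x) n (h y)"
  by (induction n) (simp_all add: commutator_def)

context group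
begin

definition engel :: "'a \<Rightarrow> 'a \<Rightarrow> bool" where
  "engel x y \<longleftrightarrow> (\<exists>n>0. engel_commutator G x n y = \<one>)"

lemma commutator_eq_one_iff:
  assumes "x \<in> carrier G" "y \<in> carrier G"
  shows "commutator G x y = \<one> \<longleftrightarrow> x \<otimes> y = y \<otimes> x"
proof -
  have "commutator G x y = inv (y \<otimes> x) \<otimes> (x \<otimes> y)" using assms by (simp add: commutator_def group_word_simps)
  then show ?thesis using assms inv_solve_left'[of \<one> "y \<otimes> x" "x \<otimes> y"] by simp
qed

lemma engel_of_commute: "x \<in> carrier G \<Longrightarrow> y \<in> carrier G \<Longrightarrow> x \<otimes> y = y \<otimes> x \<Longrightarrow> engel x y"
  unfolding engel_def by (rule exI[of _ 1]) (simp add: commutator_eq_one_iff)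

text \<open>\<open>[x, y]\<close> lies in \<open>A\<close> and therefore commutes with
  \<open>y\<close>, so two commutator steps suffice. This is applied to the abelian subgroup
  \<open>V\<close> and to \<open>cyc b\<close>.\<close>

lemma engel_of_setnorm:
  assumes fin: "finite (carrier G)" and A: "subgroup A G" "\<And>a b. a \<in> A \<Longrightarrow> b \<in> A \<Longrightarrow> a \<otimes> b = b \<otimes> a"
    and x: "x \<in> setnorm A" and y: "y \<in> A"
  shows "engel x y"
proof -
  interpret A: subgroup A G by (rule A(1))
  have xc: "x \<in> carrier G" using x by (simp add: setnorm_def)
  have yc: "y \<in> carrier G" using y by simp
  have "inv x \<in> setnorm A"
    using subgroup.m_inv_closed[OF subgroup_setnorm[OF finite_subset[OF A.subset fin] A.subset] x] .
  then have "conjug (inv x) (inv y) \<otimes> y \<in> A" using setnormD y by (intro A.m_closed) auto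
  moreover have "conjug (inv x) (inv y) \<otimes> y = commutator G x y"
    using xc yc by (simp add: conjug_def commutator_def)
  ultimately have "commutator G (commutator G x y) y = \<one>"
    using A(2) y xc yc by (simp add: commutator_eq_one_iff)
  then show ?thesis unfolding engel_def by (intro exI[of _ 2]) (simp add: numeral_2_eq_2)
qed

definition engel_rel :: "('a \<times> 'a) set" where
  "engel_rel = {(x, y). x \<in> carrier G - {\<one>} \<and> y \<in> carrier G - {\<one>} \<and> engel x y}"

lemma commuting_graph_subset_engel_rel: "commuting_graph \<subseteq> engel_rel"
  by (auto simp: commuting_graph_def engel_rel_def intro: engel_of_commute)

lemma engel_rel_into_normal_subgroup:
  assumes fin: "finite (carrier G)" and M: "M \<lhd> G" "M \<noteq> {\<one>}" and x: "x \<in> carrier G" "x \<noteq> \<one>"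
  obtains m where "m \<in> M - {\<one>}" "(x, m) \<in> engel_rel"
proof -
  interpret M: normal M G by (rule M(1))
  show thesis
  proof (cases "\<exists>m\<in>M. m \<noteq> \<one> \<and> conjug x m = m")
    case True
    then obtain m where m: "m \<in> M" "m \<noteq> \<one>" "conjug x m = m" by blast
    have mc: "m \<in> carrier G" using m by simp
    have "engel x m" using engel_of_commute[OF x(1) mc] m(3) conjug_fix_iff[OF x(1) mc] by simp
    then show ?thesis using that[of m] m x mc by (simp add: engel_rel_def)
  next
    case False
    have xM: "x \<in> setnorm M"
      by (rule setnormI[OF x(1)]) (use M.inv_op_closed2[OF x(1)] in \<open>simp add: conjug_def\<close>)
    have fpf: "m = \<one>" if "m \<in> M" "conjug x m = m" for m using False that by blast
    obtain V where V: "subgroup V G" "V \<subseteq> M" "V \<noteq> {\<one>}" "\<forall>v\<in>V. \<forall>w\<in>V. v \<otimes> w = w \<otimes> v" "x \<in> setnorm V"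
      "setnorm M \<inter> setnorm (cyc x) \<subseteq> setnorm V"
      by (rule exists_normalized_abelian_subgroup[OF fin xM M.subgroup_axioms M(2) fpf])
    obtain m where m: "m \<in> V" "m \<noteq> \<one>" using V(3) subgroup.one_closed[OF V(1)] by blast
    have "engel x m" by (rule engel_of_setnorm[OF fin V(1) bspec[OF bspec[OF V(4)]] V(5) m(1)])
    then show ?thesis
      using that[of m] m x V(2) subgroup.mem_carrier[OF V(1) m(1)] by (auto simp: engel_rel_def)
  qed
qed

lemma engel_rel_connected:
  assumes fin: "finite (carrier G)" and nas: "\<not> almost_simple_group G"
    and nofrob: "\<not> (\<exists>H. subgroup H G \<and> H \<noteq> {\<one>} \<and> H \<noteq> carrier G
      \<and> (\<forall>g\<in>carrier G - H. H \<inter> conjug g ` H = {\<one>}))"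
    and xy: "x \<in> carrier G - {\<one>}" "y \<in> carrier G - {\<one>}"
  shows "(x, y) \<in> engel_rel\<^sup>*"
proof -
  have ne: "carrier G \<noteq> {\<one>}" using xy by blast
  obtain M where M: "M \<lhd> G" "M \<noteq> {\<one>}" and
    conn: "\<forall>x\<in>M - {\<one>}. \<forall>y\<in>M - {\<one>}. (x, y) \<in> commuting_graph\<^sup>*"
    by (rule commuting_connected_normal_subgroup[OF fin ne nas])
  interpret M: normal M G by (rule M(1))
  have conn': "(u, v) \<in> engel_rel\<^sup>*" if "u \<in> M - {\<one>}" "v \<in> M - {\<one>}" for u v
    using conn that rtrancl_mono[OF commuting_graph_subset_engel_rel] by blast
  obtain m0 where m0: "m0 \<in> M - {\<one>}" using M(2) M.one_closed by blast
  \<comment> \<open>Since the elements of \<open>M - {1}\<close> reach each other, those unreachable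
    from the single element \<open>m0\<close> are those unreachable from all of
    \<open>M - {1}\<close>.\<close>
  define B where "B = {b \<in> carrier G - {\<one>}. (m0, b) \<notin> engel_rel\<^sup>*}"
  have "B = {}"
  proof (rule ccontr)
    assume ne: "B \<noteq> {}"
    have 1: "B \<inter> M = {}" using conn'[OF m0] by (auto simp: B_def)
    have 2: "B \<subseteq> carrier G" "\<one> \<notin> B" by (auto simp: B_def)
    have 3: "z \<in> B" if bz: "b \<in> B" "z \<in> setnorm (cyc b)" "z \<noteq> \<one>" for b z
    proof (rule ccontr)
      have b: "b \<in> carrier G" "b \<noteq> \<one>" "(m0, b) \<notin> engel_rel\<^sup>*" using bz(1) by (auto simp: B_def)
      have zc: "z \<in> carrier G" using bz(2) by (simp add: setnorm_def)
      assume "z \<notin> B"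
      then have "(m0, z) \<in> engel_rel\<^sup>*" using zc bz(3) by (simp add: B_def)
      moreover have "u \<otimes> v = v \<otimes> u" if "u \<in> cyc b" "v \<in> cyc b" for u v
        using that unfolding cyc_eq[OF fin b(1)] by (auto simp: nat_pow_mult[OF b(1)] add.commute)
      then have "engel z b" by (rule engel_of_setnorm[OF fin subgroup_cyc[OF b(1)] _ bz(2) in_cyc])
      then have "(z, b) \<in> engel_rel" using zc bz(3) b by (simp add: engel_rel_def)
      ultimately show False using b(3) by (meson rtrancl.rtrancl_into_rtrancl)
    qed
    show False by (rule notE[OF nofrob frobenius_complement_exists[OF fin M 1 2 _ ne]]) (rule 3)
  qed
  then have "(m0, y) \<in> engel_rel\<^sup>*" using xy(2) by (auto simp: B_def)
  moreover obtain m where "m \<in> M - {\<one>}" "(x, m) \<in> engel_rel"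
    using engel_rel_into_normal_subgroup[OF fin M] xy(1) by blast
  ultimately show ?thesis using conn'[OF _ m0] by (meson converse_rtrancl_into_rtrancl rtrancl_trans)
qed

text \<open>If \<open>[z, h] \<in> H\<close>, then the conjugate \<open>z\<^sup>-\<^sup>1 h\<^sup>-\<^sup>1 z\<close> lies in \<open>H \<inter> z\<^sup>-\<^sup>1 H z\<close>.\<close>

lemma engel_into_TI_subgroup:
  assumes H: "subgroup H G" and TI: "\<And>g. g \<in> carrier G - H \<Longrightarrow> H \<inter> conjug g ` H = {\<one>}"
    and x: "x \<in> carrier G" and h: "h \<in> H" "h \<noteq> \<one>" and "engel x h"
  shows "x \<in> H"
proof -
  interpret H: subgroup H G by (rule H)
  have hc: "h \<in> carrier G" using h by simp
  have step: "z \<in> H" if z: "z \<in> carrier G" "commutator G z h \<in> H" for z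
  proof (rule ccontr)
    assume "z \<notin> H"
    then have TIz: "H \<inter> conjug (inv z) ` H = {\<one>}"
      using TI[of "inv z"] z H.m_inv_closed[of "inv z"] by auto
    have "commutator G z h \<otimes> inv h \<in> H" using z h by simp
    moreover have "commutator G z h \<otimes> inv h = conjug (inv z) (inv h)"
      using z hc by (simp add: commutator_def conjug_def m_assoc)
    ultimately have "conjug (inv z) (inv h) \<in> H \<inter> conjug (inv z) ` H" using h by auto
    then have "conjug (inv z) (inv h) = \<one>" using TIz by blast
    then show False using z hc h(2) by (simp add: conjug_eq_one_iff)
  qed
  \<comment> \<open>Membership in \<open>H\<close> passes from each Engel commutator to the
    preceding one; starting with the trivial one, it arrives at \<open>x\<close>.\<close>
  have descend: "engel_commutator G x n h \<in> H \<Longrightarrow> x \<in> H" for n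
  proof (induction n)
    case (Suc n)
    then have "commutator G (engel_commutator G x n h) h \<in> H" by simp
    then show ?case using Suc.IH step[OF engel_commutator_closed[OF x hc]] by blast
  qed simp
  obtain n where "engel_commutator G x n h = \<one>" using assms(6) unfolding engel_def by blast
  then show ?thesis using descend[of n] H.one_closed by simp
qed

section \<open>The hypercenter and the passage to the quotient\<close>

lemma commutator_upper_central:
  assumes z: "z \<in> upper_central G (Suc i)" and y: "y \<in> carrier G"
  shows "commutator G z y \<in> upper_central G i"
proof -
  let ?N = "upper_central G i"
  have N: "?N \<lhd> G" by (rule upper_central_normal)
  interpret N: normal ?N G by (rule N)
  have zc: "z \<in> carrier G" and eq: "?N #> (z \<otimes> y) = ?N #> (y \<otimes> z)"
    using z y unfolding upper_central_Suc_iff[OF N] by auto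
  have "z \<otimes> y \<in> ?N #> (y \<otimes> z)" using rcos_self[OF _ N.subgroup_axioms, of "z \<otimes> y"] zc y eq by simp
  then obtain t where t: "t \<in> ?N" "z \<otimes> y = t \<otimes> (y \<otimes> z)" by (auto simp: r_coset_def)
  have "commutator G z y = inv (y \<otimes> z) \<otimes> (z \<otimes> y)" using zc y by (simp add: commutator_def group_word_simps)
  also have "\<dots> = inv (y \<otimes> z) \<otimes> t \<otimes> (y \<otimes> z)" using t zc y N.mem_carrier[OF t(1)] by (simp add: m_assoc)
  also have "\<dots> \<in> ?N" using N.inv_op_closed1[OF _ t(1), of "y \<otimes> z"] zc y by simp
  finally show ?thesis .
qed

text \<open>Each commutator with \<open>y\<close> goes down one term of the series. This bounds the
  number of further steps that turn an Engel commutator in the hypercenter into the unit.\<close>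

lemma engel_commutator_upper_central:
  assumes "z \<in> upper_central G i" "y \<in> carrier G"
  shows "engel_commutator G z i y = \<one>"
  using assms
proof (induction i arbitrary: z)
  case (Suc i)
  have "engel_commutator G z (1 + i) y = engel_commutator G (engel_commutator G z 1 y) i y"
    by (rule engel_commutator_add)
  also have "\<dots> = \<one>" using Suc.IH[OF commutator_upper_central[OF Suc.prems]] Suc.prems(2) by simp
  finally show ?case by simp
qed simp

lemma frobenius_group_iff:
  "frobenius_group G \<longleftrightarrow> (\<exists>H. subgroup H G \<and> H \<noteq> {\<one>} \<and> H \<noteq> carrier G
    \<and> (\<forall>g\<in>carrier G - H. H \<inter> conjug g ` H = {\<one>}))"
proof -
  have "g <#\<^bsub>G\<^esub> H #>\<^bsub>G\<^esub> inv g = conjug g ` H" for g H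
    by (auto simp: l_coset_def r_coset_def conjug_def)
  then show ?thesis by (simp add: frobenius_group_def is_group)
qed

text \<open>Edges can be tested in the quotient: an Engel commutator that is trivial modulo the
  hypercenter is killed by \<open>c\<close> more steps. The vertices are the elements with
  nontrivial image, so paths can be projected and lifted.\<close>

lemma engel_graph_connected_iff:
  assumes fin: "finite (carrier G)" and nas: "\<not> almost_simple_group (G Mod hypercenter G)"
  shows "empty_or_strongly_connected (engel_graph G) \<longleftrightarrow> \<not> frobenius_group (G Mod hypercenter G)"
proof -
  let ?Z = "hypercenter G" and ?K = "G Mod hypercenter G" and ?\<Gamma> = "engel_graph G"
  obtain c where c: "upper_central G c = ?Z" using hypercenter_eq_upper_central[OF fin] by blast
  interpret Z: normal ?Z G using upper_central_normal[of c] c by simp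
  interpret K: group ?K by (rule Z.factorgroup_is_group)
  define \<pi> where "\<pi> x = ?Z #> x" for x
  interpret \<pi>: group_hom G ?K \<pi>
    by unfold_locales (use Z.r_coset_hom_Mod in \<open>simp add: \<pi>_def[abs_def]\<close>)
  have finK: "finite (carrier ?K)" using fin by (simp add: carrier_FactGroup)
  have surj: "\<exists>x\<in>carrier G. q = \<pi> x" if "q \<in> carrier ?K" for q
    using that by (auto simp: carrier_FactGroup \<pi>_def)
  have \<pi>_one: "\<pi> x = \<one>\<^bsub>?K\<^esub> \<longleftrightarrow> x \<in> ?Z" if "x \<in> carrier G" for x
    using coset_join1[OF _ that Z.subgroup_axioms] coset_join2[OF that Z.subgroup_axioms] by (auto simp: \<pi>_def)
  have \<pi>_engel: "K.engel (\<pi> x) (\<pi> y) \<longleftrightarrow> engel x y" if xy: "x \<in> carrier G" "y \<in> carrier G" for x y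
  proof
    assume "engel x y"
    then obtain n where n: "n > 0" "engel_commutator G x n y = \<one>" by (auto simp: engel_def)
    then have "engel_commutator ?K (\<pi> x) n (\<pi> y) = \<one>\<^bsub>?K\<^esub>"
      using \<pi>.hom_engel_commutator[OF xy, of n, symmetric] \<pi>.hom_one by simp
    then show "K.engel (\<pi> x) (\<pi> y)" using n(1) by (auto simp: K.engel_def)
  next
    assume "K.engel (\<pi> x) (\<pi> y)"
    then obtain n where n: "n > 0" "engel_commutator ?K (\<pi> x) n (\<pi> y) = \<one>\<^bsub>?K\<^esub>" by (auto simp: K.engel_def)
    then have "engel_commutator G x n y \<in> upper_central G c"
      using \<pi>.hom_engel_commutator[OF xy, of n] \<pi>_one[of "engel_commutator G x n y"] xy c by simp
    then have "engel_commutator G x (n + c) y = \<one>"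
      using engel_commutator_upper_central xy by (simp add: engel_commutator_add)
    then show "engel x y" using n(1) unfolding engel_def by (intro exI[of _ "n + c"]) simp
  qed
  have verts: "verts ?\<Gamma> = {x \<in> carrier G. \<pi> x \<in> carrier ?K - {\<one>\<^bsub>?K\<^esub>}}"
    using \<pi>_one by (auto simp: engel_graph_def)
  have arcs: "(x, y) \<in> arcs_ends ?\<Gamma> \<longleftrightarrow> x \<in> verts ?\<Gamma> \<and> y \<in> verts ?\<Gamma> \<and> engel x y" for x y
    by (force simp: engel_graph_def arcs_ends_def arc_to_ends_def engel_def)
  show ?thesis
  proof
    assume conn: "empty_or_strongly_connected ?\<Gamma>"
    show "\<not> frobenius_group ?K"
    proof
      assume "frobenius_group ?K"
      then obtain H where H: "subgroup H ?K" "H \<noteq> {\<one>\<^bsub>?K\<^esub>}" "H \<noteq> carrier ?K"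
        "\<forall>g\<in>carrier ?K - H. H \<inter> K.conjug g ` H = {\<one>\<^bsub>?K\<^esub>}"
        unfolding K.frobenius_group_iff by blast
      interpret H: subgroup H ?K by (rule H(1))
      obtain p where p: "p \<in> H" "p \<noteq> \<one>\<^bsub>?K\<^esub>" using H(2) H.one_closed by blast
      obtain q where q: "q \<in> carrier ?K" "q \<notin> H" using H(3) H.subset by blast
      obtain x y where xy: "x \<in> carrier G" "q = \<pi> x" "y \<in> carrier G" "p = \<pi> y"
        using surj q(1) H.subset p(1) by (meson subsetD)
      have "q \<noteq> \<one>\<^bsub>?K\<^esub>" using q(2) H.one_closed by blast
      then have xv: "x \<in> verts ?\<Gamma>" unfolding verts using xy(1,2) q(1) by blast
      have yv: "y \<in> verts ?\<Gamma>" unfolding verts using xy(3,4) p subsetD[OF H.subset p(1)] by blast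
      \<comment> \<open>The path is followed backwards from \<open>y\<close>: every predecessor of a
        vertex mapped into \<open>H - {1}\<close> is itself mapped into \<open>H\<close>.\<close>
      have "(x, y) \<in> rtrancl_on (verts ?\<Gamma>) (arcs_ends ?\<Gamma>)"
        using conn xv yv unfolding empty_or_strongly_connected_def strongly_connected_def reachable_def by blast
      then have "\<pi> x \<in> H"
      proof (induction rule: converse_rtrancl_on_induct)
        case base
        then show ?case using p xy by simp
      next
        case (step u v)
        have uv: "u \<in> carrier G" "v \<in> carrier G" "\<pi> v \<noteq> \<one>\<^bsub>?K\<^esub>" "engel u v"
          using step.hyps(1,3,4) unfolding arcs unfolding verts by blast+
        show ?case
        proof (rule K.engel_into_TI_subgroup[OF H(1)])
          show "K.engel (\<pi> u) (\<pi> v)" using \<pi>_engel uv by blast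
          show "H \<inter> K.conjug g ` H = {\<one>\<^bsub>?K\<^esub>}" if "g \<in> carrier ?K - H" for g
            by (rule bspec[OF H(4) that])
        qed (rule \<pi>.hom_closed[OF uv(1)], rule step.IH, rule uv(3))
      qed
      then show False using q xy by simp
    qed
  next
    assume nf: "\<not> frobenius_group ?K"
    have "(u, v) \<in> rtrancl_on (verts ?\<Gamma>) (arcs_ends ?\<Gamma>)" if uv: "u \<in> verts ?\<Gamma>" "v \<in> verts ?\<Gamma>" for u v
    proof -
      have uv': "u \<in> carrier G" "v \<in> carrier G" "\<pi> u \<in> carrier ?K - {\<one>\<^bsub>?K\<^esub>}" "\<pi> v \<in> carrier ?K - {\<one>\<^bsub>?K\<^esub>}"
        using uv unfolding verts by auto
      have "(\<pi> u, \<pi> v) \<in> K.engel_rel\<^sup>*"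
        using K.engel_rel_connected[OF finK nas _ uv'(3,4)] nf K.frobenius_group_iff by blast
      \<comment> \<open>The claim covers the whole fibre over the end point, because a path in the
        quotient lifts only up to the choice of preimages. Vertices of one fibre are adjacent since
        their images coincide and so commute.\<close>
      then have "\<forall>w\<in>verts ?\<Gamma>. \<pi> w = \<pi> v \<longrightarrow> (u, w) \<in> rtrancl_on (verts ?\<Gamma>) (arcs_ends ?\<Gamma>)"
      proof (induction rule: rtrancl_induct)
        case base
        show ?case
        proof (intro ballI impI)
          fix w assume w: "w \<in> verts ?\<Gamma>" "\<pi> w = \<pi> u"
          then have wc: "w \<in> carrier G" unfolding verts by simp
          have "K.engel (\<pi> u) (\<pi> w)" using w uv' K.engel_of_commute[of "\<pi> u" "\<pi> u"] by simp
          then have "(u, w) \<in> arcs_ends ?\<Gamma>" using arcs uv(1) w(1) \<pi>_engel[OF uv'(1) wc] by blast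
          then show "(u, w) \<in> rtrancl_on (verts ?\<Gamma>) (arcs_ends ?\<Gamma>)"
            using rtrancl_on_into_rtrancl_on[OF rtrancl_on_refl[OF uv(1)] _ w(1)] by blast
        qed
      next
        case (step q q')
        show ?case
        proof (intro ballI impI)
          fix w' assume w': "w' \<in> verts ?\<Gamma>" "\<pi> w' = q'"
          have q: "q \<in> carrier ?K" "q \<noteq> \<one>\<^bsub>?K\<^esub>" "K.engel q q'" using step(2) by (auto simp: K.engel_rel_def)
          obtain w where w: "w \<in> carrier G" "q = \<pi> w" using surj[OF q(1)] by blast
          have wv: "w \<in> verts ?\<Gamma>" using w q unfolding verts by simp
          have w'c: "w' \<in> carrier G" using w'(1) unfolding verts by simp
          have "engel w w'" using q(3) \<pi>_engel[OF w(1) w'c] w(2) w'(2) by simp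
          then have A: "(w, w') \<in> arcs_ends ?\<Gamma>" using arcs wv w'(1) by blast
          have R: "(u, w) \<in> rtrancl_on (verts ?\<Gamma>) (arcs_ends ?\<Gamma>)"
            by (rule step.IH[rule_format, OF wv w(2)[symmetric]])
          show "(u, w') \<in> rtrancl_on (verts ?\<Gamma>) (arcs_ends ?\<Gamma>)"
            by (rule rtrancl_on_into_rtrancl_on[OF R A w'(1)])
        qed
      qed
      then show ?thesis using uv(2) by blast
    qed
    then show "empty_or_strongly_connected ?\<Gamma>"
      unfolding empty_or_strongly_connected_def strongly_connected_def reachable_def by blast
  qed
qed

end

theorem theorem1p2:
  fixes G :: "('a, 'b) monoid_scheme"
  assumes "group G" and "finite (carrier G)"
    and "\<not> almost_simple_group (G Mod hypercenter G)"
  shows "empty_or_strongly_connected (engel_graph G)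
    \<longleftrightarrow> \<not> frobenius_group (G Mod hypercenter G)"
  by (rule group.engel_graph_connected_iff[OF assms])

end
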